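(* Let $(\mathfrak{g},J)$ be a Lie algebra with complex structure and let $(\mathfrak{g},J_t)$ be a small deformation of $(\mathfrak{g},J)$, where $J_t$ is the complex structure on $\mathfrak{g}$ determined by some $\phi=\phi(t)\in\Lambda^{0,1}\otimes\mathfrak{g}^{1,0}$. Assume $\mathfrak{E}$ is a $\mathfrak{g}^{0,1}$-module formed by tensor products or wedge products of $\mathfrak{g}^{1,0}$ and $\mathfrak{g}^{1,0*}$, and let $\mathfrak{E}_t$ be the corresponding $\mathfrak{g}_t^{0,1}$-module. Then $$H^{0,\bullet}_{\bar\partial_t}(\mathfrak{E}_t)\cong H^{0,\bullet}_{\bar\partial_\phi}(\mathfrak{E}),$$ where $H^{0,\bullet}_{\bar\partial_t}(\mathfrak{E}_t)$ is the cohomology of the complex $(\Lambda^{0,\bullet}_{\mathfrak{g}_t}\otimes\mathfrak{E}_t,\bar\partial_t)$ and $H^{0,\bullet}_{\bar\partial_\phi}(\mathfrak{E})$ is the cohomology of $(\Lambda^{0,\bullet}\otimes\mathfrak{E},\bar\partial_\phi)$.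
   Context: A Lie algebra with complex structure $(\mathfrak{g},J)$ is a finite-dimensional real Lie algebra $\mathfrak{g}$ of even dimension $2n$ with an $\mathbb{R}$-linear $J:\mathfrak{g}\to\mathfrak{g}$ such that $J^2=-1$ and $[JX,JY]-[X,Y]-J[JX,Y]-J[X,JY]=0$ for all $X,Y\in\mathfrak{g}$. Let $\mathfrak{g}_{\mathbb{C}}=\mathfrak{g}\otimes_{\mathbb{R}}\mathbb{C}=\mathfrak{g}^{1,0}\oplus\mathfrak{g}^{0,1}$ ($\pm\sqrt{-1}$-eigenspaces of $J$), $\Lambda^{p,q}=\wedge^p\mathfrak{g}^{1,0*}\otimes\wedge^q\mathfrak{g}^{0,1*}\subset\wedge^{p+q}\mathfrak{g}_{\mathbb{C}}^*$. The Chevalley-Eilenberg differential $d$ (antiderivation with $d\omega(x,y)=-\omega([x,y])$ for $\omega\in\mathfrak{g}_{\mathbb C}^*$) splits as $d=\partial+\bar\partial$ by bidegree. Modules: $\mathfrak{g}^{0,1}$ acts on $\mathfrak{g}^{1,0}$ by $\bar X\cdot Y=\mathrm{pr}^{1,0}[\bar X,Y]$ and on $\mathfrak{g}^{1,0*}$ by $\bar X\cdot\omega=i_{\bar X}\bar\partial\omega$, and on tensor and wedge products of these by the Leibniz rule; this gives the module $\mathfrak{E}$. On $\Lambda^{0,\bullet}\otimes\mathfrak{E}$, $\bar\partial$ is the Chevalley-Eilenberg differential: $(\bar\partial e)(\bar X)=\bar X\cdot e$ for $e\in\mathfrak{E}$, and $\bar\partial(\eta\otimes e)=\bar\partial\eta\otimes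 e+(-1)^q\eta\wedge\bar\partial e$ for $\eta\in\Lambda^{0,q}$. In particular this defines $\bar\partial$ on $\Lambda^{0,\bullet}\otimes\mathfrak{g}^{1,0}$. Bracket: the Fröhlicher-Nijenhuis bracket on $\Lambda^{0,1}\otimes\mathfrak{g}^{1,0}$ is the bilinear map into $\Lambda^{0,2}\otimes\mathfrak{g}^{1,0}$ with $[\varphi\otimes X,\psi\otimes Y]=\varphi\wedge\psi\otimes[X,Y]-(i_Yd\varphi\wedge\psi\otimes X+i_Xd\psi\wedge\varphi\otimes Y+(i_Y\varphi)d\psi\otimes X+(i_X\psi)d\varphi\otimes Y)$; for $Y\in\mathfrak{g}^{1,0}$, $[\varphi\otimes X,Y]=\varphi\otimes[X,Y]-i_Yd\varphi\otimes X\in\Lambda^{0,1}\otimes\mathfrak{g}^{1,0}$. Small deformation: $\phi=\phi(t)\in\Lambda^{0,1}\otimes\mathfrak{g}^{1,0}$ is a member, for small $t$, of a family holomorphic in $t$ (over an analytic subset $B\ni 0$ of a polydisc) with $\phi(0)=0$ and $\bar\partial\phi(t)=\frac12[\phi(t),\phi(t)]$. It determines the complex structure $J_t$ on $\mathfrak{g}$ with $\mathfrak{g}_t^{0,1}=(1-\phi)\mathfrak{g}^{0,1}$ and $\mathfrak{g}_t^{1,0}=(1-\bar\phi)\mathfrak{g}^{1,0}$. The objects $\Lambda^{p,q}_{\mathfrak{g}_t}$, $d=\partial_t+\bar\partial_t$ and $\mathfrak{E}_t$ with its operator $\bar\partial_t$ on $\Lambda^{0,\bullet}_{\mathfrak{g}_t}\otimes\mathfrak{E}_t$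 are those obtained from $(\mathfrak{g},J_t)$ by the same constructions, $\mathfrak{E}_t$ being formed from $\mathfrak{g}_t^{1,0}$ and $\mathfrak{g}_t^{1,0*}$ exactly as $\mathfrak{E}$ is formed from $\mathfrak{g}^{1,0}$ and $\mathfrak{g}^{1,0*}$. Deformed operator: write $\phi=\sum_\alpha\phi^\alpha\otimes z_\alpha$ with $\{z_\alpha\}$ a basis of $\mathfrak{g}^{1,0}$, let $i_\phi=\sum_\alpha\phi^\alpha\wedge i_{z_\alpha}$ on $\wedge\mathfrak{g}_{\mathbb{C}}^*$ and $\mathcal{L}_\phi^{1,0}=i_\phi\partial-\partial i_\phi$. Then $\bar\partial_\phi:\Lambda^{0,\bullet}\otimes\mathfrak{E}\to\Lambda^{0,\bullet+1}\otimes\mathfrak{E}$ is the operator equal to $\bar\partial-\mathcal{L}_\phi^{1,0}$ on $\Lambda^{0,\bullet}$, to $Y\mapsto\bar\partial Y-[\phi,Y]$ on $\mathfrak{g}^{1,0}$, to $\omega\mapsto\bar\partial\omega-\mathcal{L}_\phi^{1,0}\omega$ on $\mathfrak{g}^{1,0*}$ (with $\Lambda^{1,1}$ identified with $\Lambda^{0,1}\otimes\mathfrak{g}^{1,0*}$ via $\bar\theta\wedge\omega\leftrightarrow\bar\theta\otimes\omega$), extended to tensor and wedge products $\mathfrak{E}$ by the Leibniz rule (with the $\Lambda^{0,1}$ factor moved to the left) and to $\Lambda^{0,q}\otimes\mathfrak{E}$ by $\bar\partial_\phi(\eta\otimes e)=(\bar\partial_\phi\eta)\otimes e+(-1)^q\eta\wedge\bar\partial_\phi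 e$. *)

theory Defs
  imports "HOL-Analysis.Analysis" "HOL-Library.Function_Algebras"
    "HOL-Combinatorics.Permutations"
begin

section \<open>Complexification\<close>

text \<open>
  The complexification of a real vector space \<open>'g\<close> is \<open>'g \<times> 'g\<close>; the pair \<open>(x, y)\<close>
  stands for \<open>x + \<i> y\<close>.
\<close>

definition cscale :: "complex \<Rightarrow> 'g::real_vector \<times> 'g \<Rightarrow> 'g \<times> 'g" where
  "cscale c w = (Re c *\<^sub>R fst w - Im c *\<^sub>R snd w, Re c *\<^sub>R snd w + Im c *\<^sub>R fst w)"

definition cconj :: "'g::real_vector \<times> 'g \<Rightarrow> 'g \<times> 'g" where
  "cconj w = (fst w, - snd w)"

interpretation cvs: vector_space "cscale :: complex \<Rightarrow> 'g::real_vector \<times> 'g \<Rightarrow> 'g \<times> 'g"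
  by unfold_locales (auto simp: cscale_def algebra_simps)

definition fscale :: "complex \<Rightarrow> ('x \<Rightarrow> complex) \<Rightarrow> 'x \<Rightarrow> complex" where
  "fscale c f = (\<lambda>x. c * f x)"

interpretation fvs: vector_space "fscale :: complex \<Rightarrow> ('x \<Rightarrow> complex) \<Rightarrow> 'x \<Rightarrow> complex"
  by unfold_locales (auto simp: fscale_def fun_eq_iff algebra_simps)

definition cdual :: "('g::real_vector \<times> 'g \<Rightarrow> complex) set" where
  "cdual = {\<xi>. Vector_Spaces.linear cscale (*) \<xi>}"

definition cbr :: "('g::real_vector \<Rightarrow> 'g \<Rightarrow> 'g) \<Rightarrow> 'g \<times> 'g \<Rightarrow> 'g \<times> 'g \<Rightarrow> 'g \<times> 'g" where
  "cbr br u v = (br (fst u) (fst v) - br (snd u) (snd v), br (fst u) (snd v) + br (snd u) (fst v))"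


section \<open>Lie algebras with complex structure\<close>

definition lie_bracket :: "('g::real_vector \<Rightarrow> 'g \<Rightarrow> 'g) \<Rightarrow> bool" where
  "lie_bracket br \<longleftrightarrow> bilinear br \<and> (\<forall>x. br x x = 0) \<and>
     (\<forall>x y z. br x (br y z) + br y (br z x) + br z (br x y) = 0)"

definition complex_structure :: "('g::real_vector \<Rightarrow> 'g \<Rightarrow> 'g) \<Rightarrow> ('g \<Rightarrow> 'g) \<Rightarrow> bool" where
  "complex_structure br J \<longleftrightarrow> linear J \<and> (\<forall>x. J (J x) = - x) \<and>
     (\<forall>x y. br (J x) (J y) - br x y - J (br (J x) y) - J (br x (J y)) = 0)"

definition lie_algebra_with_complex_structure ::
    "('g::real_vector \<Rightarrow> 'g \<Rightarrow> 'g) \<Rightarrow> ('g \<Rightarrow> 'g) \<Rightarrow> bool" where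
  "lie_algebra_with_complex_structure br J \<longleftrightarrow>
     (\<exists>S. finite S \<and> span S = (UNIV :: 'g set)) \<and> even (dim (UNIV :: 'g set)) \<and>
     lie_bracket br \<and> complex_structure br J"

definition cJ :: "('g::real_vector \<Rightarrow> 'g) \<Rightarrow> 'g \<times> 'g \<Rightarrow> 'g \<times> 'g" where
  "cJ J w = (J (fst w), J (snd w))"

definition g10 :: "('g::real_vector \<Rightarrow> 'g) \<Rightarrow> ('g \<times> 'g) set" where
  "g10 J = {w. cJ J w = cscale \<i> w}"

definition g01 :: "('g::real_vector \<Rightarrow> 'g) \<Rightarrow> ('g \<times> 'g) set" where
  "g01 J = {w. cJ J w = cscale (- \<i>) w}"

definition pr10 :: "('g::real_vector \<Rightarrow> 'g) \<Rightarrow> 'g \<times> 'g \<Rightarrow> 'g \<times> 'g" where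
  "pr10 J w = cscale (1/2) (w - cscale \<i> (cJ J w))"

definition pr01 :: "('g::real_vector \<Rightarrow> 'g) \<Rightarrow> 'g \<times> 'g \<Rightarrow> 'g \<times> 'g" where
  "pr01 J w = cscale (1/2) (w + cscale \<i> (cJ J w))"

text \<open>The dual of \<open>g10 J\<close>, as the annihilator of \<open>g01 J\<close> in the dual of the complexification.\<close>

definition g10_dual :: "('g::real_vector \<Rightarrow> 'g) \<Rightarrow> ('g \<times> 'g \<Rightarrow> complex) set" where
  "g10_dual J = {\<omega> \<in> cdual. \<forall>x \<in> g01 J. \<omega> x = 0}"

definition is_basis10 :: "('g::real_vector \<Rightarrow> 'g) \<Rightarrow> ('g \<times> 'g) set \<Rightarrow> bool" where
  "is_basis10 J Z \<longleftrightarrow> \<not> cvs.dependent Z \<and> cvs.span Z = g10 J"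


section \<open>Forms\<close>

text \<open>
  A \<open>k\<close>-form on the complexification is an alternating complex multilinear function of \<open>k\<close>
  vectors, represented as a function on lists vanishing on all lists of length other than \<open>k\<close>.
  The wedge product is normalised by
  \<open>(\<alpha> \<and> \<beta>)(x, y) = \<alpha>(x) \<beta>(y) - \<alpha>(y) \<beta>(x)\<close> for 1-forms.
\<close>

definition forms :: "nat \<Rightarrow> (('g::real_vector \<times> 'g) list \<Rightarrow> complex) set" where
  "forms k = {\<omega>. (\<forall>xs. length xs \<noteq> k \<longrightarrow> \<omega> xs = 0) \<and>
     (\<forall>xs i. length xs = k \<longrightarrow> i < k \<longrightarrow> (\<lambda>x. \<omega> (xs[i := x])) \<in> cdual) \<and>
     (\<forall>xs i j. length xs = k \<longrightarrow> i < j \<longrightarrow> j < k \<longrightarrow> xs ! i = xs ! j \<longrightarrow> \<omega> xs = 0)}"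

definition Lam :: "('g::real_vector \<Rightarrow> 'g) \<Rightarrow> nat \<Rightarrow> nat \<Rightarrow> (('g \<times> 'g) list \<Rightarrow> complex) set" where
  "Lam J p q = {\<omega> \<in> forms (p + q).
     \<forall>xs. set xs \<subseteq> g10 J \<union> g01 J \<longrightarrow> length (filter (\<lambda>x. x \<in> g10 J) xs) \<noteq> p \<longrightarrow> \<omega> xs = 0}"

definition one_form :: "('c \<Rightarrow> complex) \<Rightarrow> 'c list \<Rightarrow> complex" where
  "one_form \<theta> = (\<lambda>xs. if length xs = 1 then \<theta> (hd xs) else 0)"

definition contr :: "'c \<Rightarrow> ('c list \<Rightarrow> complex) \<Rightarrow> 'c list \<Rightarrow> complex" where
  "contr x \<omega> = (\<lambda>xs. \<omega> (x # xs))"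

definition wedge :: "nat \<Rightarrow> nat \<Rightarrow> ('c list \<Rightarrow> complex) \<Rightarrow> ('c list \<Rightarrow> complex) \<Rightarrow> 'c list \<Rightarrow> complex"
  where "wedge p q \<alpha> \<beta> = (\<lambda>xs. if length xs = p + q then
     (\<Sum>\<sigma> | \<sigma> permutes {..<p + q}. of_int (sign \<sigma>) *
        \<alpha> (map (\<lambda>i. xs ! \<sigma> i) [0..<p]) * \<beta> (map (\<lambda>i. xs ! \<sigma> i) [p..<p + q])) / (fact p * fact q)
     else 0)"

text \<open>
  The Chevalley--Eilenberg differential with trivial coefficients; on a 1-form it is
  \<open>(d\<omega>)(x, y) = - \<omega>([x, y])\<close>.
\<close>

definition ce_d :: "('g::real_vector \<Rightarrow> 'g \<Rightarrow> 'g) \<Rightarrow> (('g \<times> 'g) list \<Rightarrow> complex) \<Rightarrow> ('g \<times> 'g) list \<Rightarrow> complex"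
  where "ce_d br \<omega> = (\<lambda>xs. \<Sum>j<length xs. \<Sum>i<j.
     (-1) ^ (i + j) * \<omega> (cbr br (xs ! i) (xs ! j) # nths xs (- {i, j})))"

text \<open>The component of bidegree \<open>(p, q)\<close> of a \<open>(p + q)\<close>-form.\<close>

definition bideg :: "('g::real_vector \<Rightarrow> 'g) \<Rightarrow> nat \<Rightarrow> nat \<Rightarrow> (('g \<times> 'g) list \<Rightarrow> complex) \<Rightarrow> ('g \<times> 'g) list \<Rightarrow> complex"
  where "bideg J p q \<omega> = (\<lambda>xs. if length xs = p + q then
     (\<Sum>S | S \<subseteq> {..<p + q} \<and> card S = p.
        \<omega> (map (\<lambda>i. if i \<in> S then pr10 J (xs ! i) else pr01 J (xs ! i)) [0..<p + q]))
     else 0)"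

text \<open>\<open>del br J p q\<close> and \<open>delbar br J p q\<close> are the components of the differential on \<open>Lam J p q\<close>.\<close>

definition del :: "('g::real_vector \<Rightarrow> 'g \<Rightarrow> 'g) \<Rightarrow> ('g \<Rightarrow> 'g) \<Rightarrow> nat \<Rightarrow> nat \<Rightarrow>
    (('g \<times> 'g) list \<Rightarrow> complex) \<Rightarrow> ('g \<times> 'g) list \<Rightarrow> complex" where
  "del br J p q \<omega> = bideg J (Suc p) q (ce_d br \<omega>)"

definition delbar :: "('g::real_vector \<Rightarrow> 'g \<Rightarrow> 'g) \<Rightarrow> ('g \<Rightarrow> 'g) \<Rightarrow> nat \<Rightarrow> nat \<Rightarrow>
    (('g \<times> 'g) list \<Rightarrow> complex) \<Rightarrow> ('g \<times> 'g) list \<Rightarrow> complex" where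
  "delbar br J p q \<omega> = bideg J p (Suc q) (ce_d br \<omega>)"


section \<open>Modules formed by tensor and wedge products\<close>

text \<open>
  \<open>Tan\<close> stands for the (1,0)-part of the complexification, \<open>Cot\<close> for its dual and \<open>Wedge k M\<close>
  for the \<open>k\<close>-th exterior power of \<open>M\<close>.
\<close>

datatype mexp = Tan | Cot | Tensor mexp mexp | Wedge nat mexp

primrec arity :: "mexp \<Rightarrow> nat" where
  "arity Tan = 1"
| "arity Cot = 1"
| "arity (Tensor A B) = arity A + arity B"
| "arity (Wedge k A) = k * arity A"

text \<open>
  Tensors are multilinear functionals of lists of arguments: a factor \<open>Tan\<close> takes a covector, a
  factor \<open>Cot\<close> takes a vector.  A tensor for \<open>M\<close> vanishes on lists of length other than \<open>arity M\<close>.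
\<close>

datatype 'c arg = Vec 'c | Cov "'c \<Rightarrow> complex"

type_synonym 'g tens = "('g \<times> 'g) arg list \<Rightarrow> complex"

definition vec_tensor :: "'g::real_vector \<times> 'g \<Rightarrow> 'g tens" where
  "vec_tensor v = (\<lambda>as. case as of [Cov \<xi>] \<Rightarrow> if \<xi> \<in> cdual then \<xi> v else 0 | _ \<Rightarrow> 0)"

definition cov_tensor :: "('g::real_vector \<times> 'g \<Rightarrow> complex) \<Rightarrow> 'g tens" where
  "cov_tensor \<omega> = (\<lambda>as. case as of [Vec u] \<Rightarrow> \<omega> u | _ \<Rightarrow> 0)"

definition tensor :: "nat \<Rightarrow> ('a list \<Rightarrow> complex) \<Rightarrow> ('a list \<Rightarrow> complex) \<Rightarrow> 'a list \<Rightarrow> complex" where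
  "tensor m e f = (\<lambda>as. e (take m as) * f (drop m as))"

definition block :: "nat \<Rightarrow> nat \<Rightarrow> 'a list \<Rightarrow> 'a list" where
  "block m i as = take m (drop (i * m) as)"

text \<open>
  The wedge product of tensors \<open>es\<close> of arity \<open>m\<close>, realised as the antisymmetrised tensor
  \<open>\<Sum>\<sigma>. sign \<sigma> e\<^sub>\<sigma>\<^sub>0 \<otimes> e\<^sub>\<sigma>\<^sub>1 \<otimes> \<dots>\<close>.
\<close>

definition wedge_tensor :: "nat \<Rightarrow> ('a list \<Rightarrow> complex) list \<Rightarrow> 'a list \<Rightarrow> complex" where
  "wedge_tensor m es = (\<lambda>as. if length as = length es * m then
     (\<Sum>\<sigma> | \<sigma> permutes {..<length es}. of_int (sign \<sigma>) *
        (\<Prod>i<length es. (es ! \<sigma> i) (block m i as)))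
     else 0)"

primrec espace :: "('g::real_vector \<Rightarrow> 'g) \<Rightarrow> mexp \<Rightarrow> 'g tens set" where
  "espace J Tan = vec_tensor ` g10 J"
| "espace J Cot = cov_tensor ` g10_dual J"
| "espace J (Tensor A B) = fvs.span {tensor (arity A) e f | e f. e \<in> espace J A \<and> f \<in> espace J B}"
| "espace J (Wedge k A) = fvs.span {wedge_tensor (arity A) es | es. length es = k \<and> set es \<subseteq> espace J A}"

text \<open>
  Given \<open>\<delta>V Y \<in> \<Lambda>\<^sup>0\<^sup>,\<^sup>1 \<otimes> g10 J\<close> for \<open>Y\<close> in \<open>g10 J\<close> and
  \<open>\<delta>W \<omega> \<in> \<Lambda>\<^sup>0\<^sup>,\<^sup>1 \<otimes> g10_dual J\<close> for \<open>\<omega>\<close> in \<open>g10_dual J\<close> (both as functions of a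
  vector \<open>x\<close>), \<open>leibniz J \<delta>V \<delta>W M e\<close> is the extension to \<open>e \<in> espace J M\<close> by the Leibniz rule.
  On a tensor product it is the sum of the operators acting on one of the factors only; acting on one
  factor means holding the arguments of the other factors fixed.  The rule on decomposable elements
  is stated in \<open>leibniz_tensor\<close> and \<open>leibniz_wedge\<close> below.
\<close>

primrec leibniz :: "('g::real_vector \<Rightarrow> 'g) \<Rightarrow> ('g \<times> 'g \<Rightarrow> 'g \<times> 'g \<Rightarrow> 'g \<times> 'g) \<Rightarrow>
    (('g \<times> 'g \<Rightarrow> complex) \<Rightarrow> 'g \<times> 'g \<Rightarrow> 'g \<times> 'g \<Rightarrow> complex) \<Rightarrow>
    mexp \<Rightarrow> 'g tens \<Rightarrow> 'g \<times> 'g \<Rightarrow> 'g tens" where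
  "leibniz J \<delta>V \<delta>W Tan = (\<lambda>e x. vec_tensor (\<delta>V (THE Y. Y \<in> g10 J \<and> e = vec_tensor Y) x))"
| "leibniz J \<delta>V \<delta>W Cot = (\<lambda>e x. cov_tensor (\<delta>W (\<lambda>u. e [Vec u]) x))"
| "leibniz J \<delta>V \<delta>W (Tensor A B) = (\<lambda>e x as.
     if length as = arity A + arity B then
       leibniz J \<delta>V \<delta>W A (\<lambda>bs. e (bs @ drop (arity A) as)) x (take (arity A) as) +
       leibniz J \<delta>V \<delta>W B (\<lambda>bs. e (take (arity A) as @ bs)) x (drop (arity A) as)
     else 0)"
| "leibniz J \<delta>V \<delta>W (Wedge k A) = (\<lambda>e x as.
     if length as = k * arity A then
       (\<Sum>i<k. leibniz J \<delta>V \<delta>W A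
          (\<lambda>bs. e (take (i * arity A) as @ bs @ drop (Suc i * arity A) as)) x (block (arity A) i as))
     else 0)"


section \<open>Cochains with values in a module\<close>

text \<open>
  An element of \<open>\<Lambda>\<^sup>0\<^sup>,\<^sup>q \<otimes> espace J M\<close> is a function of a list of \<open>q\<close> vectors and a list of
  tensor arguments.
\<close>

definition cotensor :: "('c list \<Rightarrow> complex) \<Rightarrow> ('a list \<Rightarrow> complex) \<Rightarrow> 'c list \<times> 'a list \<Rightarrow> complex" where
  "cotensor \<eta> e = (\<lambda>(xs, as). \<eta> xs * e as)"

definition cochains :: "('g::real_vector \<Rightarrow> 'g) \<Rightarrow> mexp \<Rightarrow> nat \<Rightarrow>
    (('g \<times> 'g) list \<times> ('g \<times> 'g) arg list \<Rightarrow> complex) set" where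
  "cochains J M q = fvs.span {cotensor \<eta> e | \<eta> e. \<eta> \<in> Lam J 0 q \<and> e \<in> espace J M}"

text \<open>
  The operator \<open>\<eta> \<otimes> e \<mapsto> d\<eta> \<otimes> e + (-1)\<^sup>q \<eta> \<and> \<delta>e\<close> on cochains of degree \<open>q\<close>, where
  \<open>\<delta>e \<in> \<Lambda>\<^sup>0\<^sup>,\<^sup>1 \<otimes> espace J M\<close>; the second summand antisymmetrises as in \<open>wedge q 1\<close>.
  See \<open>ext_op_cotensor\<close> below.
\<close>

definition ext_op :: "(('c list \<Rightarrow> complex) \<Rightarrow> 'c list \<Rightarrow> complex) \<Rightarrow>
    (('a list \<Rightarrow> complex) \<Rightarrow> 'c \<Rightarrow> 'a list \<Rightarrow> complex) \<Rightarrow> nat \<Rightarrow>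
    ('c list \<times> 'a list \<Rightarrow> complex) \<Rightarrow> 'c list \<times> 'a list \<Rightarrow> complex" where
  "ext_op d \<delta> q F = (\<lambda>(xs, as). d (\<lambda>ys. F (ys, as)) xs + (-1) ^ q *
     (if length xs = q + 1 then
       (\<Sum>\<sigma> | \<sigma> permutes {..<q + 1}. of_int (sign \<sigma>) *
          \<delta> (\<lambda>bs. F (map (\<lambda>i. xs ! \<sigma> i) [0..<q], bs)) (xs ! \<sigma> q) as) / fact q
      else 0))"

definition act_vec :: "('g::real_vector \<Rightarrow> 'g \<Rightarrow> 'g) \<Rightarrow> ('g \<Rightarrow> 'g) \<Rightarrow> 'g \<times> 'g \<Rightarrow> 'g \<times> 'g \<Rightarrow> 'g \<times> 'g" where
  "act_vec br J Y x = pr10 J (cbr br (pr01 J x) Y)"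

definition act_cov :: "('g::real_vector \<Rightarrow> 'g \<Rightarrow> 'g) \<Rightarrow> ('g \<Rightarrow> 'g) \<Rightarrow>
    ('g \<times> 'g \<Rightarrow> complex) \<Rightarrow> 'g \<times> 'g \<Rightarrow> 'g \<times> 'g \<Rightarrow> complex" where
  "act_cov br J \<omega> x = (\<lambda>u. contr (pr01 J x) (delbar br J 1 0 (one_form \<omega>)) [u])"

definition dbar :: "('g::real_vector \<Rightarrow> 'g \<Rightarrow> 'g) \<Rightarrow> ('g \<Rightarrow> 'g) \<Rightarrow> mexp \<Rightarrow> nat \<Rightarrow>
    (('g \<times> 'g) list \<times> ('g \<times> 'g) arg list \<Rightarrow> complex) \<Rightarrow>
    ('g \<times> 'g) list \<times> ('g \<times> 'g) arg list \<Rightarrow> complex" where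
  "dbar br J M q = ext_op (delbar br J 0 q) (leibniz J (act_vec br J) (act_cov br J) M) q"


section \<open>Deformations\<close>

text \<open>
  An element of \<open>\<Lambda>\<^sup>0\<^sup>,\<^sup>1 \<otimes> g10 J\<close> is a complex linear endomorphism of the complexification that
  vanishes on \<open>g10 J\<close> and takes values in \<open>g10 J\<close>.
\<close>

definition Lam01_T10 :: "('g::real_vector \<Rightarrow> 'g) \<Rightarrow> ('g \<times> 'g \<Rightarrow> 'g \<times> 'g) set" where
  "Lam01_T10 J = {\<phi>. Vector_Spaces.linear cscale cscale \<phi> \<and> (\<forall>x \<in> g10 J. \<phi> x = 0) \<and> range \<phi> \<subseteq> g10 J}"

text \<open>The (0,1)-form \<open>\<phi>\<^sup>z\<close> in \<open>\<phi> = (\<Sum>z\<in>Z. \<phi>\<^sup>z \<otimes> z)\<close>.\<close>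

definition coord :: "('g::real_vector \<times> 'g) set \<Rightarrow> ('g \<times> 'g \<Rightarrow> 'g \<times> 'g) \<Rightarrow> 'g \<times> 'g \<Rightarrow> ('g \<times> 'g) list \<Rightarrow> complex" where
  "coord Z \<phi> z = one_form (\<lambda>x. cvs.representation Z (\<phi> x) z)"

definition fn_bracket_dec :: "('g::real_vector \<Rightarrow> 'g \<Rightarrow> 'g) \<Rightarrow> (('g \<times> 'g) list \<Rightarrow> complex) \<Rightarrow> 'g \<times> 'g \<Rightarrow>
    (('g \<times> 'g) list \<Rightarrow> complex) \<Rightarrow> 'g \<times> 'g \<Rightarrow> ('g \<times> 'g) list \<Rightarrow> 'g \<times> 'g" where
  "fn_bracket_dec br \<theta> X \<psi> Y = (\<lambda>xs. cscale (wedge 1 1 \<theta> \<psi> xs) (cbr br X Y) -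
     (cscale (wedge 1 1 (contr Y (ce_d br \<theta>)) \<psi> xs) X +
      cscale (wedge 1 1 (contr X (ce_d br \<psi>)) \<theta> xs) Y +
      cscale (contr Y \<theta> [] * ce_d br \<psi> xs) X +
      cscale (contr X \<psi> [] * ce_d br \<theta> xs) Y))"

definition fn_bracket :: "('g::real_vector \<Rightarrow> 'g \<Rightarrow> 'g) \<Rightarrow> ('g \<times> 'g) set \<Rightarrow> ('g \<times> 'g \<Rightarrow> 'g \<times> 'g) \<Rightarrow>
    ('g \<times> 'g \<Rightarrow> 'g \<times> 'g) \<Rightarrow> ('g \<times> 'g) list \<Rightarrow> 'g \<times> 'g" where
  "fn_bracket br Z \<phi> \<psi> = (\<lambda>xs. \<Sum>z\<in>Z. \<Sum>w\<in>Z. fn_bracket_dec br (coord Z \<phi> z) z (coord Z \<psi> w) w xs)"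

definition fn_bracket_vec_dec :: "('g::real_vector \<Rightarrow> 'g \<Rightarrow> 'g) \<Rightarrow> (('g \<times> 'g) list \<Rightarrow> complex) \<Rightarrow> 'g \<times> 'g \<Rightarrow>
    'g \<times> 'g \<Rightarrow> ('g \<times> 'g) list \<Rightarrow> 'g \<times> 'g" where
  "fn_bracket_vec_dec br \<theta> X Y = (\<lambda>xs. cscale (\<theta> xs) (cbr br X Y) - cscale (contr Y (ce_d br \<theta>) xs) X)"

definition fn_bracket_vec :: "('g::real_vector \<Rightarrow> 'g \<Rightarrow> 'g) \<Rightarrow> ('g \<times> 'g) set \<Rightarrow> ('g \<times> 'g \<Rightarrow> 'g \<times> 'g) \<Rightarrow>
    'g \<times> 'g \<Rightarrow> ('g \<times> 'g) list \<Rightarrow> 'g \<times> 'g" where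
  "fn_bracket_vec br Z \<phi> Y = (\<lambda>xs. \<Sum>z\<in>Z. fn_bracket_vec_dec br (coord Z \<phi> z) z Y xs)"

definition vec_cochain :: "(('g::real_vector \<times> 'g) list \<Rightarrow> 'g \<times> 'g) \<Rightarrow>
    ('g \<times> 'g) list \<times> ('g \<times> 'g) arg list \<Rightarrow> complex" where
  "vec_cochain G = (\<lambda>(xs, as). vec_tensor (G xs) as)"

definition maurer_cartan :: "('g::real_vector \<Rightarrow> 'g \<Rightarrow> 'g) \<Rightarrow> ('g \<Rightarrow> 'g) \<Rightarrow> ('g \<times> 'g) set \<Rightarrow>
    ('g \<times> 'g \<Rightarrow> 'g \<times> 'g) \<Rightarrow> bool" where
  "maurer_cartan br J Z \<phi> \<longleftrightarrow>
     dbar br J Tan 1 (vec_cochain (\<lambda>xs. if length xs = 1 then \<phi> (hd xs) else 0)) =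
     vec_cochain (\<lambda>xs. cscale (1/2) (fn_bracket br Z \<phi> \<phi> xs))"

definition determines :: "('g::real_vector \<Rightarrow> 'g \<Rightarrow> 'g) \<Rightarrow> ('g \<Rightarrow> 'g) \<Rightarrow> ('g \<times> 'g \<Rightarrow> 'g \<times> 'g) \<Rightarrow>
    ('g \<Rightarrow> 'g) \<Rightarrow> bool" where
  "determines br J \<phi> J' \<longleftrightarrow> complex_structure br J' \<and>
     g01 J' = (\<lambda>x. x - \<phi> x) ` g01 J \<and>
     g10 J' = (\<lambda>x. x - cconj (\<phi> (cconj x))) ` g10 J"

definition holomorphic_several :: "(complex ^ 'm) set \<Rightarrow> (complex ^ 'm \<Rightarrow> complex) \<Rightarrow> bool" where
  "holomorphic_several U f \<longleftrightarrow>
     (\<forall>t\<in>U. \<exists>D. (f has_derivative D) (at t) \<and> (\<forall>c v. D (c *s v) = c * D v))"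

definition polydisc :: "real ^ 'm \<Rightarrow> (complex ^ 'm) set" where
  "polydisc r = {t. \<forall>i. cmod (t $ i) < r $ i}"

definition analytic_subset :: "(complex ^ 'm) set \<Rightarrow> (complex ^ 'm) set \<Rightarrow> bool" where
  "analytic_subset \<Delta> B \<longleftrightarrow> B \<subseteq> \<Delta> \<and>
     (\<forall>p\<in>\<Delta>. \<exists>U fs. open U \<and> p \<in> U \<and> U \<subseteq> \<Delta> \<and> finite fs \<and> (\<forall>f\<in>fs. holomorphic_several U f) \<and>
        B \<inter> U = {t \<in> U. \<forall>f\<in>fs. f t = 0})"

text \<open>
  Holomorphy on an analytic subset: local extendability to a holomorphic map on an open set of the
  ambient space.
\<close>

definition holomorphic_family :: "('g::real_vector \<Rightarrow> 'g) \<Rightarrow> (complex ^ 'm) set \<Rightarrow>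
    (complex ^ 'm \<Rightarrow> 'g \<times> 'g \<Rightarrow> 'g \<times> 'g) \<Rightarrow> bool" where
  "holomorphic_family J B \<phi> \<longleftrightarrow> (\<forall>t\<in>B. \<phi> t \<in> Lam01_T10 J) \<and>
     (\<forall>p\<in>B. \<exists>U \<Phi>. open U \<and> p \<in> U \<and> (\<forall>t\<in>U. \<Phi> t \<in> Lam01_T10 J) \<and> (\<forall>t\<in>B \<inter> U. \<Phi> t = \<phi> t) \<and>
        (\<forall>x. \<forall>\<xi>\<in>cdual. holomorphic_several U (\<lambda>t. \<xi> (\<Phi> t x))))"


section \<open>The deformed operator\<close>

text \<open>\<open>ins Z \<phi> k\<close> is \<open>i\<^sub>\<phi>\<close> on \<open>k\<close>-forms.\<close>

definition ins :: "('g::real_vector \<times> 'g) set \<Rightarrow> ('g \<times> 'g \<Rightarrow> 'g \<times> 'g) \<Rightarrow> nat \<Rightarrow>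
    (('g \<times> 'g) list \<Rightarrow> complex) \<Rightarrow> ('g \<times> 'g) list \<Rightarrow> complex" where
  "ins Z \<phi> k \<omega> = (\<Sum>z\<in>Z. wedge 1 (k - 1) (coord Z \<phi> z) (contr z \<omega>))"

text \<open>
  \<open>lie10\<close> is \<open>i\<^sub>\<phi> \<partial> - \<partial> i\<^sub>\<phi>\<close> on \<open>Lam J p q\<close>.  The truncated \<open>p - 1\<close> is harmless, because \<open>i\<^sub>\<phi>\<close>
  vanishes on \<open>Lam J 0 q\<close>.
\<close>

definition lie10 :: "('g::real_vector \<Rightarrow> 'g \<Rightarrow> 'g) \<Rightarrow> ('g \<Rightarrow> 'g) \<Rightarrow> ('g \<times> 'g) set \<Rightarrow> ('g \<times> 'g \<Rightarrow> 'g \<times> 'g) \<Rightarrow>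
    nat \<Rightarrow> nat \<Rightarrow> (('g \<times> 'g) list \<Rightarrow> complex) \<Rightarrow> ('g \<times> 'g) list \<Rightarrow> complex" where
  "lie10 br J Z \<phi> p q \<omega> =
     ins Z \<phi> (p + q + 1) (del br J p q \<omega>) - del br J (p - 1) (q + 1) (ins Z \<phi> (p + q) \<omega>)"

definition delbar_phi :: "('g::real_vector \<Rightarrow> 'g \<Rightarrow> 'g) \<Rightarrow> ('g \<Rightarrow> 'g) \<Rightarrow> ('g \<times> 'g) set \<Rightarrow> ('g \<times> 'g \<Rightarrow> 'g \<times> 'g) \<Rightarrow>
    nat \<Rightarrow> nat \<Rightarrow> (('g \<times> 'g) list \<Rightarrow> complex) \<Rightarrow> ('g \<times> 'g) list \<Rightarrow> complex" where
  "delbar_phi br J Z \<phi> p q \<omega> = delbar br J p q \<omega> - lie10 br J Z \<phi> p q \<omega>"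

definition phi_vec :: "('g::real_vector \<Rightarrow> 'g \<Rightarrow> 'g) \<Rightarrow> ('g \<Rightarrow> 'g) \<Rightarrow> ('g \<times> 'g) set \<Rightarrow> ('g \<times> 'g \<Rightarrow> 'g \<times> 'g) \<Rightarrow>
    'g \<times> 'g \<Rightarrow> 'g \<times> 'g \<Rightarrow> 'g \<times> 'g" where
  "phi_vec br J Z \<phi> Y x = act_vec br J Y x - fn_bracket_vec br Z \<phi> Y [x]"

text \<open>
  The identification of \<open>\<Lambda>\<^sup>1\<^sup>,\<^sup>1\<close> with \<open>\<Lambda>\<^sup>0\<^sup>,\<^sup>1 \<otimes> g10_dual J\<close> that sends \<open>\<theta> \<and> \<omega>\<close>, with \<open>\<theta>\<close> of
  type (0,1) and \<open>\<omega>\<close> of type (1,0), to \<open>\<theta> \<otimes> \<omega>\<close>; see \<open>split11_wedge\<close> below.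
\<close>

definition split11 :: "('g::real_vector \<Rightarrow> 'g) \<Rightarrow> (('g \<times> 'g) list \<Rightarrow> complex) \<Rightarrow> 'g \<times> 'g \<Rightarrow> 'g \<times> 'g \<Rightarrow> complex" where
  "split11 J G x = (\<lambda>u. G [pr01 J x, pr10 J u])"

definition phi_cov :: "('g::real_vector \<Rightarrow> 'g \<Rightarrow> 'g) \<Rightarrow> ('g \<Rightarrow> 'g) \<Rightarrow> ('g \<times> 'g) set \<Rightarrow> ('g \<times> 'g \<Rightarrow> 'g \<times> 'g) \<Rightarrow>
    ('g \<times> 'g \<Rightarrow> complex) \<Rightarrow> 'g \<times> 'g \<Rightarrow> 'g \<times> 'g \<Rightarrow> complex" where
  "phi_cov br J Z \<phi> \<omega> = split11 J (delbar_phi br J Z \<phi> 1 0 (one_form \<omega>))"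

definition dbar_phi :: "('g::real_vector \<Rightarrow> 'g \<Rightarrow> 'g) \<Rightarrow> ('g \<Rightarrow> 'g) \<Rightarrow> ('g \<times> 'g) set \<Rightarrow> ('g \<times> 'g \<Rightarrow> 'g \<times> 'g) \<Rightarrow>
    mexp \<Rightarrow> nat \<Rightarrow> (('g \<times> 'g) list \<times> ('g \<times> 'g) arg list \<Rightarrow> complex) \<Rightarrow>
    ('g \<times> 'g) list \<times> ('g \<times> 'g) arg list \<Rightarrow> complex" where
  "dbar_phi br J Z \<phi> M q =
     ext_op (delbar_phi br J Z \<phi> 0 q) (leibniz J (phi_vec br J Z \<phi>) (phi_cov br J Z \<phi>) M) q"


section \<open>Cohomology\<close>

definition cocycles :: "(nat \<Rightarrow> ('x \<Rightarrow> complex) set) \<Rightarrow> (nat \<Rightarrow> ('x \<Rightarrow> complex) \<Rightarrow> 'x \<Rightarrow> complex) \<Rightarrow>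
    nat \<Rightarrow> ('x \<Rightarrow> complex) set" where
  "cocycles C D q = {F \<in> C q. D q F = 0}"

definition coboundaries :: "(nat \<Rightarrow> ('x \<Rightarrow> complex) set) \<Rightarrow> (nat \<Rightarrow> ('x \<Rightarrow> complex) \<Rightarrow> 'x \<Rightarrow> complex) \<Rightarrow>
    nat \<Rightarrow> ('x \<Rightarrow> complex) set" where
  "coboundaries C D q = (case q of 0 \<Rightarrow> {0} | Suc p \<Rightarrow> D p ` C p)"

text \<open>Cohomology classes are cosets of the space of coboundaries.\<close>

definition cohomology :: "(nat \<Rightarrow> ('x \<Rightarrow> complex) set) \<Rightarrow> (nat \<Rightarrow> ('x \<Rightarrow> complex) \<Rightarrow> 'x \<Rightarrow> complex) \<Rightarrow>
    nat \<Rightarrow> ('x \<Rightarrow> complex) set set" where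
  "cohomology C D q = (\<lambda>F. F +o coboundaries C D q) ` cocycles C D q"

definition class_scale :: "(nat \<Rightarrow> ('x \<Rightarrow> complex) set) \<Rightarrow> (nat \<Rightarrow> ('x \<Rightarrow> complex) \<Rightarrow> 'x \<Rightarrow> complex) \<Rightarrow>
    nat \<Rightarrow> complex \<Rightarrow> ('x \<Rightarrow> complex) set \<Rightarrow> ('x \<Rightarrow> complex) set" where
  "class_scale C D q c K = fscale c ` K + coboundaries C D q"

text \<open>
  Complex linear isomorphism in degree \<open>q\<close>.  The sum of two classes is their elementwise sum
  (\<^theory>\<open>HOL-Library.Set_Algebras\<close>).
\<close>

definition cohomology_iso :: "(nat \<Rightarrow> ('x \<Rightarrow> complex) set) \<Rightarrow> (nat \<Rightarrow> ('x \<Rightarrow> complex) \<Rightarrow> 'x \<Rightarrow> complex) \<Rightarrow>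
    (nat \<Rightarrow> ('y \<Rightarrow> complex) set) \<Rightarrow> (nat \<Rightarrow> ('y \<Rightarrow> complex) \<Rightarrow> 'y \<Rightarrow> complex) \<Rightarrow> nat \<Rightarrow> bool" where
  "cohomology_iso C D C' D' q \<longleftrightarrow>
     (\<exists>h. bij_betw h (cohomology C D q) (cohomology C' D' q) \<and>
       (\<forall>K\<in>cohomology C D q. \<forall>L\<in>cohomology C D q. h (K + L) = h K + h L) \<and>
       (\<forall>K\<in>cohomology C D q. \<forall>c. h (class_scale C D q c K) = class_scale C' D' q c (h K)))"


section \<open>The Leibniz rules\<close>

lemma cdual_separates:
  fixes v :: "'g::real_vector \<times> 'g"
  assumes "v \<noteq> 0"
  obtains \<xi> where "\<xi> \<in> cdual" "\<xi> v = 1"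
proof -
  interpret p: vector_space_pair "cscale :: complex \<Rightarrow> 'g \<times> 'g \<Rightarrow> 'g \<times> 'g" "(*) :: complex \<Rightarrow> complex \<Rightarrow> complex"
    by unfold_locales (auto simp: algebra_simps)
  have "\<exists>g. Vector_Spaces.linear cscale (*) g \<and> (\<forall>x\<in>{v}. g x = 1)"
    using assms by (intro p.linear_independent_extend) simp
  then show ?thesis using that by (auto simp: cdual_def)
qed

lemma cdual_add: "\<xi> \<in> cdual \<Longrightarrow> \<xi> (v + w) = \<xi> v + \<xi> w"
  unfolding cdual_def Vector_Spaces.linear_def module_hom_def module_hom_axioms_def by blast

lemma cdual_scale: "\<xi> \<in> cdual \<Longrightarrow> \<xi> (cscale c v) = c * \<xi> v"
  unfolding cdual_def Vector_Spaces.linear_def module_hom_def module_hom_axioms_def by blast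

lemma cdualI:
  fixes \<xi> :: "'g::real_vector \<times> 'g \<Rightarrow> complex"
  assumes "\<And>v w. \<xi> (v + w) = \<xi> v + \<xi> w" "\<And>c v. \<xi> (cscale c v) = c * \<xi> v"
  shows "\<xi> \<in> cdual"
  unfolding cdual_def using assms
  by (simp, unfold_locales) (auto simp: algebra_simps)

lemma vec_tensor_add: "vec_tensor (v + w) = vec_tensor v + vec_tensor w"
  by (rule ext) (auto simp: vec_tensor_def cdual_add split: list.splits arg.splits)

lemma vec_tensor_scale: "vec_tensor (cscale c v) = fscale c (vec_tensor v)"
  by (rule ext) (auto simp: vec_tensor_def cdual_scale fscale_def split: list.splits arg.splits)

lemma vec_tensor_inject: "vec_tensor v = vec_tensor w \<longleftrightarrow> v = w"
proof
  assume eq: "vec_tensor v = vec_tensor w"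
  show "v = w"
  proof (rule ccontr)
    assume "v \<noteq> w"
    then obtain \<xi> where \<xi>: "\<xi> \<in> cdual" "\<xi> (v - w) = 1"
      using cdual_separates[of "v - w"] by auto
    have "\<xi> v = \<xi> w"
      using fun_cong[OF eq, of "[Cov \<xi>]"] \<xi>(1) by (simp add: vec_tensor_def)
    moreover have "\<xi> v = \<xi> (v - w) + \<xi> w"
      using cdual_add[OF \<xi>(1), of "v - w" w] by simp
    ultimately show False using \<xi>(2) by simp
  qed
qed simp

lemma cov_tensor_add: "cov_tensor (\<lambda>u. \<omega> u + \<omega>' u) = cov_tensor \<omega> + cov_tensor \<omega>'"
  by (rule ext) (auto simp: cov_tensor_def split: list.splits arg.splits)

lemma cov_tensor_scale: "cov_tensor (\<lambda>u. c * \<omega> u) = fscale c (cov_tensor \<omega>)"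
  by (rule ext) (auto simp: cov_tensor_def fscale_def split: list.splits arg.splits)

lemma g10_add: "linear J \<Longrightarrow> v \<in> g10 J \<Longrightarrow> w \<in> g10 J \<Longrightarrow> v + w \<in> g10 J"
  by (auto simp: g10_def cJ_def cscale_def linear_add prod_eq_iff)

lemma g10_scale: "linear J \<Longrightarrow> v \<in> g10 J \<Longrightarrow> cscale c v \<in> g10 J"
  by (auto simp: g10_def cJ_def cscale_def linear_add linear_diff linear_scale prod_eq_iff)

lemma g10_dual_add: "\<omega> \<in> g10_dual J \<Longrightarrow> \<omega>' \<in> g10_dual J \<Longrightarrow> (\<lambda>u. \<omega> u + \<omega>' u) \<in> g10_dual J"
  unfolding g10_dual_def by (intro CollectI conjI cdualI) (simp_all add: cdual_add cdual_scale algebra_simps)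

lemma g10_dual_scale: "\<omega> \<in> g10_dual J \<Longrightarrow> (\<lambda>u. c * \<omega> u) \<in> g10_dual J"
  unfolding g10_dual_def by (intro CollectI conjI cdualI) (simp_all add: cdual_add cdual_scale algebra_simps)

lemma espace_add:
  assumes J: "linear J" and e: "e \<in> espace J M" and f: "f \<in> espace J M"
  shows "e + f \<in> espace J M"
proof (cases M)
  case Tan
  then obtain v w where "v \<in> g10 J" "e = vec_tensor v" "w \<in> g10 J" "f = vec_tensor w"
    using e f unfolding Tan espace.simps by blast
  then have "e + f = vec_tensor (v + w)" "v + w \<in> g10 J"
    by (simp_all only: vec_tensor_add g10_add J)
  then show ?thesis unfolding Tan espace.simps by blast
next
  case Cot
  then obtain v w where "v \<in> g10_dual J" "e = cov_tensor v" "w \<in> g10_dual J" "f = cov_tensor w"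
    using e f unfolding Cot espace.simps by blast
  then have "e + f = cov_tensor (\<lambda>u. v u + w u)" "(\<lambda>u. v u + w u) \<in> g10_dual J"
    by (simp_all only: cov_tensor_add g10_dual_add)
  then show ?thesis unfolding Cot espace.simps by blast
qed (use e f in \<open>simp_all only: espace.simps fvs.span_add\<close>)

lemma espace_scale:
  assumes J: "linear J" and e: "e \<in> espace J M"
  shows "fscale c e \<in> espace J M"
proof (cases M)
  case Tan
  then obtain v where "v \<in> g10 J" "e = vec_tensor v"
    using e unfolding Tan espace.simps by blast
  then have "fscale c e = vec_tensor (cscale c v)" "cscale c v \<in> g10 J"
    by (simp_all only: vec_tensor_scale g10_scale J)
  then show ?thesis unfolding Tan espace.simps by blast
next
  case Cot
  then obtain v where "v \<in> g10_dual J" "e = cov_tensor v"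
    using e unfolding Cot espace.simps by blast
  then have "fscale c e = cov_tensor (\<lambda>u. c * v u)" "(\<lambda>u. c * v u) \<in> g10_dual J"
    by (simp_all only: cov_tensor_scale g10_dual_scale)
  then show ?thesis unfolding Cot espace.simps by blast
qed (use e in \<open>simp_all only: espace.simps fvs.span_scale\<close>)

lemma espace_zero: assumes "linear J" shows "0 \<in> espace J M"
proof (cases M)
  case Tan
  have "(0 :: 'a tens) = vec_tensor 0"
    by (rule ext) (auto simp: vec_tensor_def cdual_scale[of _ 0 0, simplified] split: list.splits arg.splits)
  moreover have "(0 :: 'a \<times> 'a) \<in> g10 J" using assms by (auto simp: g10_def cJ_def linear_0 prod_eq_iff)
  ultimately show ?thesis using Tan by auto
next
  case Cot
  have "(0 :: 'a tens) = cov_tensor (\<lambda>u. 0)"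
    by (rule ext) (auto simp: cov_tensor_def split: list.splits arg.splits)
  moreover have "(\<lambda>u. 0) \<in> g10_dual J" by (auto simp: g10_dual_def intro!: cdualI)
  ultimately show ?thesis using Cot by (auto simp: image_iff)
qed (simp_all add: fvs.span_zero)

lemma espace_subspace: "linear J \<Longrightarrow> fvs.subspace (espace J M)"
  by (auto simp: fvs.subspace_def espace_add espace_scale espace_zero)

lemma espace_arity: "e \<in> espace J M \<Longrightarrow> length as \<noteq> arity M \<Longrightarrow> e as = 0"
proof (induction M arbitrary: e as)
  case Tan
  then show ?case by (auto simp: vec_tensor_def split: list.splits arg.splits)
next
  case Cot
  then show ?case by (auto simp: cov_tensor_def split: list.splits arg.splits)
next
  case (Tensor A B)
  from Tensor.prems(1) show ?case unfolding espace.simps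
  proof (induction rule: fvs.span_induct_alt)
    case base show ?case by simp
  next
    case (step c x y)
    then obtain e f where ef: "x = tensor (arity A) e f" "e \<in> espace J A" "f \<in> espace J B" by auto
    have "x as = 0"
    proof (cases "length as < arity A")
      case True
      then show ?thesis using Tensor.IH(1)[OF ef(2), of as] by (simp add: ef(1) tensor_def)
    next
      case False
      then show ?thesis using Tensor.IH(2)[OF ef(3), of "drop (arity A) as"] Tensor.prems(2)
        by (simp add: ef(1) tensor_def)
    qed
    then show ?case using step by (simp add: fscale_def)
  qed
next
  case (Wedge k A)
  from Wedge.prems(1) show ?case unfolding espace.simps
  proof (induction rule: fvs.span_induct_alt)
    case base show ?case by simp
  next
    case (step c x y)
    then show ?case using Wedge.prems(2) by (auto simp: fscale_def wedge_tensor_def)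
  qed
qed

lemma tensor_append:
  assumes e: "e \<in> espace J A" and f: "f \<in> espace J B" and bs: "length bs = arity B"
  shows "tensor (arity A) e f (as @ bs) = e as * f bs"
proof -
  consider "length as = arity A" | "length as > arity A" | "length as < arity A" "arity B = 0"
    | "length as < arity A" "arity B > 0" by linarith
  then show ?thesis
  proof cases
    case 1 then show ?thesis by (simp add: tensor_def)
  next
    case 2 then show ?thesis
      using espace_arity[OF e, of as] espace_arity[OF f, of "drop (arity A) (as @ bs)"] bs
      by (simp add: tensor_def)
  next
    case 3 then show ?thesis
      using espace_arity[OF e, of as] bs by (simp add: tensor_def)
  next
    case 4 then show ?thesis
      using espace_arity[OF e, of as] espace_arity[OF f, of "drop (arity A) (as @ bs)"] bs
      by (simp add: tensor_def)
  qed
qed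

lemma espace_tensor_left:
  assumes J: "linear J" and e: "e \<in> espace J (Tensor A B)" and bs: "length bs = arity B"
  shows "(\<lambda>as. e (as @ bs)) \<in> espace J A"
  using e unfolding espace.simps
proof (induction rule: fvs.span_induct_alt)
  case base show ?case using espace_zero[OF J] by (simp add: zero_fun_def)
next
  case (step c x y)
  then obtain e f where ef: "x = tensor (arity A) e f" "e \<in> espace J A" "f \<in> espace J B" by auto
  have "tensor (arity A) e f (as @ bs) = e as * f bs" for as
    by (rule tensor_append[OF ef(2,3) bs])
  then have *: "(\<lambda>as. (fscale c x + y) (as @ bs)) = fscale (c * f bs) e + (\<lambda>as. y (as @ bs))"
    by (auto simp: ef(1) fscale_def)
  show ?case unfolding * by (intro espace_add espace_scale J ef step)
qed

lemma espace_tensor_right: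
  assumes J: "linear J" and e: "e \<in> espace J (Tensor A B)" and as: "length as = arity A"
  shows "(\<lambda>bs. e (as @ bs)) \<in> espace J B"
  using e unfolding espace.simps
proof (induction rule: fvs.span_induct_alt)
  case base show ?case using espace_zero[OF J] by (simp add: zero_fun_def)
next
  case (step c x y)
  then obtain e f where ef: "x = tensor (arity A) e f" "e \<in> espace J A" "f \<in> espace J B" by auto
  have *: "(\<lambda>bs. (fscale c x + y) (as @ bs)) = fscale (c * e as) f + (\<lambda>bs. y (as @ bs))"
    by (auto simp: ef(1) fscale_def tensor_def as)
  show ?case unfolding * by (intro espace_add espace_scale J ef step)
qed

lemma block_mid:
  assumes "length bs = m" "length pre = i * m"
  shows "block m i (pre @ bs @ post) = bs"
  using assms by (simp add: block_def)

lemma block_other: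
  assumes "length bs = m" "length bs' = m" "length pre = i * m" "j \<noteq> i"
  shows "block m j (pre @ bs @ post) = block m j (pre @ bs' @ post)"
proof (cases "j < i")
  case True
  then have "Suc j * m \<le> i * m" by (intro mult_le_mono1) simp
  then show ?thesis using assms by (simp add: block_def)
next
  case False
  then have "Suc i * m \<le> j * m" using assms(4) by (intro mult_le_mono1) simp
  then show ?thesis using assms by (simp add: block_def)
qed

lemma wedge_tensor_mid:
  assumes "length es = k" "i < k" "length pre = i * m" "length post = (k - Suc i) * m"
    "length bs = m" "length us = m"
  shows "wedge_tensor m es (pre @ bs @ post) =
    (\<Sum>\<sigma> | \<sigma> permutes {..<k}. of_int (sign \<sigma>) *
       (\<Prod>j\<in>{..<k} - {i}. (es ! \<sigma> j) (block m j (pre @ us @ post))) * (es ! \<sigma> i) bs)"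
proof -
  have "i * m + (m + (k - Suc i) * m) = (i + (1 + (k - Suc i))) * m" by (simp add: algebra_simps)
  then have len: "i * m + (m + (k - Suc i) * m) = k * m" using assms(2) by simp
  have prod: "(\<Prod>j<k. (es ! \<sigma> j) (block m j (pre @ bs @ post))) =
      (\<Prod>j\<in>{..<k} - {i}. (es ! \<sigma> j) (block m j (pre @ us @ post))) * (es ! \<sigma> i) bs" for \<sigma>
  proof -
    have "(\<Prod>j<k. (es ! \<sigma> j) (block m j (pre @ bs @ post))) =
        (es ! \<sigma> i) (block m i (pre @ bs @ post)) * (\<Prod>j\<in>{..<k} - {i}. (es ! \<sigma> j) (block m j (pre @ bs @ post)))"
      using assms(2) by (intro prod.remove) auto
    also have "(\<Prod>j\<in>{..<k} - {i}. (es ! \<sigma> j) (block m j (pre @ bs @ post))) =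
        (\<Prod>j\<in>{..<k} - {i}. (es ! \<sigma> j) (block m j (pre @ us @ post)))"
      using assms by (intro prod.cong refl arg_cong[where f = "es ! _"] block_other) auto
    finally show ?thesis using assms by (simp add: block_mid)
  qed
  show ?thesis using assms len prod by (simp add: wedge_tensor_def mult.assoc)
qed

lemma fun_sum_apply: "(\<Sum>x\<in>A. f x) y = (\<Sum>x\<in>A. f x y)"
  for f :: "'a \<Rightarrow> 'b \<Rightarrow> 'c::comm_monoid_add"
  by (induction A rule: infinite_finite_induct) auto

lemma permutes_nth_mem:
  "\<sigma> permutes {..<k} \<Longrightarrow> length es = k \<Longrightarrow> i < k \<Longrightarrow> set es \<subseteq> S \<Longrightarrow> es ! \<sigma> i \<in> S"
  using permutes_in_image[of \<sigma> "{..<k}" i] by auto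

lemma wedge_tensor_mid_fun:
  assumes es: "length es = k" "set es \<subseteq> espace J A" and i: "i < k"
    and pre: "length pre = i * arity A" and post: "length post = (k - Suc i) * arity A"
    and us: "length us = arity A"
  shows "(\<lambda>bs. wedge_tensor (arity A) es (pre @ bs @ post)) =
    (\<Sum>\<sigma> | \<sigma> permutes {..<k}. fscale (of_int (sign \<sigma>) *
       (\<Prod>j\<in>{..<k} - {i}. (es ! \<sigma> j) (block (arity A) j (pre @ us @ post)))) (es ! \<sigma> i))"
proof (rule ext)
  fix bs
  let ?m = "arity A"
  show "wedge_tensor ?m es (pre @ bs @ post) = (\<Sum>\<sigma> | \<sigma> permutes {..<k}. fscale (of_int (sign \<sigma>) *
       (\<Prod>j\<in>{..<k} - {i}. (es ! \<sigma> j) (block ?m j (pre @ us @ post)))) (es ! \<sigma> i)) bs"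
  proof (cases "length bs = ?m")
    case True
    then show ?thesis
      using wedge_tensor_mid[OF es(1) i pre post True us] by (simp add: fun_sum_apply fscale_def)
  next
    case False
    have "i * ?m + (?m + (k - Suc i) * ?m) = (i + (1 + (k - Suc i))) * ?m" by (simp add: algebra_simps)
    then have "i * ?m + (?m + (k - Suc i) * ?m) = k * ?m" using i by simp
    then have "length (pre @ bs @ post) \<noteq> k * ?m" using False pre post by simp
    moreover have "(es ! \<sigma> i) bs = 0" if "\<sigma> permutes {..<k}" for \<sigma>
      using permutes_nth_mem[OF that es(1) i es(2)] False espace_arity by blast
    ultimately show ?thesis using es(1) by (simp add: wedge_tensor_def fun_sum_apply fscale_def)
  qed
qed

lemma espace_wedge_mid:
  assumes J: "linear J" and e: "e \<in> espace J (Wedge k A)" and i: "i < k"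
    and pre: "length pre = i * arity A" and post: "length post = (k - Suc i) * arity A"
  shows "(\<lambda>bs. e (pre @ bs @ post)) \<in> espace J A"
  using e unfolding espace.simps
proof (induction rule: fvs.span_induct_alt)
  case base show ?case using espace_zero[OF J] by (simp add: zero_fun_def)
next
  case (step c x y)
  then obtain es where es: "x = wedge_tensor (arity A) es" "length es = k" "set es \<subseteq> espace J A" by auto
  obtain us :: "('a \<times> 'a) arg list" where us: "length us = arity A" using Ex_list_of_length by blast
  have "(\<lambda>bs. x (pre @ bs @ post)) \<in> espace J A"
    unfolding es(1) wedge_tensor_mid_fun[OF es(2,3) i pre post us]
    using permutes_nth_mem[OF _ es(2) i es(3)]
    by (intro fvs.subspace_sum espace_subspace espace_scale J) auto
  then have "fscale c (\<lambda>bs. x (pre @ bs @ post)) + (\<lambda>bs. y (pre @ bs @ post)) \<in> espace J A"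
    by (intro espace_add espace_scale J step)
  also have "fscale c (\<lambda>bs. x (pre @ bs @ post)) + (\<lambda>bs. y (pre @ bs @ post)) =
      (\<lambda>bs. (fscale c x + y) (pre @ bs @ post))" by (auto simp: fscale_def)
  finally show ?case .
qed

context
  fixes J :: "'g::real_vector \<Rightarrow> 'g" and \<delta>V :: "'g \<times> 'g \<Rightarrow> 'g \<times> 'g \<Rightarrow> 'g \<times> 'g"
    and \<delta>W :: "('g \<times> 'g \<Rightarrow> complex) \<Rightarrow> 'g \<times> 'g \<Rightarrow> 'g \<times> 'g \<Rightarrow> complex"
  assumes J: "linear J"
    and V_add: "\<And>Y Y' x. Y \<in> g10 J \<Longrightarrow> Y' \<in> g10 J \<Longrightarrow> \<delta>V (Y + Y') x = \<delta>V Y x + \<delta>V Y' x"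
    and V_scale: "\<And>Y c x. Y \<in> g10 J \<Longrightarrow> \<delta>V (cscale c Y) x = cscale c (\<delta>V Y x)"
    and W_add: "\<And>\<omega> \<omega>' x. \<omega> \<in> g10_dual J \<Longrightarrow> \<omega>' \<in> g10_dual J \<Longrightarrow>
      \<delta>W (\<lambda>u. \<omega> u + \<omega>' u) x = (\<lambda>u. \<delta>W \<omega> x u + \<delta>W \<omega>' x u)"
    and W_scale: "\<And>\<omega> c x. \<omega> \<in> g10_dual J \<Longrightarrow> \<delta>W (\<lambda>u. c * \<omega> u) x = (\<lambda>u. c * \<delta>W \<omega> x u)"
begin

lemma leibniz_Tan: "Y \<in> g10 J \<Longrightarrow> leibniz J \<delta>V \<delta>W Tan (vec_tensor Y) x = vec_tensor (\<delta>V Y x)"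
  by (auto simp: vec_tensor_inject intro!: arg_cong[where f = vec_tensor] arg_cong[where f = "\<lambda>Y. \<delta>V Y x"])

lemma leibniz_Cot: "leibniz J \<delta>V \<delta>W Cot (cov_tensor \<omega>) x = cov_tensor (\<delta>W \<omega> x)"
proof -
  have "(\<lambda>u. cov_tensor \<omega> [Vec u]) = \<omega>" by (simp add: cov_tensor_def)
  then show ?thesis by simp
qed

lemma leibniz_linear:
  "e \<in> espace J M \<Longrightarrow> f \<in> espace J M \<Longrightarrow>
   leibniz J \<delta>V \<delta>W M (fscale c e + f) x = fscale c (leibniz J \<delta>V \<delta>W M e x) + leibniz J \<delta>V \<delta>W M f x"
proof (induction M arbitrary: e f)
  case Tan
  then obtain Y Y' where Y: "Y \<in> g10 J" "e = vec_tensor Y" "Y' \<in> g10 J" "f = vec_tensor Y'" by auto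
  have "fscale c e + f = vec_tensor (cscale c Y + Y')" by (simp only: Y vec_tensor_add vec_tensor_scale)
  moreover have "leibniz J \<delta>V \<delta>W Tan (vec_tensor (cscale c Y + Y')) x = vec_tensor (cscale c (\<delta>V Y x) + \<delta>V Y' x)"
    using Y J by (simp only: leibniz_Tan g10_add g10_scale V_add V_scale)
  ultimately show ?case
    using Y by (simp only: leibniz_Tan vec_tensor_add vec_tensor_scale)
next
  case Cot
  then obtain \<omega> \<omega>' where w: "\<omega> \<in> g10_dual J" "e = cov_tensor \<omega>" "\<omega>' \<in> g10_dual J" "f = cov_tensor \<omega>'" by auto
  have "fscale c e + f = cov_tensor (\<lambda>u. (\<lambda>u. c * \<omega> u) u + \<omega>' u)"
    by (simp only: w cov_tensor_add cov_tensor_scale)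
  moreover have "leibniz J \<delta>V \<delta>W Cot (cov_tensor (\<lambda>u. (\<lambda>u. c * \<omega> u) u + \<omega>' u)) x =
      cov_tensor (\<lambda>u. c * \<delta>W \<omega> x u + \<delta>W \<omega>' x u)"
    unfolding leibniz_Cot W_add[OF g10_dual_scale[OF w(1)] w(3)] W_scale[OF w(1)] ..
  ultimately show ?case
    using w by (simp only: leibniz_Cot cov_tensor_add cov_tensor_scale)
next
  case (Tensor A B)
  show ?case
  proof (rule ext)
    fix as :: "('g \<times> 'g) arg list"
    show "leibniz J \<delta>V \<delta>W (Tensor A B) (fscale c e + f) x as =
      (fscale c (leibniz J \<delta>V \<delta>W (Tensor A B) e x) + leibniz J \<delta>V \<delta>W (Tensor A B) f x) as"
    proof (cases "length as = arity A + arity B")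
      case True
      let ?a = "take (arity A) as" and ?b = "drop (arity A) as"
      have 1: "(\<lambda>bs. (fscale c e + f) (bs @ ?b)) = fscale c (\<lambda>bs. e (bs @ ?b)) + (\<lambda>bs. f (bs @ ?b))"
        and 2: "(\<lambda>bs. (fscale c e + f) (?a @ bs)) = fscale c (\<lambda>bs. e (?a @ bs)) + (\<lambda>bs. f (?a @ bs))"
        by (auto simp: fscale_def)
      have len: "length ?a = arity A" "length ?b = arity B" using True by auto
      have 3: "leibniz J \<delta>V \<delta>W A (fscale c (\<lambda>bs. e (bs @ ?b)) + (\<lambda>bs. f (bs @ ?b))) x =
          fscale c (leibniz J \<delta>V \<delta>W A (\<lambda>bs. e (bs @ ?b)) x) + leibniz J \<delta>V \<delta>W A (\<lambda>bs. f (bs @ ?b)) x"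
        by (intro Tensor.IH(1) espace_tensor_left[OF J _ len(2)] Tensor.prems)
      have 4: "leibniz J \<delta>V \<delta>W B (fscale c (\<lambda>bs. e (?a @ bs)) + (\<lambda>bs. f (?a @ bs))) x =
          fscale c (leibniz J \<delta>V \<delta>W B (\<lambda>bs. e (?a @ bs)) x) + leibniz J \<delta>V \<delta>W B (\<lambda>bs. f (?a @ bs)) x"
        by (intro Tensor.IH(2) espace_tensor_right[OF J _ len(1)] Tensor.prems)
      show ?thesis
        unfolding leibniz.simps 1 2 3 4 by (simp add: fscale_def algebra_simps True)
    qed (simp add: fscale_def)
  qed
next
  case (Wedge k A)
  show ?case
  proof (rule ext)
    fix as :: "('g \<times> 'g) arg list"
    let ?pre = "\<lambda>i. take (i * arity A) as" and ?post = "\<lambda>i. drop (Suc i * arity A) as"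
    show "leibniz J \<delta>V \<delta>W (Wedge k A) (fscale c e + f) x as =
      (fscale c (leibniz J \<delta>V \<delta>W (Wedge k A) e x) + leibniz J \<delta>V \<delta>W (Wedge k A) f x) as"
    proof (cases "length as = k * arity A")
      case True
      have "leibniz J \<delta>V \<delta>W A (\<lambda>bs. (fscale c e + f) (?pre i @ bs @ ?post i)) x =
          fscale c (leibniz J \<delta>V \<delta>W A (\<lambda>bs. e (?pre i @ bs @ ?post i)) x) +
          leibniz J \<delta>V \<delta>W A (\<lambda>bs. f (?pre i @ bs @ ?post i)) x" if i: "i < k" for i
      proof -
        have "i * arity A \<le> k * arity A" using i by (intro mult_le_mono1) simp
        then have len: "length (?pre i) = i * arity A" "length (?post i) = (k - Suc i) * arity A"
          using True by (auto simp: diff_mult_distrib)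
        have 1: "(\<lambda>bs. (fscale c e + f) (?pre i @ bs @ ?post i)) =
            fscale c (\<lambda>bs. e (?pre i @ bs @ ?post i)) + (\<lambda>bs. f (?pre i @ bs @ ?post i))"
          by (auto simp: fscale_def)
        show ?thesis unfolding 1
          by (intro Wedge.IH espace_wedge_mid[OF J _ i] Wedge.prems len)
      qed
      then show ?thesis
        using True by (simp del: mult_Suc add: fscale_def sum.distrib sum_distrib_left)
    qed (simp add: fscale_def)
  qed
qed

lemma leibniz_scale:
  assumes "e \<in> espace J M"
  shows "leibniz J \<delta>V \<delta>W M (fscale c e) x = fscale c (leibniz J \<delta>V \<delta>W M e x)"
proof -
  have "leibniz J \<delta>V \<delta>W M 0 x = 0"
    using leibniz_linear[OF espace_zero espace_zero, OF J J, of M 1 x]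
    by (simp add: fvs.scale_one)
  then show ?thesis using leibniz_linear[OF assms espace_zero[OF J], of c x] by (simp only: add_0_right)
qed

lemma leibniz_sum:
  assumes "finite S" "\<And>s. s \<in> S \<Longrightarrow> e s \<in> espace J M"
  shows "leibniz J \<delta>V \<delta>W M (\<Sum>s\<in>S. fscale (c s) (e s)) x = (\<Sum>s\<in>S. fscale (c s) (leibniz J \<delta>V \<delta>W M (e s) x))"
  using assms
proof (induction S rule: finite_induct)
  case empty
  show ?case using leibniz_scale[OF espace_zero[OF J], of M 0 x] by (simp only: sum.empty fvs.scale_zero_left)
next
  case (insert s S)
  have "(\<Sum>s\<in>S. fscale (c s) (e s)) \<in> espace J M"
    using insert.prems by (intro fvs.subspace_sum espace_subspace espace_scale J) auto
  then show ?case using insert by (simp only: sum.insert leibniz_linear insertI1 insertI2 insert_iff simp_thms)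
qed

lemma leibniz_arity: "length as \<noteq> arity M \<Longrightarrow> leibniz J \<delta>V \<delta>W M e x as = 0"
  by (cases M) (auto simp: vec_tensor_def cov_tensor_def split: list.split arg.split)

lemma leibniz_tensor:
  assumes e: "e \<in> espace J A" and f: "f \<in> espace J B"
  shows "leibniz J \<delta>V \<delta>W (Tensor A B) (tensor (arity A) e f) x =
    tensor (arity A) (leibniz J \<delta>V \<delta>W A e x) f + tensor (arity A) e (leibniz J \<delta>V \<delta>W B f x)"
proof (rule ext)
  fix as :: "('g \<times> 'g) arg list"
  let ?a = "take (arity A) as" and ?b = "drop (arity A) as"
  show "leibniz J \<delta>V \<delta>W (Tensor A B) (tensor (arity A) e f) x as =
    (tensor (arity A) (leibniz J \<delta>V \<delta>W A e x) f + tensor (arity A) e (leibniz J \<delta>V \<delta>W B f x)) as"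
  proof (cases "length as = arity A + arity B")
    case True
    have 1: "(\<lambda>bs. tensor (arity A) e f (bs @ ?b)) = fscale (f ?b) e"
      using True by (auto simp: fscale_def tensor_append[OF e f])
    have 2: "(\<lambda>bs. tensor (arity A) e f (?a @ bs)) = fscale (e ?a) f"
      using True by (auto simp: tensor_def fscale_def)
    show ?thesis
      unfolding leibniz.simps 1 2
      by (simp add: leibniz_scale e f True tensor_def) (simp add: fscale_def)
  next
    case False
    have "arity A \<noteq> length as \<Longrightarrow> length as < arity A \<Longrightarrow> leibniz J \<delta>V \<delta>W A e x ?a = 0 \<and> e ?a = 0"
      by (auto intro!: leibniz_arity espace_arity[OF e])
    moreover have "\<not> length as < arity A \<Longrightarrow> leibniz J \<delta>V \<delta>W B f x ?b = 0 \<and> f ?b = 0"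
      using False by (auto intro!: leibniz_arity espace_arity[OF f])
    ultimately show ?thesis using False by (cases "length as < arity A") (auto simp: tensor_def)
  qed
qed

lemma leibniz_wedge:
  assumes es: "length es = k" "set es \<subseteq> espace J A"
  shows "leibniz J \<delta>V \<delta>W (Wedge k A) (wedge_tensor (arity A) es) x =
    (\<Sum>l<k. wedge_tensor (arity A) (es[l := leibniz J \<delta>V \<delta>W A (es ! l) x]))"
proof (rule ext)
  fix as :: "('g \<times> 'g) arg list"
  let ?m = "arity A" and ?D = "\<lambda>e. leibniz J \<delta>V \<delta>W A e x"
  let ?P = "{\<sigma>. \<sigma> permutes {..<k}}"
  show "leibniz J \<delta>V \<delta>W (Wedge k A) (wedge_tensor ?m es) x as =
    (\<Sum>l<k. wedge_tensor ?m (es[l := ?D (es ! l)])) as"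
  proof (cases "length as = k * ?m")
    case True
    let ?R = "\<lambda>\<sigma> i. of_int (sign \<sigma>) * (\<Prod>j\<in>{..<k} - {i}. (es ! \<sigma> j) (block ?m j as)) * ?D (es ! \<sigma> i) (block ?m i as)"
    have L: "?D (\<lambda>bs. wedge_tensor ?m es (take (i * ?m) as @ bs @ drop (Suc i * ?m) as)) (block ?m i as) =
        (\<Sum>\<sigma>\<in>?P. ?R \<sigma> i)" if i: "i < k" for i
    proof -
      have le: "Suc i * ?m \<le> k * ?m" using i by (intro mult_le_mono1) simp
      have pre: "length (take (i * ?m) as) = i * ?m" and post: "length (drop (Suc i * ?m) as) = (k - Suc i) * ?m"
        and us: "length (block ?m i as) = ?m"
        using True le by (auto simp: diff_mult_distrib block_def)
      have as: "take (i * ?m) as @ block ?m i as @ drop (Suc i * ?m) as = as"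
        by (simp add: block_def) (metis add.commute append_take_drop_id drop_drop)
      show ?thesis
        unfolding wedge_tensor_mid_fun[OF es i pre post us] as
        by (subst leibniz_sum)
          (use permutes_nth_mem[OF _ es(1) i es(2)] in \<open>auto simp: finite_permutations fun_sum_apply fscale_def\<close>)
    qed
    have R: "wedge_tensor ?m (es[l := ?D (es ! l)]) as = (\<Sum>\<sigma>\<in>?P. ?R \<sigma> (inv \<sigma> l))" if l: "l < k" for l
    proof -
      have "(\<Prod>j<k. (es[l := ?D (es ! l)] ! \<sigma> j) (block ?m j as)) =
        (\<Prod>j\<in>{..<k} - {inv \<sigma> l}. (es ! \<sigma> j) (block ?m j as)) * ?D (es ! \<sigma> (inv \<sigma> l)) (block ?m (inv \<sigma> l) as)"
        if \<sigma>: "\<sigma> permutes {..<k}" for \<sigma>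
      proof -
        have inv: "inv \<sigma> l < k" "\<sigma> (inv \<sigma> l) = l"
          using permutes_in_image[OF permutes_inv[OF \<sigma>], of l] l permutes_inverses(1)[OF \<sigma>] by auto
        have "(\<Prod>j<k. (es[l := ?D (es ! l)] ! \<sigma> j) (block ?m j as)) =
          (es[l := ?D (es ! l)] ! \<sigma> (inv \<sigma> l)) (block ?m (inv \<sigma> l) as) *
          (\<Prod>j\<in>{..<k} - {inv \<sigma> l}. (es[l := ?D (es ! l)] ! \<sigma> j) (block ?m j as))"
          using inv by (intro prod.remove) auto
        also have "(\<Prod>j\<in>{..<k} - {inv \<sigma> l}. (es[l := ?D (es ! l)] ! \<sigma> j) (block ?m j as)) =
          (\<Prod>j\<in>{..<k} - {inv \<sigma> l}. (es ! \<sigma> j) (block ?m j as))"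
        proof (rule prod.cong[OF refl])
          fix j assume "j \<in> {..<k} - {inv \<sigma> l}"
          then have "\<sigma> j \<noteq> l" using permutes_inverses(2)[OF \<sigma>, of j] by auto
          then show "(es[l := ?D (es ! l)] ! \<sigma> j) (block ?m j as) = (es ! \<sigma> j) (block ?m j as)" by simp
        qed
        finally show ?thesis using inv l es(1) by simp
      qed
      then show ?thesis using True es(1) by (auto simp: wedge_tensor_def mult.assoc intro!: sum.cong)
    qed
    have "(\<Sum>l<k. \<Sum>\<sigma>\<in>?P. ?R \<sigma> (inv \<sigma> l)) = (\<Sum>\<sigma>\<in>?P. \<Sum>l<k. ?R \<sigma> (inv \<sigma> l))" by (rule sum.swap)
    also have "\<dots> = (\<Sum>\<sigma>\<in>?P. \<Sum>i<k. ?R \<sigma> i)"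
    proof (rule sum.cong[OF refl])
      fix \<sigma> assume "\<sigma> \<in> ?P"
      then have "inv \<sigma> permutes {..<k}" by (simp add: permutes_inv)
      then show "(\<Sum>l<k. ?R \<sigma> (inv \<sigma> l)) = (\<Sum>i<k. ?R \<sigma> i)"
        using sum.permute[of "inv \<sigma>" "{..<k}" "?R \<sigma>"] by (simp add: o_def)
    qed
    also have "\<dots> = (\<Sum>i<k. \<Sum>\<sigma>\<in>?P. ?R \<sigma> i)" by (rule sum.swap)
    finally show ?thesis using True L R by (simp del: mult_Suc add: fun_sum_apply)
  next
    case False
    then show ?thesis using es(1) by (auto simp: fun_sum_apply wedge_tensor_def)
  qed
qed

lemma ext_op_cotensor:
  assumes e: "e \<in> espace J M" and d: "\<And>c \<eta>. d (fscale c \<eta>) = fscale c (d \<eta>)"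
  shows "ext_op d (leibniz J \<delta>V \<delta>W M) q (cotensor \<eta> e) (xs, as) =
    cotensor (d \<eta>) e (xs, as) +
    (-1) ^ q * wedge q 1 \<eta> (one_form (\<lambda>x. leibniz J \<delta>V \<delta>W M e x as)) xs"
proof -
  have 1: "(\<lambda>ys. cotensor \<eta> e (ys, as)) = fscale (e as) \<eta>"
    by (auto simp: cotensor_def fscale_def)
  have 2: "(\<lambda>bs. cotensor \<eta> e (ys, bs)) = fscale (\<eta> ys) e" for ys
    by (auto simp: cotensor_def fscale_def)
  show ?thesis
    unfolding ext_op_def split 1 2 d leibniz_scale[OF e] wedge_def
    by (auto simp: fscale_def cotensor_def one_form_def mult.assoc)
qed

end

lemma split11_wedge:
  assumes J: "linear J" "\<And>x. J (J x) = - x"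
    and \<theta>: "\<theta> \<in> cdual" "\<And>x. x \<in> g10 J \<Longrightarrow> \<theta> x = 0" and \<omega>: "\<omega> \<in> g10_dual J"
  shows "split11 J (wedge 1 1 (one_form \<theta>) (one_form \<omega>)) x u = \<theta> x * \<omega> u"
proof -
  have pr: "pr10 J y \<in> g10 J" "pr01 J y \<in> g01 J" "y = pr10 J y + pr01 J y" for y
    using J by (auto simp: pr10_def pr01_def g10_def g01_def cJ_def cscale_def prod_eq_iff
        linear_add linear_diff linear_scale linear_neg algebra_simps scaleR_add_left[symmetric])
  have \<theta>': "\<theta> (pr01 J x) = \<theta> x"
    using cdual_add[OF \<theta>(1), of "pr10 J x" "pr01 J x"] pr(3)[of x] \<theta>(2)[OF pr(1)] by simp
  have \<omega>': "\<omega> (pr10 J u) = \<omega> u"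
    using cdual_add[of \<omega> "pr10 J u" "pr01 J u"] pr(2,3)[of u] \<omega> by (auto simp: g10_dual_def)
  have P: "{\<sigma>. \<sigma> permutes {..<Suc (Suc 0)}} = {id, Transposition.transpose 0 (Suc 0)}"
    by (auto simp: lessThan_Suc permutes_doubleton_iff insert_commute)
  have ne: "id \<noteq> Transposition.transpose 0 (Suc 0 :: nat)"
    by (metis id_apply transpose_apply_first zero_neq_one One_nat_def)
  show ?thesis
    using \<theta>(2)[OF pr(1)[of u]] \<theta>' \<omega>'
    by (simp add: split11_def wedge_def one_form_def P ne sign_swap_id sign_id)
qed


end

theory Submission
  imports Defs
begin

text \<open>
  Integrability of the deformed structure makes the range \<open>g01 J'\<close> of \<open>rho = (1 - \<phi>) \<circ> pr01\<close> a
  subalgebra complementary to \<open>g10 J\<close>.  Let \<open>proj\<close> be the projection onto \<open>g10 J\<close> along it.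
  Pulling back the form arguments along \<open>rho\<close> and applying \<open>proj\<close> to the coefficients identifies
  \<open>g01 J\<close> with \<open>g01 J'\<close> and \<open>g10 J\<close> with the quotient of the complexification by \<open>g01 J'\<close>.
  Under this identification \<open>dbar_phi\<close> is the Chevalley--Eilenberg differential of the transported
  bracket: \<open>phi_vec\<close> is \<open>Y \<mapsto> proj [rho x, Y]\<close>, and the terms of \<open>- i\<^sub>\<phi> \<partial>\<close> supply the mixed part
  \<open>- [\<phi> u, v] - [u, \<phi> v]\<close> of \<open>[u - \<phi> u, v - \<phi> v]\<close>.  Hence the two complexes are isomorphic.
\<close>

section \<open>Alternating forms\<close>

lemma forms_length: "\<omega> \<in> forms k \<Longrightarrow> length xs \<noteq> k \<Longrightarrow> \<omega> xs = 0"
  by (auto simp: forms_def)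

lemma forms_slot: "\<omega> \<in> forms k \<Longrightarrow> length xs = k \<Longrightarrow> i < k \<Longrightarrow> (\<lambda>x. \<omega> (xs[i := x])) \<in> cdual"
  unfolding forms_def by blast

lemma forms_alt:
  assumes \<omega>: "\<omega> \<in> forms k" and xs: "length xs = k" "i < k" "j < k" "i \<noteq> j" "xs ! i = xs ! j"
  shows "\<omega> xs = 0"
proof -
  have *: "\<omega> xs = 0" if "a < b" "b < k" "xs ! a = xs ! b" for a b
    using \<omega> xs(1) that unfolding forms_def by blast
  show ?thesis using *[of i j] *[of j i] xs(2-5) by (metis nat_neq_iff)
qed

lemma formsI:
  assumes "\<And>xs. length xs \<noteq> k \<Longrightarrow> \<omega> xs = 0"
    "\<And>xs i. length xs = k \<Longrightarrow> i < k \<Longrightarrow> (\<lambda>x. \<omega> (xs[i := x])) \<in> cdual"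
    "\<And>xs i j. length xs = k \<Longrightarrow> i < j \<Longrightarrow> j < k \<Longrightarrow> xs ! i = xs ! j \<Longrightarrow> \<omega> xs = 0"
  shows "\<omega> \<in> forms k"
  unfolding forms_def using assms by blast

lemma cdual_zero: "\<xi> \<in> cdual \<Longrightarrow> \<xi> 0 = 0"
  using cdual_scale[of \<xi> 0 0] by (simp only: cvs.scale_zero_left mult_zero_left)

lemma cdual_minus: "\<xi> \<in> cdual \<Longrightarrow> \<xi> (- v) = - \<xi> v"
  using cdual_scale[of \<xi> "-1" v] by (simp only: cvs.scale_minus_left cvs.scale_one mult_minus1)

lemma cdual_diff: "\<xi> \<in> cdual \<Longrightarrow> \<xi> (v - w) = \<xi> v - \<xi> w"
  using cdual_add[of \<xi> v "- w"] cdual_minus[of \<xi> w] by simp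

lemma cdual_sum: "\<xi> \<in> cdual \<Longrightarrow> \<xi> (\<Sum>s\<in>S. cscale (c s) (f s)) = (\<Sum>s\<in>S. c s * \<xi> (f s))"
  by (induction S rule: infinite_finite_induct) (auto simp: cdual_zero cdual_add cdual_scale)

lemma cdual_sum_fun: "(\<And>s. s \<in> S \<Longrightarrow> f s \<in> cdual) \<Longrightarrow> (\<lambda>x. \<Sum>s\<in>S. f s x) \<in> cdual"
  by (rule cdualI) (simp_all add: cdual_add cdual_scale sum.distrib sum_distrib_left)

lemma cdual_uminus: "\<xi> \<in> cdual \<Longrightarrow> (\<lambda>x. - \<xi> x) \<in> cdual"
  by (rule cdualI) (simp_all add: cdual_add cdual_scale)

lemma cdual_comp:
  assumes "\<xi> \<in> cdual" "\<And>u v. f (u + v) = f u + f v" "\<And>c u. f (cscale c u) = cscale c (f u)"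
  shows "(\<lambda>x. \<xi> (f x)) \<in> cdual"
  by (rule cdualI) (simp_all only: assms(2,3) cdual_add[OF assms(1)] cdual_scale[OF assms(1)])

text \<open>Polarisation: expand the vanishing value with \<open>a + b\<close> in both
  slots.\<close>

lemma forms_swap:
  assumes \<omega>: "\<omega> \<in> forms k" and xs: "length xs = k" and ij: "i < k" "j < k" "i \<noteq> j"
  shows "\<omega> (xs[i := a, j := b]) = - \<omega> (xs[i := b, j := a])"
proof -
  have add1: "\<omega> (xs[i := u + v, j := w]) = \<omega> (xs[i := u, j := w]) + \<omega> (xs[i := v, j := w])" for u v w
    using cdual_add[OF forms_slot[OF \<omega>, of "xs[j := w]" i], of u v] xs ij
    by (simp add: list_update_swap[of i j])
  have add2: "\<omega> (xs[i := w, j := u + v]) = \<omega> (xs[i := w, j := u]) + \<omega> (xs[i := w, j := v])" for u v w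
    using cdual_add[OF forms_slot[OF \<omega>, of "xs[i := w]" j], of u v] xs ij by simp
  have alt: "\<omega> (xs[i := u, j := u]) = 0" for u
    using xs ij by (intro forms_alt[OF \<omega>, of _ i j]) auto
  have "0 = \<omega> (xs[i := a + b, j := a + b])" by (simp add: alt)
  also have "\<dots> = \<omega> (xs[i := a, j := b]) + \<omega> (xs[i := b, j := a])"
    unfolding add1 add2 by (simp add: alt)
  finally show ?thesis by (intro iffD2[OF eq_neg_iff_add_eq_0]) (rule sym)
qed

lemma forms_swap_front:
  assumes "\<omega> \<in> forms k"
  shows "\<omega> (a # b # zs) = - \<omega> (b # a # zs)"
proof (cases "length (a # b # zs) = k")
  case True
  then show ?thesis using forms_swap[OF assms, of "a # b # zs" 0 1 a b] by simp
next
  case False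
  then show ?thesis using assms by (simp add: forms_length)
qed

text \<open>Induction over transpositions. The index set starts at an arbitrary \<open>m\<close>
  because in a wedge product the right factor occupies the last slots.\<close>

lemma forms_permute:
  assumes \<omega>: "\<omega> \<in> forms k" and \<sigma>: "\<sigma> permutes {m..<m + k}"
  shows "\<omega> (map (\<lambda>i. f (\<sigma> i)) [m..<m + k]) = of_int (sign \<sigma>) * \<omega> (map f [m..<m + k])"
  using finite_atLeastLessThan \<sigma>
proof (induction rule: permutes_rev_induct)
  case id
  show ?case by (simp add: sign_id)
next
  case (swap a b p)
  let ?g = "\<lambda>i. f (p i)"
  let ?ys = "map ?g [m..<m + k]"
  have ab: "a - m < k" "b - m < k" "a - m \<noteq> b - m" using swap.hyps(1-3) by auto
  have "map (\<lambda>i. f ((p \<circ> Transposition.transpose a b) i)) [m..<m + k] = ?ys[a - m := ?g b, b - m := ?g a]"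
    using swap.hyps(1-3) by (intro nth_equalityI) (auto simp: nth_list_update Transposition.transpose_def)
  also have "\<omega> \<dots> = - \<omega> (?ys[a - m := ?g a, b - m := ?g b])"
    using ab by (intro forms_swap[OF \<omega>]) auto
  also have "?ys[a - m := ?g a, b - m := ?g b] = ?ys"
    using swap.hyps(1-3) by (intro nth_equalityI) (auto simp: nth_list_update)
  finally show ?case
    unfolding sign_compose[OF permutes_imp_permutation[OF finite_atLeastLessThan swap.hyps(4)] permutation_swap_id]
    using swap.hyps(3) swap.IH by (simp add: sign_swap_id)
qed

lemma contr_forms: "\<omega> \<in> forms (Suc k) \<Longrightarrow> contr x \<omega> \<in> forms k" for x :: "'g::real_vector \<times> 'g"
proof (rule formsI)
  fix xs :: "('g \<times> 'g) list" and i assume \<omega>: "\<omega> \<in> forms (Suc k)" "length xs = k" "i < k"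
  then show "(\<lambda>u. contr x \<omega> (xs[i := u])) \<in> cdual"
    using forms_slot[OF \<omega>(1), of "x # xs" "Suc i"] by (simp add: contr_def)
next
  fix xs :: "('g \<times> 'g) list" and i j assume \<omega>: "\<omega> \<in> forms (Suc k)" "length xs = k" "i < j" "j < k" "xs ! i = xs ! j"
  then show "contr x \<omega> xs = 0"
    using forms_alt[OF \<omega>(1), of "x # xs" "Suc i" "Suc j"] by (simp add: contr_def)
qed (simp add: contr_def forms_length)

lemma forms_zero_entry:
  assumes "\<omega> \<in> forms k" "0 \<in> set xs"
  shows "\<omega> xs = 0"
proof (cases "length xs = k")
  case True
  obtain i where "i < length xs" "xs ! i = 0" using assms(2) by (auto simp: in_set_conv_nth)
  then show ?thesis using cdual_zero[OF forms_slot[OF assms(1) True, of i]] True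
      list_update_id[of xs i] by simp
qed (simp add: forms_length[OF assms(1)])

text \<open>The front entry reaches slot \<open>j\<close> by \<open>j\<close> adjacent swaps. This
  turns the terms of the differential that involve the first argument into slot
  replacements.\<close>

lemma forms_move:
  "\<omega> \<in> forms (length ys) \<Longrightarrow> j < length ys \<Longrightarrow> \<omega> (c # nths ys (- {j})) = (-1) ^ j * \<omega> (ys[j := c])"
proof (induction ys arbitrary: \<omega> j)
  case (Cons y ws)
  show ?case
  proof (cases j)
    case 0
    have "nths ws UNIV = ws" by (simp add: nths_all)
    moreover have "{j. Suc j \<in> - {0}} = UNIV" by auto
    ultimately show ?thesis by (simp add: 0 nths_Cons)
  next
    case (Suc m)
    have *: "{j. Suc j \<in> - {Suc m}} = - {m}" by auto
    have "\<omega> (c # nths (y # ws) (- {j})) = - contr y \<omega> (c # nths ws (- {m}))"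
      using forms_swap_front[OF Cons.prems(1), of c y "nths ws (- {m})"]
      unfolding Suc nths_Cons * by (simp add: contr_def)
    also have "\<dots> = - ((-1) ^ m * contr y \<omega> (ws[m := c]))"
      using Cons.prems Suc by (subst Cons.IH) (auto intro: contr_forms)
    finally show ?thesis by (simp add: Suc contr_def)
  qed
qed simp

lemma forms_map:
  fixes f :: "'h::real_vector \<times> 'h \<Rightarrow> 'g::real_vector \<times> 'g"
  assumes \<omega>: "\<omega> \<in> forms k" and f: "\<And>u v. f (u + v) = f u + f v" "\<And>c u. f (cscale c u) = cscale c (f u)"
  shows "(\<lambda>xs. \<omega> (map f xs)) \<in> forms k"
proof (rule formsI)
  fix xs :: "('h \<times> 'h) list" and i assume xs: "length xs = k" "i < k"
  then show "(\<lambda>x. \<omega> (map f (xs[i := x]))) \<in> cdual"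
    using cdual_comp[OF forms_slot[OF \<omega>, of "map f xs" i] f] by (simp add: map_update)
next
  fix xs :: "('h \<times> 'h) list" and i j assume "length xs = k" "i < j" "j < k" "xs ! i = xs ! j"
  then show "\<omega> (map f xs) = 0" by (intro forms_alt[OF \<omega>, of _ i j]) auto
qed (simp add: forms_length[OF \<omega>])

text \<open>If two entries are equal, only the terms that replace one of them survive, and these two
  cancel by a swap. With \<open>f\<close> a bracket by a fixed vector this is, up to sign, a Lie
  derivative.\<close>

lemma forms_derivation:
  fixes f :: "'g::real_vector \<times> 'g \<Rightarrow> 'g \<times> 'g"
  assumes \<omega>: "\<omega> \<in> forms k" and f: "\<And>u v. f (u + v) = f u + f v" "\<And>c u. f (cscale c u) = cscale c (f u)"
  shows "(\<lambda>xs. \<Sum>j<length xs. \<omega> (xs[j := f (xs ! j)])) \<in> forms k"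
proof (rule formsI)
  fix xs :: "('g \<times> 'g) list" and i assume xs: "length xs = k" "i < k"
  have "(\<lambda>x. \<omega> (xs[i := x, j := f (xs[i := x] ! j)])) \<in> cdual" if "j < k" for j
  proof (cases "j = i")
    case True
    then show ?thesis using xs cdual_comp[OF forms_slot[OF \<omega> xs] f] by simp
  next
    case False
    then show ?thesis using xs forms_slot[OF \<omega>, of "xs[j := f (xs ! j)]" i]
      by (simp add: list_update_swap[of i j])
  qed
  then have "(\<lambda>x. \<Sum>j<k. \<omega> (xs[i := x, j := f (xs[i := x] ! j)])) \<in> cdual"
    by (intro cdual_sum_fun) simp
  then show "(\<lambda>x. \<Sum>j<length (xs[i := x]). \<omega> (xs[i := x, j := f (xs[i := x] ! j)])) \<in> cdual"
    using xs by simp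
next
  fix xs :: "('g \<times> 'g) list" and i j assume xs: "length xs = k" "i < j" "j < k" "xs ! i = xs ! j"
  have "\<omega> (xs[l := f (xs ! l)]) = 0" if "l < k" "l \<noteq> i" "l \<noteq> j" for l
    using xs that by (intro forms_alt[OF \<omega>, of _ i j]) auto
  then have "(\<Sum>l<k. \<omega> (xs[l := f (xs ! l)])) = (\<Sum>l\<in>{i, j}. \<omega> (xs[l := f (xs ! l)]))"
    using xs by (intro sum.mono_neutral_right) auto
  also have "\<dots> = \<omega> (xs[i := f (xs ! i), j := xs ! j]) + \<omega> (xs[i := xs ! i, j := f (xs ! j)])"
    using xs(2) list_update_id[of "xs[i := f (xs ! i)]" j] by simp
  also have "\<dots> = 0"
    using xs forms_swap[OF \<omega> xs(1), of i j "f (xs ! i)" "xs ! i"] by simp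
  finally show "(\<Sum>l<length xs. \<omega> (xs[l := f (xs ! l)])) = 0" using xs by simp
qed (simp add: forms_length[OF \<omega>])

lemma forms_uminus: "\<omega> \<in> forms k \<Longrightarrow> (\<lambda>xs. - \<omega> xs) \<in> forms k"
  for \<omega> :: "('g::real_vector \<times> 'g) list \<Rightarrow> complex"
proof (rule formsI)
  fix xs :: "('g \<times> 'g) list" and i assume "\<omega> \<in> forms k" "length xs = k" "i < k"
  from forms_slot[OF this] show "(\<lambda>x. - \<omega> (xs[i := x])) \<in> cdual"
    by (rule cdual_uminus)
next
  fix xs :: "('g \<times> 'g) list" and i j assume "\<omega> \<in> forms k" "length xs = k" "i < j" "j < k" "xs ! i = xs ! j"
  then show "- \<omega> xs = 0" using forms_alt[of \<omega> k xs i j] by simp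
qed (simp add: forms_length)

lemma forms_lin:
  assumes \<omega>: "\<omega> \<in> forms k" and \<omega>': "\<omega>' \<in> forms k"
  shows "fscale c \<omega> + \<omega>' \<in> forms k"
proof (rule formsI)
  fix xs :: "('a \<times> 'a) list" and i assume i: "length xs = k" "i < k"
  show "(\<lambda>x. (fscale c \<omega> + \<omega>') (xs[i := x])) \<in> cdual"
    using cdual_add[OF forms_slot[OF \<omega> i]] cdual_add[OF forms_slot[OF \<omega>' i]]
      cdual_scale[OF forms_slot[OF \<omega> i]] cdual_scale[OF forms_slot[OF \<omega>' i]]
    by (intro cdualI) (simp_all only: plus_fun_apply fscale_def distrib_left ac_simps)
next
  fix xs :: "('a \<times> 'a) list" and i j assume "length xs = k" "i < j" "j < k" "xs ! i = xs ! j"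
  then show "(fscale c \<omega> + \<omega>') xs = 0"
    using forms_alt[OF \<omega>, of xs i j] forms_alt[OF \<omega>', of xs i j] by (simp add: fscale_def)
qed (simp add: fscale_def forms_length[OF \<omega>] forms_length[OF \<omega>'])

text \<open>Each permutation of the slots is uniquely a transposition of 0 and \<open>b\<close>
  composed with a permutation of the slots of \<beta>. The sign of the latter is cancelled by the
  alternation of \<beta>, so each \<open>b\<close> is counted \<open>fact q\<close> times, which is
  exactly the normalising denominator.\<close>

lemma wedge_one_Cons:
  assumes \<beta>: "\<beta> \<in> forms q" and ys: "length ys = q"
  shows "wedge 1 q \<alpha> \<beta> (x # ys) = \<alpha> [x] * \<beta> ys - (\<Sum>b<q. \<alpha> [ys ! b] * \<beta> (ys[b := x]))"
proof -
  define xs where "xs = x # ys"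
  let ?t = "\<lambda>b. Transposition.transpose (0::nat) b"
  define f where "f = (\<lambda>\<sigma>. of_int (sign \<sigma>) * \<alpha> [xs ! \<sigma> 0] * \<beta> (map (\<lambda>i. xs ! \<sigma> i) [1..<1 + q]))"
  define w where "w = (\<lambda>b. map (\<lambda>i. xs ! ?t b i) [1..<1 + q])"
  have ins: "{..<1 + q} = insert 0 {1..<1 + q}" by auto
  have f: "f (?t b \<circ> \<tau>) = of_int (sign (?t b)) * \<alpha> [xs ! b] * \<beta> (w b)"
    if \<tau>: "\<tau> permutes {1..<1 + q}" for b \<tau>
  proof -
    have "\<tau> 0 = 0" using \<tau> by (simp add: permutes_def)
    moreover have "of_int (sign \<tau>) * of_int (sign \<tau>) = (1 :: complex)"
      unfolding of_int_mult[symmetric] sign_idempotent by (rule of_int_1)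
    moreover have "sign (?t b \<circ> \<tau>) = sign (?t b) * sign \<tau>"
      by (intro sign_compose permutation_swap_id permutes_imp_permutation[OF finite_atLeastLessThan \<tau>])
    ultimately show ?thesis
      unfolding f_def w_def o_apply using forms_permute[OF \<beta> \<tau>, of "\<lambda>i. xs ! ?t b i"]
      by (simp only: o_def of_int_mult transpose_apply_first mult_ac)
         (simp only: mult.assoc[symmetric] mult_1_left)
  qed
  have card: "card {\<tau>. \<tau> permutes {1..<1 + q}} = fact q" by (rule card_permutations) auto
  have w0: "w 0 = ys"
    using ys by (intro nth_equalityI) (simp_all add: w_def xs_def del: upt_Suc)
  have wS: "w (Suc b) = ys[b := x]" if "b < q" for b
    using ys that by (intro nth_equalityI) (auto simp: w_def xs_def Transposition.transpose_def nth_list_update simp del: upt_Suc)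
  have "(\<Sum>\<sigma> | \<sigma> permutes {..<1 + q}. f \<sigma>) =
      (\<Sum>b<1 + q. \<Sum>\<tau> | \<tau> permutes {1..<1 + q}. f (?t b \<circ> \<tau>))"
    unfolding ins by (rule sum_over_permutations_insert) auto
  also have "\<dots> = (\<Sum>b<1 + q. fact q * (of_int (sign (?t b)) * \<alpha> [xs ! b] * \<beta> (w b)))"
    using card by (intro sum.cong refl) (simp add: f del: o_apply)
  also have "\<dots> = fact q * (\<Sum>b<Suc q. of_int (sign (?t b)) * \<alpha> [xs ! b] * \<beta> (w b))"
    by (simp only: sum_distrib_left plus_1_eq_Suc)
  also have "(\<Sum>b<Suc q. of_int (sign (?t b)) * \<alpha> [xs ! b] * \<beta> (w b)) =
     \<alpha> [x] * \<beta> ys - (\<Sum>b<q. \<alpha> [ys ! b] * \<beta> (ys[b := x]))"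
    unfolding sum.lessThan_Suc_shift
    by (simp add: w0 wS xs_def sign_swap_id sum_negf)
  finally show ?thesis using ys by (simp add: wedge_def f_def xs_def)
qed
section \<open>The Chevalley--Eilenberg differential of an arbitrary bracket\<close>

text \<open>The bracket is a parameter because the deformed operator is governed by
  \<open>[u, v] - [\<phi> u, v] - [u, \<phi> v]\<close> instead of the bracket of the
  complexification.\<close>

definition alt_d :: "('c \<Rightarrow> 'c \<Rightarrow> 'c) \<Rightarrow> ('c list \<Rightarrow> complex) \<Rightarrow> 'c list \<Rightarrow> complex" where
  "alt_d B \<omega> xs = (\<Sum>j<length xs. \<Sum>i<j.
     (-1) ^ (i + j) * \<omega> (B (xs ! i) (xs ! j) # nths xs (- {i, j})))"

lemma ce_d_eq_alt_d: "ce_d br = alt_d (cbr br)"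
  by (intro ext) (simp add: ce_d_def alt_d_def)

lemma alt_d_Nil [simp]: "alt_d B \<omega> [] = 0"
  by (simp add: alt_d_def)

lemma alt_d_zero: "alt_d B (\<lambda>xs. 0) xs = 0"
  by (simp add: alt_d_def)

text \<open>Pairs of positions are separated by whether the first argument is involved. Shifting
  both indices keeps the sign, shifting one of them reverses it.\<close>

lemma alt_d_Cons:
  "alt_d B \<omega> (x # ys) = - (\<Sum>j<length ys. (-1) ^ j * \<omega> (B x (ys ! j) # nths ys (- {j}))) +
     (\<Sum>j<length ys. \<Sum>i<j. (-1) ^ (i + j) * \<omega> (B (ys ! i) (ys ! j) # x # nths ys (- {i, j})))"
proof -
  have 1: "nths (x # ys) (- {0, Suc j}) = nths ys (- {j})" for j
  proof -
    have "{l. Suc l \<in> - {0, Suc j}} = - {j}" by auto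
    then show ?thesis by (simp add: nths_Cons)
  qed
  have 2: "nths (x # ys) (- {Suc i, Suc j}) = x # nths ys (- {i, j})" for i j
  proof -
    have "{l. Suc l \<in> - {Suc i, Suc j}} = - {i, j}" by auto
    then show ?thesis by (simp add: nths_Cons)
  qed
  show ?thesis
    unfolding alt_d_def list.size add_Suc_right add_0_right sum.lessThan_Suc_shift
    by (simp add: 1 2 sum.distrib sum_negf sum_subtractf)
qed

text \<open>Cartan's formula: contracting the differential with \<open>x\<close> gives the Lie
  derivative along \<open>x\<close> minus the differential of the contraction. It drives the
  recursions on the list of arguments.\<close>

lemma alt_d_Cons_forms:
  assumes \<omega>: "\<omega> \<in> forms (length ys)"
  shows "alt_d B \<omega> (x # ys) = - (\<Sum>j<length ys. \<omega> (ys[j := B x (ys ! j)])) - alt_d B (contr x \<omega>) ys"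
proof -
  have 1: "(-1) ^ j * \<omega> (c # nths ys (- {j})) = \<omega> (ys[j := c])" if "j < length ys" for j c
    using forms_move[OF \<omega> that] by simp
  have 2: "\<omega> (c # x # zs) = - contr x \<omega> (c # zs)" for c zs
    using forms_swap_front[OF \<omega>, of c x zs] by (simp add: contr_def)
  show ?thesis unfolding alt_d_Cons 2
    by (simp add: 1 sum_negf) (simp add: alt_d_def)
qed

lemma alt_d_cong:
  assumes "\<And>i j zs. i < length xs \<Longrightarrow> j < length xs \<Longrightarrow>
    \<omega> (B (xs ! i) (xs ! j) # nths xs (- {i, j})) = \<omega>' (B' (xs' ! i) (xs' ! j) # nths xs' (- {i, j}))"
    "length xs = length xs'"
  shows "alt_d B \<omega> xs = alt_d B' \<omega>' xs'"
  unfolding alt_d_def assms(2)[symmetric] using assms(1) by (intro sum.cong refl) auto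

lemma alt_d_diff:
  assumes \<omega>: "\<omega> \<in> forms k"
  shows "alt_d (\<lambda>u v. B u v - B' u v) \<omega> xs = alt_d B \<omega> xs - alt_d B' \<omega> xs"
proof -
  have "\<omega> ((u - v) # zs) = \<omega> (u # zs) - \<omega> (v # zs)" for u v zs
  proof (cases "length (u # zs) = k")
    case True
    then show ?thesis using cdual_diff[OF forms_slot[OF \<omega> True, of 0], of u v] True by simp
  next
    case False
    then show ?thesis by (simp add: forms_length[OF \<omega>])
  qed
  then show ?thesis by (simp add: alt_d_def right_diff_distrib sum_subtractf)
qed

text \<open>For \<open>\<beta> u v = [\<phi> u, v]\<close> this is \<open>i\<^sub>\<phi> \<partial>\<omega>\<close> on vectors of type (0,1); see \<open>ins_del\<close> below.\<close>

fun ins_d :: "('c \<Rightarrow> 'c \<Rightarrow> 'c) \<Rightarrow> ('c list \<Rightarrow> complex) \<Rightarrow> 'c list \<Rightarrow> complex" where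
  "ins_d \<beta> \<omega> [] = 0"
| "ins_d \<beta> \<omega> (x # ys) = - (\<Sum>j<length ys. \<omega> (ys[j := \<beta> x (ys ! j)])) +
     (\<Sum>b<length ys. \<Sum>j<length ys. \<omega> (ys[b := x, j := \<beta> (ys ! b) (ys[b := x] ! j)]))"

text \<open>For \<open>j = b\<close> the second update overwrites the first, so that
  \<open>x\<close> survives only inside \<beta>; these diagonal terms supply the second half of the
  antisymmetrised bracket.\<close>

lemma sum_update_split:
  fixes f :: "'c list \<Rightarrow> complex"
  shows "(\<Sum>b<length ys. \<Sum>j<length ys. f (ys[b := x, j := \<beta> (ys ! b) (ys[b := x] ! j)])) =
    (\<Sum>b<length ys. f (ys[b := \<beta> (ys ! b) x]) +
       (\<Sum>j\<in>{..<length ys} - {b}. f (ys[b := x, j := \<beta> (ys ! b) (ys ! j)])))"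
proof (rule sum.cong[OF refl])
  fix b assume "b \<in> {..<length ys}"
  then show "(\<Sum>j<length ys. f (ys[b := x, j := \<beta> (ys ! b) (ys[b := x] ! j)])) =
      f (ys[b := \<beta> (ys ! b) x]) + (\<Sum>j\<in>{..<length ys} - {b}. f (ys[b := x, j := \<beta> (ys ! b) (ys ! j)]))"
    by (subst sum.remove[of _ b]) auto
qed

text \<open>The part of the double sum in which the two positions differ is again of the form \<open>ins_d\<close>.\<close>

lemma ins_d_rest:
  assumes \<omega>: "\<omega> \<in> forms (length ys)"
  shows "(\<Sum>b<length ys. \<Sum>j\<in>{..<length ys} - {b}. \<omega> (ys[b := x, j := \<beta> (ys ! b) (ys ! j)])) =
    - ins_d \<beta> (contr x \<omega>) ys"
proof (cases ys)
  case (Cons y ws)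
  let ?n = "length ws"
  have \<omega>': "\<omega> \<in> forms (Suc ?n)" using \<omega> Cons by simp
  have split: "{..<Suc ?n} - {Suc b} = insert 0 (Suc ` ({..<?n} - {b}))" for b
    unfolding lessThan_Suc_eq_insert_0 by auto
  have split0: "{..<Suc ?n} - {0} = Suc ` {..<?n}"
    unfolding lessThan_Suc_eq_insert_0 by auto
  have swap: "\<omega> (c # ws[b := x]) = - contr x \<omega> (ws[b := c])" if "b < ?n" for b c
    using forms_swap[OF \<omega>', of "y # ws" 0 "Suc b" c x] that by (simp add: contr_def)
  have swap2: "\<omega> (y # ws[b := x, j := c]) = - contr x \<omega> (ws[b := y, j := c])"
    if "b < ?n" "j < ?n" "j \<noteq> b" for b j c
    using forms_swap[OF \<omega>', of "y # ws[j := c]" 0 "Suc b" y x] that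
    by (simp add: contr_def list_update_swap[of b j])
  have "(\<Sum>b<length ys. \<Sum>j\<in>{..<length ys} - {b}. \<omega> (ys[b := x, j := \<beta> (ys ! b) (ys ! j)])) =
    (\<Sum>j<?n. \<omega> (x # ws[j := \<beta> y (ws ! j)])) +
    (\<Sum>b<?n. \<omega> (\<beta> (ws ! b) y # ws[b := x]) +
       (\<Sum>j\<in>{..<?n} - {b}. \<omega> (y # ws[b := x, j := \<beta> (ws ! b) (ws ! j)])))"
    unfolding Cons list.size add_Suc_right add_0_right sum.lessThan_Suc_shift split split0
    by (simp add: sum.reindex)
  also have "\<dots> = (\<Sum>j<?n. contr x \<omega> (ws[j := \<beta> y (ws ! j)])) -
    (\<Sum>b<?n. contr x \<omega> (ws[b := \<beta> (ws ! b) y]) +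
       (\<Sum>j\<in>{..<?n} - {b}. contr x \<omega> (ws[b := y, j := \<beta> (ws ! b) (ws ! j)])))"
    by (simp add: swap swap2 sum_negf sum_subtractf) (simp add: contr_def sum.distrib)
  also have "\<dots> = - ins_d \<beta> (contr x \<omega>) ys"
    unfolding Cons by (simp add: sum_update_split)
  finally show ?thesis .
qed simp

text \<open>Both sides obey the same recursion on the first argument: Cartan's formula on the right,
  and on the left the separation of the diagonal together with \<open>ins_d_rest\<close>. For
  \<beta> given by \<open>[\<phi> u, v]\<close> the bracket on the right is
  \<open>[\<phi> u, v] + [u, \<phi> v]\<close>.\<close>

lemma ins_d_eq_alt_d:
  assumes "\<omega> \<in> forms (length xs - 1)"
  shows "ins_d \<beta> \<omega> xs = alt_d (\<lambda>u v. \<beta> u v - \<beta> v u) \<omega> xs"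
  using assms
proof (induction xs arbitrary: \<omega>)
  case (Cons x ys)
  let ?n = "length ys"
  have \<omega>: "\<omega> \<in> forms ?n" using Cons.prems by simp
  \<comment> \<open>For empty \<open>ys\<close> the degree \<open>length ys - 1\<close> is
    truncated, and both sides vanish directly.\<close>
  have IH: "alt_d (\<lambda>u v. \<beta> u v - \<beta> v u) (contr x \<omega>) ys = ins_d \<beta> (contr x \<omega>) ys"
  proof (cases ys)
    case (Cons y ws)
    then show ?thesis using \<omega> by (intro Cons.IH[symmetric]) (auto intro: contr_forms)
  qed simp
  have "\<omega> (ys[j := \<beta> x (ys ! j) - \<beta> (ys ! j) x]) = \<omega> (ys[j := \<beta> x (ys ! j)]) - \<omega> (ys[j := \<beta> (ys ! j) x])"
    if "j < ?n" for j
    using cdual_diff[OF forms_slot[OF \<omega> refl that]] .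
  then have "alt_d (\<lambda>u v. \<beta> u v - \<beta> v u) \<omega> (x # ys) =
      - (\<Sum>j<?n. \<omega> (ys[j := \<beta> x (ys ! j)])) + (\<Sum>j<?n. \<omega> (ys[j := \<beta> (ys ! j) x])) - ins_d \<beta> (contr x \<omega>) ys"
    by (simp add: alt_d_Cons_forms[OF \<omega>] IH sum_subtractf)
  also have "\<dots> = - (\<Sum>j<?n. \<omega> (ys[j := \<beta> x (ys ! j)])) +
      (\<Sum>b<?n. \<omega> (ys[b := \<beta> (ys ! b) x]) +
        (\<Sum>j\<in>{..<?n} - {b}. \<omega> (ys[b := x, j := \<beta> (ys ! b) (ys ! j)])))"
    by (simp add: sum.distrib ins_d_rest[OF \<omega>])
  finally show ?case by (simp add: sum_update_split)
qed simp

section \<open>The complexified Lie algebra\<close>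

locale lie_algebra =
  fixes br :: "'g::real_vector \<Rightarrow> 'g \<Rightarrow> 'g"
  assumes lie: "lie_bracket br"
begin

lemma br_bilinear: "bilinear br"
  using lie by (simp add: lie_bracket_def)

lemmas br_simps =
  bilinear_ladd[OF br_bilinear] bilinear_radd[OF br_bilinear]
  bilinear_lsub[OF br_bilinear] bilinear_rsub[OF br_bilinear]
  bilinear_lmul[OF br_bilinear] bilinear_rmul[OF br_bilinear]

lemma br_anticomm: "br x y = - br y x"
proof -
  have alt: "br v v = 0" for v using lie by (simp add: lie_bracket_def)
  have "0 = br (x + y) (x + y)" by (simp add: alt)
  also have "\<dots> = br x y + br y x" unfolding br_simps by (simp add: alt)
  finally have "br x y + br y x = 0" by (rule sym)
  then show ?thesis by (simp only: eq_neg_iff_add_eq_0)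
qed

lemma cbr_add_left: "cbr br (u + v) w = cbr br u w + cbr br v w"
  by (simp add: cbr_def br_simps)

lemma cbr_scale_left: "cbr br (cscale c u) w = cscale c (cbr br u w)"
  by (simp add: cbr_def cscale_def br_simps algebra_simps)

lemma cbr_anticomm: "cbr br u v = - cbr br v u"
  using br_anticomm[of "fst u" "fst v"] br_anticomm[of "snd u" "snd v"]
    br_anticomm[of "fst u" "snd v"] br_anticomm[of "snd u" "fst v"]
  by (simp add: cbr_def)

lemma cbr_add_right: "cbr br w (u + v) = cbr br w u + cbr br w v"
  by (simp add: cbr_def br_simps)

lemma cbr_scale_right: "cbr br w (cscale c u) = cscale c (cbr br w u)"
  by (simp add: cbr_def cscale_def br_simps algebra_simps)

lemma cbr_diff_left: "cbr br (u - v) w = cbr br u w - cbr br v w"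
  by (simp add: cbr_def br_simps)

lemma cbr_diff_right: "cbr br w (u - v) = cbr br w u - cbr br w v"
  by (simp add: cbr_def br_simps)

lemma cbr_zero_left [simp]: "cbr br 0 w = 0"
  using cbr_diff_left[of 0 0 w] by simp

end

section \<open>Decomposition of vectors and forms by type\<close>

lemma g10_iff: "w \<in> g10 J \<longleftrightarrow> J (fst w) = - snd w \<and> J (snd w) = fst w"
  by (auto simp: g10_def cJ_def cscale_def prod_eq_iff)

lemma g01_iff: "w \<in> g01 J \<longleftrightarrow> J (fst w) = snd w \<and> J (snd w) = - fst w"
  by (auto simp: g01_def cJ_def cscale_def prod_eq_iff)

lemma pr10_eq: "pr10 J w = ((1/2) *\<^sub>R (fst w + J (snd w)), (1/2) *\<^sub>R (snd w - J (fst w)))"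
  by (simp add: pr10_def cJ_def cscale_def)

lemma pr01_eq: "pr01 J w = ((1/2) *\<^sub>R (fst w - J (snd w)), (1/2) *\<^sub>R (snd w + J (fst w)))"
  by (simp add: pr01_def cJ_def cscale_def)

locale almost_complex =
  fixes J :: "'g::real_vector \<Rightarrow> 'g"
  assumes lin: "linear J" and sq: "J (J x) = - x"
begin

lemmas J_simps = linear_add[OF lin] linear_diff[OF lin] linear_scale[OF lin] linear_neg[OF lin]

lemma pr10_add: "pr10 J (u + v) = pr10 J u + pr10 J v"
  and pr01_add: "pr01 J (u + v) = pr01 J u + pr01 J v"
  by (simp_all add: pr10_eq pr01_eq J_simps algebra_simps)

lemma pr10_scale: "pr10 J (cscale c u) = cscale c (pr10 J u)"
  and pr01_scale: "pr01 J (cscale c u) = cscale c (pr01 J u)"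
  by (simp_all add: pr10_eq pr01_eq cscale_def J_simps algebra_simps)

lemma pr10_g10: "w \<in> g10 J \<Longrightarrow> pr10 J w = w"
  and pr01_g10: "w \<in> g10 J \<Longrightarrow> pr01 J w = 0"
  and pr10_g01: "w \<in> g01 J \<Longrightarrow> pr10 J w = 0"
  and pr01_g01: "w \<in> g01 J \<Longrightarrow> pr01 J w = w"
  by (simp_all add: g10_iff g01_iff pr10_eq pr01_eq prod_eq_iff flip: scaleR_add_left)

lemma pr10_mem: "pr10 J w \<in> g10 J" and pr01_mem: "pr01 J w \<in> g01 J"
  by (simp_all add: g10_iff g01_iff pr10_eq pr01_eq J_simps sq algebra_simps)

lemma pr_sum: "pr10 J w + pr01 J w = w"
  by (simp add: pr10_eq pr01_eq prod_eq_iff algebra_simps flip: scaleR_add_left)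

lemmas pr_simps = pr10_g10[OF pr10_mem] pr01_g10[OF pr10_mem] pr10_g01[OF pr01_mem] pr01_g01[OF pr01_mem]

lemma pr10_diff: "pr10 J (u - v) = pr10 J u - pr10 J v"
  and pr01_diff: "pr01 J (u - v) = pr01 J u - pr01 J v"
  by (simp_all add: pr10_eq pr01_eq J_simps algebra_simps)

lemma pr01_zero: "pr01 J 0 = 0"
  using pr01_diff[of 0 0] by simp

lemma g10_pr01: "pr01 J w = 0 \<Longrightarrow> w \<in> g10 J"
  and g01_pr10: "pr10 J w = 0 \<Longrightarrow> w \<in> g01 J"
  using pr_sum[of w] pr10_mem[of w] pr01_mem[of w] by auto

text \<open>\<open>Lam\<close> constrains only lists whose entries all have pure type. Induction on
  the number of mixed entries: such an entry is split into its two parts, and each part leaves fewer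
  mixed entries.\<close>

lemma Lam_g10:
  assumes \<omega>: "\<omega> \<in> Lam J 0 q" and xs: "i < length xs" "xs ! i \<in> g10 J"
  shows "\<omega> xs = 0"
  using xs
proof (induction "card {l. l < length xs \<and> xs ! l \<notin> g10 J \<union> g01 J}" arbitrary: xs rule: less_induct)
  case less
  have F: "\<omega> \<in> forms q" using \<omega> by (simp add: Lam_def)
  let ?N = "\<lambda>xs. {l. l < length xs \<and> xs ! l \<notin> g10 J \<union> g01 J}"
  consider "length xs \<noteq> q" | "length xs = q" "?N xs = {}" | l where "length xs = q" "l \<in> ?N xs" by blast
  then show ?case
  proof cases
    case 1
    then show ?thesis using F by (simp add: forms_length)
  next
    case 2
    have "set xs \<subseteq> g10 J \<union> g01 J" using 2(2) by (force simp: in_set_conv_nth)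
    moreover have "xs ! i \<in> set (filter (\<lambda>x. x \<in> g10 J) xs)" using less.prems by simp
    then have "length (filter (\<lambda>x. x \<in> g10 J) xs) \<noteq> 0" by (metis length_pos_if_in_set less_not_refl)
    ultimately show ?thesis using \<omega> unfolding Lam_def by blast
  next
    case 3
    then have l: "l < q" "xs ! l \<notin> g10 J \<union> g01 J" "i \<noteq> l" using less.prems by auto
    have "\<omega> (xs[l := v]) = 0" if v: "v \<in> g10 J \<union> g01 J" for v
    proof (rule less.hyps)
      show "card (?N (xs[l := v])) < card (?N xs)"
      proof (rule psubset_card_mono)
        show "?N (xs[l := v]) \<subset> ?N xs"
          using v 3 by (auto simp: nth_list_update split: if_splits)
      qed simp
      show "i < length (xs[l := v])" "xs[l := v] ! i \<in> g10 J" using less.prems l by auto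
    qed
    then have "\<omega> (xs[l := pr10 J (xs ! l) + pr01 J (xs ! l)]) = 0"
      using cdual_add[OF forms_slot[OF F 3(1) l(1)]] pr10_mem pr01_mem by simp
    then show ?thesis by (simp add: pr_sum)
  qed
qed

text \<open>The entries are projected one after the other from the left; each discarded part has
  type (1,0) and contributes nothing by \<open>Lam_g10\<close>.\<close>

lemma Lam_pr01:
  assumes \<omega>: "\<omega> \<in> Lam J 0 q"
  shows "\<omega> (map (pr01 J) xs) = \<omega> xs"
proof (cases "length xs = q")
  case True
  have F: "\<omega> \<in> forms q" using \<omega> by (simp add: Lam_def)
  have "\<omega> (map (pr01 J) (take k xs) @ drop k xs) = \<omega> xs" if "k \<le> q" for k
    using that
  proof (induction k)
    case (Suc k)
    let ?ys = "map (pr01 J) (take k xs) @ drop k xs"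
    have len: "length ?ys = q" using True by simp
    have k: "k < q" using Suc by simp
    have nth: "?ys ! k = xs ! k" using True k by (simp add: nth_append)
    have "map (pr01 J) (take (Suc k) xs) @ drop (Suc k) xs = ?ys[k := pr01 J (xs ! k)]"
      using True k by (intro nth_equalityI) (auto simp: nth_append nth_list_update min_def less_Suc_eq)
    moreover have "\<omega> (?ys[k := pr10 J (xs ! k)]) = 0"
      using len k pr10_mem by (intro Lam_g10[OF \<omega>, of k]) auto
    moreover have "\<omega> (?ys[k := pr10 J (xs ! k) + pr01 J (xs ! k)]) = \<omega> ?ys"
      unfolding pr_sum using list_update_id[of ?ys k] nth by simp
    ultimately show ?case
      using cdual_add[OF forms_slot[OF F len k]] Suc by simp
  qed simp
  from this[of q] show ?thesis using True by simp
next
  case False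
  have F: "\<omega> \<in> forms q" using \<omega> by (simp add: Lam_def)
  show ?thesis using False by (simp add: forms_length[OF F])
qed

text \<open>A map that kills \<open>g10 J\<close> puts a zero into every list with an entry of type
  (1,0), so the pullback is of type (0,q) for \<open>J\<close>, whatever the range of
  \<open>f\<close>.\<close>

lemma Lam_map:
  fixes \<omega> :: "('h::real_vector \<times> 'h) list \<Rightarrow> complex"
  assumes \<omega>: "\<omega> \<in> Lam J' 0 q"
    and f: "\<And>u v. f (u + v) = f u + f v" "\<And>c u. f (cscale c u) = cscale c (f u)"
    and f0: "\<And>x. x \<in> g10 J \<Longrightarrow> f x = 0"
  shows "(\<lambda>xs. \<omega> (map f xs)) \<in> Lam J 0 q"
proof -
  have F: "\<omega> \<in> forms q" using \<omega> by (simp add: Lam_def)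
  have "\<omega> (map f xs) = 0" if "length (filter (\<lambda>x. x \<in> g10 J) xs) \<noteq> 0" for xs
  proof -
    have "\<exists>x\<in>set xs. x \<in> g10 J" using that unfolding length_0_conv filter_empty_conv by blast
    then obtain x where "x \<in> set xs" "x \<in> g10 J" by blast
    then have "0 \<in> set (map f xs)" using f0[of x] by (metis image_eqI set_map)
    then show ?thesis by (rule forms_zero_entry[OF F])
  qed
  then show ?thesis using forms_map[OF F f] by (auto simp: Lam_def)
qed

end

lemma bideg_0: "bideg J 0 q \<omega> xs = (if length xs = q then \<omega> (map (pr01 J) xs) else 0)"
proof -
  have "S = {}" if "S \<subseteq> {..<q}" "card S = 0" for S
    using that finite_subset[OF that(1)] by simp
  then have S: "{S. S \<subseteq> {..<q} \<and> card S = 0} = {{}}" by (intro equalityI subsetI) simp_all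
  have "map (\<lambda>i. pr01 J (xs ! i)) [0..<length xs] = map (pr01 J) xs"
    by (intro nth_equalityI) auto
  then show ?thesis using S by (cases "length xs = q") (simp_all add: bideg_def)
qed

lemma bideg_1: "bideg J (Suc 0) q \<omega> xs = (if length xs = Suc q then
    (\<Sum>i<Suc q. \<omega> (map (\<lambda>k. if k = i then pr10 J (xs ! k) else pr01 J (xs ! k)) [0..<Suc q])) else 0)"
proof -
  have "{S. S \<subseteq> {..<Suc q} \<and> card S = Suc 0} = (\<lambda>i. {i}) ` {..<Suc q}"
    by (auto simp: card_1_singleton_iff)
  then show ?thesis by (simp add: bideg_def sum.reindex)
qed

lemma bideg_full: "bideg J p 0 \<omega> xs = (if length xs = p then \<omega> (map (pr10 J) xs) else 0)"
proof -
  have "S = {..<p}" if "S \<subseteq> {..<p}" "card S = p" for S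
    using card_subset_eq[OF finite_lessThan that(1)] that(2) by simp
  then have S: "{S. S \<subseteq> {..<p} \<and> card S = p} = {{..<p}}" by (intro equalityI subsetI) simp_all
  have "map (\<lambda>i. if i \<in> {..<p} then pr10 J (xs ! i) else pr01 J (xs ! i)) [0..<p] = map (pr10 J) xs"
    if "length xs = p" using that by (intro nth_equalityI) auto
  then show ?thesis using S by (cases "length xs = p") (simp_all add: bideg_def)
qed

section \<open>The operators of the deformed complex\<close>

lemma ce_d_one: "ce_d br \<omega> [u, v] = - \<omega> [cbr br u v]"
proof -
  have "nths [u, v] (- {0, Suc 0}) = []" by (simp add: nths_Cons)
  then show ?thesis by (simp add: ce_d_def lessThan_Suc)
qed

lemma delbar_0:
  "delbar br J 0 q \<omega> xs = (if length xs = Suc q then alt_d (cbr br) \<omega> (map (pr01 J) xs) else 0)"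
  by (simp add: delbar_def bideg_0 ce_d_eq_alt_d)

text \<open>One member \<phi> of the family is fixed, before any deformed structure is named.
  Integrability of \<open>J\<close> enters as closure of \<open>g10 J\<close> under the bracket.
  Finiteness of \<open>Z\<close> matters because a sum over an infinite set is 0 by default.\<close>

locale beltrami = lie_algebra br + almost_complex J
  for br :: "'g::real_vector \<Rightarrow> 'g \<Rightarrow> 'g" and J +
  fixes Z :: "('g \<times> 'g) set" and \<phi> :: "'g \<times> 'g \<Rightarrow> 'g \<times> 'g"
  assumes g10_cbr: "u \<in> g10 J \<Longrightarrow> v \<in> g10 J \<Longrightarrow> cbr br u v \<in> g10 J"
    and phi: "\<phi> \<in> Lam01_T10 J" and Z: "is_basis10 J Z" and finZ: "finite Z"
begin

lemma phi_add: "\<phi> (u + v) = \<phi> u + \<phi> v" and phi_scale: "\<phi> (cscale c u) = cscale c (\<phi> u)"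
proof -
  have "Vector_Spaces.linear cscale cscale \<phi>" using phi unfolding Lam01_T10_def by blast
  then show "\<phi> (u + v) = \<phi> u + \<phi> v" "\<phi> (cscale c u) = cscale c (\<phi> u)"
    unfolding Vector_Spaces.linear_def module_hom_def module_hom_axioms_def by blast+
qed

lemma phi_g10: "x \<in> g10 J \<Longrightarrow> \<phi> x = 0" and phi_mem: "\<phi> x \<in> g10 J"
  using phi unfolding Lam01_T10_def by blast+

lemma phi_diff: "\<phi> (u - v) = \<phi> u - \<phi> v"
  using phi_add[of "u - v" v] by simp

lemma phi_minus: "\<phi> (- u) = - \<phi> u"
  using phi_diff[of 0 u] phi_diff[of 0 0] by simp

lemma phi_pr01: "\<phi> (pr01 J x) = \<phi> x"
  using phi_add[of "pr10 J x" "pr01 J x"] phi_g10[OF pr10_mem] by (simp add: pr_sum)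

text \<open>Composing \<open>1 - \<phi>\<close> with \<open>pr01 J\<close> extends it to the whole
  complexification with kernel \<open>g10 J\<close>, so that forms pulled back along it are of type
  (0,q) for \<open>J\<close>.\<close>

definition rho :: "'g \<times> 'g \<Rightarrow> 'g \<times> 'g" where
  "rho x = pr01 J x - \<phi> x"

text \<open>The projection onto \<open>g10 J\<close> along the range of \<open>rho\<close>.\<close>

definition proj :: "'g \<times> 'g \<Rightarrow> 'g \<times> 'g" where
  "proj v = pr10 J v + \<phi> v"

lemma sum_coord: "(\<Sum>z\<in>Z. cscale (coord Z \<phi> z [x]) z) = \<phi> x"
  using Z phi_mem[of x] finZ
  by (simp add: coord_def one_form_def is_basis10_def cvs.sum_representation_eq)

text \<open>This removes the basis \<open>Z\<close> from the formulas: the coordinates of \<phi>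
  recombine under any linear functional.\<close>

lemma sum_coord_cdual: "\<xi> \<in> cdual \<Longrightarrow> (\<Sum>z\<in>Z. coord Z \<phi> z [x] * \<xi> z) = \<xi> (\<phi> x)"
  using cdual_sum[of \<xi> "\<lambda>z. coord Z \<phi> z [x]" "\<lambda>z. z" Z] by (simp add: sum_coord)

lemma Z_g10: "z \<in> Z \<Longrightarrow> z \<in> g10 J"
  using Z unfolding is_basis10_def by (metis cvs.span_base)

lemma cbr_sum_left: "(\<Sum>z\<in>S. cscale (c z) (cbr br z Y)) = cbr br (\<Sum>z\<in>S. cscale (c z) z) Y"
  by (induction S rule: infinite_finite_induct) (simp_all add: cbr_add_left cbr_scale_left)

text \<open>The Froehlicher-Nijenhuis term equals \<open>[\<phi> x, Y] - \<phi> [pr01 x, Y]\<close>.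
  Its second part completes \<open>pr10 [pr01 x, Y]\<close> to \<open>proj [pr01 x, Y]\<close>, and
  its first part is fixed by \<open>proj\<close> because it lies in \<open>g10 J\<close>.\<close>

lemma phi_vec_eq:
  assumes Y: "Y \<in> g10 J"
  shows "phi_vec br J Z \<phi> Y x = proj (cbr br (rho x) Y)"
proof -
  let ?n = "pr01 J x"
  have "fn_bracket_vec br Z \<phi> Y [x] = (\<Sum>z\<in>Z. cscale (coord Z \<phi> z [x]) (cbr br z Y) +
      cscale (coord Z \<phi> z [cbr br Y x]) z)"
    by (simp add: fn_bracket_vec_def fn_bracket_vec_dec_def contr_def ce_d_one)
  also have "\<dots> = cbr br (\<phi> x) Y + \<phi> (cbr br Y x)"
    by (simp only: sum.distrib cbr_sum_left sum_coord)
  \<comment> \<open>Only the (0,1)-part of \<open>x\<close> matters: its (1,0)-part brackets with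
    \<open>Y\<close> into \<open>g10 J\<close>, which \<phi> kills.\<close>
  also have "\<phi> (cbr br Y x) = - \<phi> (cbr br ?n Y)"
  proof -
    have "\<phi> (cbr br Y x) = \<phi> (cbr br Y (pr10 J x) + cbr br Y ?n)"
      by (simp add: pr_sum flip: cbr_add_right)
    also have "\<dots> = \<phi> (cbr br Y ?n)"
      by (simp only: phi_add phi_g10[OF g10_cbr[OF Y pr10_mem]] add_0_left)
    also have "\<dots> = - \<phi> (cbr br ?n Y)"
      by (subst cbr_anticomm) (rule phi_minus)
    finally show ?thesis .
  qed
  finally have F: "fn_bracket_vec br Z \<phi> Y [x] = cbr br (\<phi> x) Y + - \<phi> (cbr br ?n Y)" .
  have P: "cbr br (\<phi> x) Y \<in> g10 J" by (rule g10_cbr[OF phi_mem Y])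
  show ?thesis
    by (simp add: phi_vec_def act_vec_def F proj_def rho_def cbr_diff_left pr10_diff phi_diff
        phi_g10[OF P] pr10_g10[OF P])
qed

text \<open>Of Cartan's formula only the Lie derivative along \<open>z\<close> remains, since
  contracting a form of type (0,q) with \<open>z\<close> gives zero.\<close>

lemma del_contr:
  assumes \<omega>: "\<omega> \<in> Lam J 0 q" and z: "z \<in> g10 J"
  shows "contr z (del br J 0 q \<omega>) ys = (if length ys = q then
    - (\<Sum>j<q. \<omega> ((map (pr01 J) ys)[j := cbr br z (pr01 J (ys ! j))])) else 0)"
proof (cases "length ys = q")
  case True
  have F: "\<omega> \<in> forms q" using \<omega> by (simp add: Lam_def)
  let ?l = "\<lambda>i. map (\<lambda>k. if k = i then pr10 J ((z # ys) ! k) else pr01 J ((z # ys) ! k)) [0..<Suc q]"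
  \<comment> \<open>If the (1,0)-projection falls on a later slot, the front entry becomes
    \<open>pr01 J z = 0\<close>.\<close>
  have "alt_d (cbr br) \<omega> (?l (Suc i)) = 0" for i
  proof -
    obtain ws where ws: "?l (Suc i) = 0 # ws" "length ws = q"
      by (simp add: map_upt_Suc pr01_g10[OF z] del: upt_Suc)
    have "contr 0 \<omega> = (\<lambda>xs. 0)" by (auto simp: contr_def forms_zero_entry[OF F])
    then show ?thesis unfolding ws(1) using F ws(2)
      by (subst alt_d_Cons_forms) (simp_all add: alt_d_zero forms_zero_entry[OF F] set_update_memI)
  qed
  moreover have "?l 0 = z # map (pr01 J) ys"
  proof -
    have "map (\<lambda>i. pr01 J (ys ! i)) [0..<q] = map (pr01 J) ys" using True by (intro nth_equalityI) auto
    then show ?thesis by (simp add: map_upt_Suc pr10_g10[OF z] del: upt_Suc)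
  qed
  moreover have "contr z \<omega> = (\<lambda>xs. 0)"
    using Lam_g10[OF \<omega>, of 0] z by (auto simp: contr_def)
  ultimately have "bideg J (Suc 0) q (alt_d (cbr br) \<omega>) (z # ys) =
      - (\<Sum>j<q. \<omega> ((map (pr01 J) ys)[j := cbr br z (pr01 J (ys ! j))]))"
    using True F
    by (simp only: bideg_1 sum.lessThan_Suc_shift list.size if_True)
       (simp add: alt_d_Cons_forms alt_d_zero)
  then show ?thesis using True by (simp add: contr_def del_def ce_d_eq_alt_d)
next
  case False
  then show ?thesis by (simp add: contr_def del_def bideg_1)
qed

lemma ins_Lam0:
  assumes \<omega>: "\<omega> \<in> Lam J 0 q"
  shows "ins Z \<phi> k \<omega> = 0"
proof -
  have "contr z \<omega> = (\<lambda>xs. 0)" if "z \<in> Z" for z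
    using Lam_g10[OF \<omega>, of 0] Z_g10[OF that] by (auto simp: contr_def)
  then have "wedge 1 (k - 1) (coord Z \<phi> z) (contr z \<omega>) = 0" if "z \<in> Z" for z
    using that by (intro ext) (simp add: wedge_def)
  then show ?thesis by (simp add: ins_def)
qed

text \<open>Expand each wedge with \<open>coord Z \<phi> z\<close> on its first argument and insert
  \<open>del_contr\<close>. The summands are linear in \<open>z\<close>, so the sum over the basis
  replaces \<open>z\<close> by values of \<phi>, which gives the two sums of
  \<open>ins_d\<close>.\<close>

lemma ins_del:
  assumes \<omega>: "\<omega> \<in> Lam J 0 q"
  shows "ins Z \<phi> (Suc q) (del br J 0 q \<omega>) xs =
    (if length xs = Suc q then ins_d (\<lambda>u v. cbr br (\<phi> u) v) \<omega> (map (pr01 J) xs) else 0)"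
proof (cases "length xs = Suc q")
  case True
  then obtain x ys where xs: "xs = x # ys" and ys: "length ys = q" by (cases xs) auto
  have F: "\<omega> \<in> forms q" using \<omega> by (simp add: Lam_def)
  let ?L = "\<lambda>z ys. \<Sum>j<length ys. \<omega> (ys[j := cbr br z (ys ! j)])"
  let ?p = "map (pr01 J)"
  have c: "contr z (del br J 0 q \<omega>) = (\<lambda>ys. - ?L z (?p ys))" if "z \<in> Z" for z
  proof
    fix ys
    show "contr z (del br J 0 q \<omega>) ys = - ?L z (?p ys)"
      by (cases "length ys = q")
        (simp_all add: del_contr[OF \<omega> Z_g10[OF that]] forms_length[OF F] cong: sum.cong_simp)
  qed
  have "(\<lambda>ys. ?L z (?p ys)) \<in> forms q" for z
    by (intro forms_map[OF forms_derivation[OF F]] pr01_add pr01_scale cbr_add_right cbr_scale_right)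
  then have cF: "(\<lambda>ys. - ?L z (?p ys)) \<in> forms q" for z
    by (rule forms_uminus)
  \<comment> \<open>With the other entries fixed, the Lie derivative along \<open>z\<close> is a
    linear functional of \<open>z\<close>.\<close>
  have L: "(\<Sum>z\<in>Z. coord Z \<phi> z [v] * ?L z ws) = ?L (\<phi> v) ws" if "length ws = q" for v ws
  proof (rule sum_coord_cdual)
    have "(\<lambda>z. \<omega> (ws[j := cbr br z (ws ! j)])) \<in> cdual" if "j < q" for j
      using \<open>length ws = q\<close> that
      by (intro cdual_comp[OF forms_slot[OF F]] cbr_add_left cbr_scale_left)
    then show "(\<lambda>z. ?L z ws) \<in> cdual" using that by (intro cdual_sum_fun) simp
  qed
  have "ins Z \<phi> (Suc q) (del br J 0 q \<omega>) xs = (\<Sum>z\<in>Z. wedge 1 q (coord Z \<phi> z) (\<lambda>ys. - ?L z (?p ys)) xs)"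
    by (simp add: ins_def fun_sum_apply c)
  also have "\<dots> = (\<Sum>z\<in>Z. (\<Sum>b<q. coord Z \<phi> z [ys ! b] * ?L z (?p (ys[b := x]))) -
      coord Z \<phi> z [x] * ?L z (?p ys))"
    unfolding xs wedge_one_Cons[OF cF ys] by (simp add: sum_negf)
  also have "\<dots> = (\<Sum>b<q. \<Sum>z\<in>Z. coord Z \<phi> z [ys ! b] * ?L z (?p (ys[b := x]))) -
      (\<Sum>z\<in>Z. coord Z \<phi> z [x] * ?L z (?p ys))"
    unfolding sum_subtractf by (subst sum.swap) (rule refl)
  also have "\<dots> = (\<Sum>b<q. ?L (\<phi> (ys ! b)) (?p (ys[b := x]))) - ?L (\<phi> x) (?p ys)"
    using ys by (intro arg_cong2[where f = "(-)"] sum.cong refl L) simp_all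
  also have "\<dots> = ins_d (\<lambda>u v. cbr br (\<phi> u) v) \<omega> (?p xs)"
    using ys by (simp add: xs phi_pr01 map_update)
  finally show ?thesis using True by simp
next
  case False
  then show ?thesis by (simp add: ins_def fun_sum_apply wedge_def)
qed

text \<open>The summand \<open>\<partial> i\<^sub>\<phi>\<close> vanishes on forms of type (0,q).
  What remains is the differential of the bracket of \<open>u - \<phi> u\<close> and
  \<open>v - \<phi> v\<close> without its quadratic term
  \<open>[\<phi> u, \<phi> v]\<close>.\<close>

lemma delbar_phi_0:
  assumes \<omega>: "\<omega> \<in> Lam J 0 q"
  shows "delbar_phi br J Z \<phi> 0 q \<omega> xs = (if length xs = Suc q then
    alt_d (\<lambda>u v. cbr br u v - (cbr br (\<phi> u) v - cbr br (\<phi> v) u)) \<omega> (map (pr01 J) xs) else 0)"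
proof -
  have F: "\<omega> \<in> forms q" using \<omega> by (simp add: Lam_def)
  have "del br J p q' 0 = 0" for p q'
    by (auto simp: del_def bideg_def ce_d_def)
  then have "delbar_phi br J Z \<phi> 0 q \<omega> xs = delbar br J 0 q \<omega> xs - ins Z \<phi> (Suc q) (del br J 0 q \<omega>) xs"
    by (simp add: delbar_phi_def lie10_def ins_Lam0[OF \<omega>])
  then show ?thesis
    using F by (simp add: delbar_0 ins_del[OF \<omega>] alt_d_diff[OF F] ins_d_eq_alt_d)
qed

text \<open>By \<open>phi_vec_eq\<close> the right-hand side is
  \<open>- \<omega> (phi_vec br J Z \<phi> (pr10 J u) x)\<close>, so \<open>phi_cov\<close> is the
  contragredient of \<open>phi_vec\<close>.\<close>

lemma phi_cov_eq:
  assumes \<omega>: "\<omega> \<in> g10_dual J"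
  shows "phi_cov br J Z \<phi> \<omega> x u = - \<omega> (proj (cbr br (rho x) (pr10 J u)))"
proof -
  define n p where "n = pr01 J x" and "p = pr10 J u"
  have W: "\<omega> \<in> cdual" and W01: "\<And>v. v \<in> g01 J \<Longrightarrow> \<omega> v = 0"
    using \<omega> by (auto simp: g10_dual_def)
  have np: "pr10 J n = 0" "pr01 J n = n" "pr10 J p = p" "pr01 J p = 0" "n \<in> g01 J" "p \<in> g10 J"
    by (simp_all add: n_def p_def pr_simps pr01_mem pr10_mem)
  have one: "ins Z \<phi> 1 (one_form \<omega>) = one_form (\<lambda>v. \<omega> (\<phi> v))"
  proof
    fix xs
    show "ins Z \<phi> 1 (one_form \<omega>) xs = one_form (\<lambda>v. \<omega> (\<phi> v)) xs"
    proof (cases "length xs = 1")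
      case True
      then obtain v where v: "xs = [v]" by (cases xs) auto
      have "{\<sigma>. \<sigma> permutes {..<Suc 0}} = {id}" by (simp add: lessThan_Suc)
      then have "wedge 1 0 \<alpha> \<beta> [v] = \<alpha> [v] * \<beta> []" for \<alpha> \<beta>
        by (simp add: wedge_def sign_id)
      then show ?thesis
        by (simp add: ins_def fun_sum_apply v one_form_def contr_def sum_coord_cdual[OF W])
    next
      case False
      then show ?thesis by (simp add: ins_def fun_sum_apply wedge_def one_form_def)
    qed
  qed
  \<comment> \<open>This component serves twice: it is \<open>delbar\<close> of a form of type (1,0)
    and \<open>del\<close> of a form of type (0,1), here of \<omega> and of its composite with
    \<phi>.\<close>
  have b11: "bideg J (Suc 0) (Suc 0) (ce_d br (one_form \<psi>)) [n, p] = - \<psi> (cbr br n p)"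
    if "\<psi> 0 = 0" for \<psi>
    using that by (simp add: bideg_1 ce_d_one one_form_def np lessThan_Suc)
  have two: "ins Z \<phi> 2 (bideg J 2 0 (ce_d br (one_form \<omega>))) [n, p] = - \<omega> (cbr br (\<phi> n) p)"
  proof -
    let ?G = "bideg J 2 0 (ce_d br (one_form \<omega>))"
    have G: "?G [a, b] = - \<omega> (cbr br (pr10 J a) (pr10 J b))" for a b
      by (simp add: bideg_full ce_d_one one_form_def)
    have P: "{\<sigma>. \<sigma> permutes {..<Suc (Suc 0)}} = {id, Transposition.transpose 0 (Suc 0)}"
      by (auto simp: lessThan_Suc permutes_doubleton_iff insert_commute)
    have ne: "id \<noteq> Transposition.transpose 0 (Suc 0 :: nat)"
      by (metis id_apply transpose_apply_first zero_neq_one One_nat_def)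
    have w: "wedge 1 1 \<alpha> \<beta> [a, b] = \<alpha> [a] * \<beta> [b] - \<alpha> [b] * \<beta> [a]" for \<alpha> \<beta> and a b :: "'g \<times> 'g"
      by (simp add: wedge_def P ne sign_swap_id sign_id)
    have p0: "coord Z \<phi> z [p] = 0" for z
      using phi_g10[OF np(6)] Z
      by (simp add: coord_def one_form_def is_basis10_def cvs.representation_zero)
    have "ins Z \<phi> 2 ?G [n, p] = (\<Sum>z\<in>Z. coord Z \<phi> z [n] * (- \<omega> (cbr br z p)))"
      by (simp add: ins_def fun_sum_apply w[simplified] p0 contr_def G pr10_g10[OF Z_g10] np cong: sum.cong_simp)
    also have "\<dots> = - \<omega> (cbr br (\<phi> n) p)"
      using sum_coord_cdual[OF cdual_comp[of \<omega> "\<lambda>v. cbr br v p", OF W cbr_add_left cbr_scale_left], of n] by (simp add: sum_negf)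
    finally show ?thesis .
  qed
  \<comment> \<open>The three terms come from the undeformed operator, from
    \<open>i\<^sub>\<phi> \<partial>\<close> and from \<open>\<partial> i\<^sub>\<phi>\<close>; the
    first and the last combine because
    \<open>\<omega> \<circ> proj = \<omega> + \<omega> \<circ> \<phi>\<close>.\<close>
  have "phi_cov br J Z \<phi> \<omega> x u = - \<omega> (cbr br n p) - (- \<omega> (cbr br (\<phi> n) p) - (- \<omega> (\<phi> (cbr br n p))))"
    using b11[of \<omega>] b11[of "\<lambda>v. \<omega> (\<phi> v)"] two one cdual_zero[OF W] phi_diff[of 0 0]
    by (simp add: phi_cov_def split11_def delbar_phi_def lie10_def delbar_def del_def
        numeral_2_eq_2 flip: n_def p_def)
  also have "\<dots> = - \<omega> (proj (cbr br (n - \<phi> n) p))"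
  proof -
    have 1: "\<omega> (proj v) = \<omega> v + \<omega> (\<phi> v)" for v
    proof -
      have "\<omega> (proj v) = \<omega> (pr10 J v) + \<omega> (\<phi> v)" by (simp add: proj_def cdual_add[OF W])
      also have "\<omega> (pr10 J v) = \<omega> v"
        using cdual_add[OF W, of "pr10 J v" "pr01 J v"] W01[OF pr01_mem[of v]] by (simp add: pr_sum)
      finally show ?thesis .
    qed
    show ?thesis
      unfolding 1 using phi_g10[OF g10_cbr[OF phi_mem np(6)], of n]
      by (simp add: cbr_diff_left phi_diff cdual_diff[OF W])
  qed
  finally show ?thesis by (simp add: rho_def n_def p_def phi_pr01)
qed

end

section \<open>Transport of tensors and cochains\<close>

text \<open>Acting on arguments is contravariant: it sends the tensor of \<open>v\<close> to that of
  \<open>a v\<close> and the tensor of \<omega> to that of \<open>\<omega> \<circ> b\<close>.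
  Nonlinear \<xi> stay unchanged, because \<open>vec_tensor\<close> vanishes on them, whereas their
  composite with \<open>a\<close> might be linear.\<close>

definition tr_arg :: "('g::real_vector \<times> 'g \<Rightarrow> 'g \<times> 'g) \<Rightarrow> ('g \<times> 'g \<Rightarrow> 'g \<times> 'g) \<Rightarrow> ('g \<times> 'g) arg \<Rightarrow> ('g \<times> 'g) arg" where
  "tr_arg a b x = (case x of Vec u \<Rightarrow> Vec (b u) | Cov \<xi> \<Rightarrow> Cov (if \<xi> \<in> cdual then (\<lambda>u. \<xi> (a u)) else \<xi>))"

definition transport :: "('g::real_vector \<times> 'g \<Rightarrow> 'g \<times> 'g) \<Rightarrow> ('g \<times> 'g \<Rightarrow> 'g \<times> 'g) \<Rightarrow> ('g \<times> 'g \<Rightarrow> 'g \<times> 'g) \<Rightarrow>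
    (('g \<times> 'g) list \<times> ('g \<times> 'g) arg list \<Rightarrow> complex) \<Rightarrow> ('g \<times> 'g) list \<times> ('g \<times> 'g) arg list \<Rightarrow> complex" where
  "transport \<alpha> a b F = (\<lambda>(xs, as). F (map \<alpha> xs, map (tr_arg a b) as))"

lemma transport_add: "transport \<alpha> a b (F + G) = transport \<alpha> a b F + transport \<alpha> a b G"
  and transport_scale: "transport \<alpha> a b (fscale c F) = fscale c (transport \<alpha> a b F)"
  by (auto simp: transport_def fscale_def)

lemma block_map: "block m i (map f xs) = map f (block m i xs)"
  by (simp add: block_def take_map drop_map)

lemma wedge_tensor_map:
  "wedge_tensor m es (map f xs) = wedge_tensor m (map (\<lambda>e xs. e (map f xs)) es) xs"
proof -
  have "(\<Prod>i<length es. (es ! \<sigma> i) (block m i (map f xs))) =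
      (\<Prod>i<length es. (map (\<lambda>e xs. e (map f xs)) es ! \<sigma> i) (block m i xs))"
    if "\<sigma> permutes {..<length es}" for \<sigma>
    using permutes_in_image[OF that] by (intro prod.cong refl) (simp add: block_map)
  then show ?thesis by (simp add: wedge_tensor_def)
qed

lemma Lam_lin: "\<omega> \<in> Lam J p q \<Longrightarrow> \<omega>' \<in> Lam J p q \<Longrightarrow> fscale c \<omega> + \<omega>' \<in> Lam J p q"
  unfolding Lam_def by (simp add: forms_lin) (simp add: fscale_def)

lemma Lam_zero: "0 \<in> Lam J p q"
proof -
  have "(0 :: ('a \<times> 'a) list \<Rightarrow> complex) \<in> forms k" for k
    by (rule formsI) (auto intro!: cdualI)
  then show ?thesis by (simp add: Lam_def)
qed

text \<open>\<open>ext_op\<close> looks at a cochain only with its tensor arguments fixed or with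
  its form arguments fixed. Together with \<open>cochains_tens\<close> this lets forms and tensors
  be treated separately.\<close>

lemma cochains_form:
  assumes "F \<in> cochains J M q"
  shows "(\<lambda>xs. F (xs, as)) \<in> Lam J 0 q"
  using assms unfolding cochains_def
proof (induction rule: fvs.span_induct_alt)
  case base
  show ?case using Lam_zero by (simp add: zero_fun_def)
next
  case (step c x y)
  then obtain \<eta> e where x: "x = cotensor \<eta> e" "\<eta> \<in> Lam J 0 q" by blast
  have "(\<lambda>xs. (fscale c x + y) (xs, as)) = fscale (c * e as) \<eta> + (\<lambda>xs. y (xs, as))"
    by (auto simp: x cotensor_def fscale_def)
  then show ?case using Lam_lin[OF x(2) step(2)] by simp
qed

lemma cochains_tens:
  assumes J: "linear J" and "F \<in> cochains J M q"
  shows "(\<lambda>as. F (xs, as)) \<in> espace J M"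
  using assms(2) unfolding cochains_def
proof (induction rule: fvs.span_induct_alt)
  case base
  show ?case using espace_zero[OF J] by (simp add: zero_fun_def)
next
  case (step c x y)
  then obtain \<eta> e where x: "x = cotensor \<eta> e" "e \<in> espace J M" by blast
  have "(\<lambda>as. (fscale c x + y) (xs, as)) = fscale (c * \<eta> xs) e + (\<lambda>as. y (xs, as))"
    by (auto simp: x cotensor_def fscale_def)
  then show ?case using espace_add[OF J espace_scale[OF J x(2)] step(2)] by simp
qed

text \<open>Tensors for \<open>J'\<close> become tensors for \<open>J\<close>: vectors are moved by
  \<open>a\<close>, covectors are pulled back along \<open>b\<close>.\<close>

locale tens_transport =
  fixes J' J :: "'g::real_vector \<Rightarrow> 'g" and a b :: "'g \<times> 'g \<Rightarrow> 'g \<times> 'g"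
  assumes J': "linear J'" and J: "linear J"
    and a_add: "\<And>u v. a (u + v) = a u + a v" and a_scale: "\<And>c u. a (cscale c u) = cscale c (a u)"
    and a_mem: "\<And>v. v \<in> g10 J' \<Longrightarrow> a v \<in> g10 J"
    and b_dual: "\<And>\<omega>. \<omega> \<in> g10_dual J' \<Longrightarrow> (\<lambda>u. \<omega> (b u)) \<in> g10_dual J"
begin

abbreviation "tr \<equiv> map (tr_arg a b)"

lemma vec_tensor_tr: "(\<lambda>as. vec_tensor v (tr as)) = vec_tensor (a v)"
  by (rule ext) (auto simp: vec_tensor_def tr_arg_def cdual_comp a_add a_scale
      split: list.splits arg.splits if_splits)

lemma cov_tensor_tr: "(\<lambda>as. cov_tensor \<omega> (tr as)) = cov_tensor (\<lambda>u. \<omega> (b u))"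
  by (rule ext) (auto simp: cov_tensor_def tr_arg_def split: list.splits arg.splits)

lemma espace_tr: "e \<in> espace J' M \<Longrightarrow> (\<lambda>as. e (tr as)) \<in> espace J M"
proof (induction M arbitrary: e)
  case Tan
  then obtain v where "v \<in> g10 J'" "e = vec_tensor v" unfolding espace.simps by blast
  then show ?case using a_mem by (simp add: vec_tensor_tr)
next
  case Cot
  then obtain \<omega> where "\<omega> \<in> g10_dual J'" "e = cov_tensor \<omega>" unfolding espace.simps by blast
  then show ?case using b_dual by (simp add: cov_tensor_tr)
next
  case (Tensor A B)
  from Tensor.prems show ?case unfolding espace.simps(3)[of J']
  proof (induction rule: fvs.span_induct_alt)
    case base
    show ?case using espace_zero[OF J] by (simp only: zero_fun_def)
  next
    case (step c x y)
    then obtain e f where x: "x = tensor (arity A) e f" "e \<in> espace J' A" "f \<in> espace J' B" by blast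
    have "(\<lambda>as. x (tr as)) = tensor (arity A) (\<lambda>as. e (tr as)) (\<lambda>as. f (tr as))"
      by (simp add: x(1) tensor_def take_map drop_map)
    then have "(\<lambda>as. x (tr as)) \<in> espace J (Tensor A B)"
      unfolding espace.simps using Tensor.IH(1)[OF x(2)] Tensor.IH(2)[OF x(3)]
      by (intro fvs.span_base) blast
    then have "fscale c (\<lambda>as. x (tr as)) + (\<lambda>as. y (tr as)) \<in> espace J (Tensor A B)"
      by (intro espace_add espace_scale J step)
    then show ?case by (simp only: fscale_def plus_fun_def)
  qed
next
  case (Wedge k A)
  from Wedge.prems show ?case unfolding espace.simps(4)[of J']
  proof (induction rule: fvs.span_induct_alt)
    case base
    show ?case using espace_zero[OF J] by (simp only: zero_fun_def)
  next
    case (step c x y)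
    then obtain es where x: "x = wedge_tensor (arity A) es" "length es = k" "set es \<subseteq> espace J' A" by blast
    have "set (map (\<lambda>e as. e (tr as)) es) \<subseteq> espace J A"
      using x(3) Wedge.IH by auto
    moreover have "(\<lambda>as. x (tr as)) = wedge_tensor (arity A) (map (\<lambda>e as. e (tr as)) es)"
      by (simp only: x(1) wedge_tensor_map)
    ultimately have "(\<lambda>as. x (tr as)) \<in> espace J (Wedge k A)"
      unfolding espace.simps using x(2) by (intro fvs.span_base) (metis (mono_tags, lifting) length_map mem_Collect_eq)
    then have "fscale c (\<lambda>as. x (tr as)) + (\<lambda>as. y (tr as)) \<in> espace J (Wedge k A)"
      by (intro espace_add espace_scale J step)
    then show ?case by (simp only: fscale_def plus_fun_def)
  qed
qed

text \<open>The arguments themselves may change under \<open>tr\<close>; only what vectors and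
  covectors of the right type detect has to be preserved.\<close>

lemma espace_tr_id:
  assumes a: "\<And>v. v \<in> g10 J' \<Longrightarrow> a v = v" and b: "\<And>\<omega> u. \<omega> \<in> g10_dual J' \<Longrightarrow> \<omega> (b u) = \<omega> u"
  shows "e \<in> espace J' M \<Longrightarrow> e (tr as) = e as"
proof (induction M arbitrary: e as)
  case Tan
  then obtain v where "v \<in> g10 J'" "e = vec_tensor v" unfolding espace.simps by blast
  then show ?case using fun_cong[OF vec_tensor_tr[of v], of as] by (simp add: a)
next
  case Cot
  then obtain \<omega> where "\<omega> \<in> g10_dual J'" "e = cov_tensor \<omega>" unfolding espace.simps by blast
  then show ?case using fun_cong[OF cov_tensor_tr[of \<omega>], of as] by (simp add: b)
next
  case (Tensor A B)
  from Tensor.prems show ?case unfolding espace.simps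
  proof (induction rule: fvs.span_induct_alt)
    case (step c x y)
    then obtain e f where x: "x = tensor (arity A) e f" "e \<in> espace J' A" "f \<in> espace J' B" by blast
    then have "x (tr as) = x as"
      using Tensor.IH(1)[OF x(2), of "take (arity A) as"] Tensor.IH(2)[OF x(3), of "drop (arity A) as"]
      by (simp only: x(1) tensor_def take_map drop_map)
    then show ?case using step(2) by (simp add: fscale_def)
  qed simp
next
  case (Wedge k A)
  from Wedge.prems show ?case unfolding espace.simps
  proof (induction rule: fvs.span_induct_alt)
    case (step c x y)
    then obtain es where x: "x = wedge_tensor (arity A) es" "length es = k" "set es \<subseteq> espace J' A" by blast
    have "(es ! \<sigma> i) (block (arity A) i (tr as)) = (es ! \<sigma> i) (block (arity A) i as)"
      if "\<sigma> permutes {..<k}" "i < k" for \<sigma> i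
      using Wedge.IH[OF permutes_nth_mem[OF that(1) x(2) that(2) x(3)]] by (simp add: block_map)
    then have "x (tr as) = x as" using x(2) by (simp add: x(1) wedge_tensor_def)
    then show ?case using step(2) by (simp add: fscale_def)
  qed simp
qed

text \<open>The Leibniz extension is natural: it acts on one factor with the other arguments held
  fixed, so intertwining on \<open>Tan\<close> and \<open>Cot\<close> propagates to all modules. The
  direction is \<open>x\<close> on one side and \<open>x'\<close> on the other because the form
  arguments are moved as well.\<close>

lemma leibniz_tr:
  assumes V: "\<And>v. v \<in> g10 J' \<Longrightarrow> \<delta>V (a v) x = a (\<delta>V' v x')"
    and W: "\<And>\<omega> u. \<omega> \<in> g10_dual J' \<Longrightarrow> \<delta>W (\<lambda>u. \<omega> (b u)) x u = \<delta>W' \<omega> x' (b u)"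
  shows "e \<in> espace J' M \<Longrightarrow>
    leibniz J \<delta>V \<delta>W M (\<lambda>as. e (tr as)) x as = leibniz J' \<delta>V' \<delta>W' M e x' (tr as)"
proof (induction M arbitrary: e as)
  case Tan
  then obtain v where v: "v \<in> g10 J'" "e = vec_tensor v" unfolding espace.simps by blast
  \<comment> \<open>The \<open>THE\<close> in \<open>leibniz\<close> returns the intended vector
    because \<open>vec_tensor\<close> is injective.\<close>
  have "leibniz J \<delta>V \<delta>W Tan (\<lambda>as. e (tr as)) x as = vec_tensor (a (\<delta>V' v x')) as"
    using a_mem[OF v(1)] V[OF v(1)]
    by (simp add: v(2) vec_tensor_tr vec_tensor_inject)
       (metis (mono_tags, lifting) the_equality)
  also have "\<dots> = vec_tensor (\<delta>V' v x') (tr as)"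
    using fun_cong[OF vec_tensor_tr, of "\<delta>V' v x'" as] by simp
  also have "\<dots> = leibniz J' \<delta>V' \<delta>W' Tan e x' (tr as)"
    using v by (simp add: vec_tensor_inject) (metis (mono_tags, lifting) the_equality)
  finally show ?case .
next
  case Cot
  then obtain \<omega> where \<omega>: "\<omega> \<in> g10_dual J'" "e = cov_tensor \<omega>" unfolding espace.simps by blast
  have ev: "(\<lambda>u. cov_tensor \<psi> [Vec u]) = \<psi>" for \<psi> :: "'g \<times> 'g \<Rightarrow> complex" by (simp add: cov_tensor_def)
  have "leibniz J \<delta>V \<delta>W Cot (\<lambda>as. e (tr as)) x as = cov_tensor (\<lambda>u. \<delta>W' \<omega> x' (b u)) as"
    unfolding leibniz.simps \<omega>(2) cov_tensor_tr ev using W[OF \<omega>(1)] by presburger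
  also have "\<dots> = leibniz J' \<delta>V' \<delta>W' Cot e x' (tr as)"
    unfolding leibniz.simps \<omega>(2) ev using fun_cong[OF cov_tensor_tr[of "\<delta>W' \<omega> x'"], of as] by simp
  finally show ?case .
next
  case (Tensor A B)
  show ?case
  proof (cases "length as = arity A + arity B")
    case True
    have "leibniz J \<delta>V \<delta>W A (\<lambda>bs. e (tr bs @ tr (drop (arity A) as))) x (take (arity A) as) =
        leibniz J' \<delta>V' \<delta>W' A (\<lambda>bs. e (bs @ tr (drop (arity A) as))) x' (tr (take (arity A) as))"
      using True by (intro Tensor.IH(1) espace_tensor_left[OF J' Tensor.prems]) simp
    moreover have "leibniz J \<delta>V \<delta>W B (\<lambda>bs. e (tr (take (arity A) as) @ tr bs)) x (drop (arity A) as) =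
        leibniz J' \<delta>V' \<delta>W' B (\<lambda>bs. e (tr (take (arity A) as) @ bs)) x' (tr (drop (arity A) as))"
      using True by (intro Tensor.IH(2) espace_tensor_right[OF J' Tensor.prems]) simp
    ultimately show ?thesis using True by (simp add: take_map drop_map)
  qed simp
next
  case (Wedge k A)
  show ?case
  proof (cases "length as = k * arity A")
    case True
    have "leibniz J \<delta>V \<delta>W A (\<lambda>bs. e (tr (take (i * arity A) as) @ tr bs @ tr (drop (Suc i * arity A) as))) x
          (block (arity A) i as) =
        leibniz J' \<delta>V' \<delta>W' A (\<lambda>bs. e (tr (take (i * arity A) as) @ bs @ tr (drop (Suc i * arity A) as))) x'
          (tr (block (arity A) i as))" if i: "i < k" for i
    proof (intro Wedge.IH espace_wedge_mid[OF J' Wedge.prems i])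
      have "i * arity A \<le> k * arity A" using i by (intro mult_le_mono1) simp
      then show "length (tr (take (i * arity A) as)) = i * arity A"
        "length (tr (drop (Suc i * arity A) as)) = (k - Suc i) * arity A"
        using True by (auto simp: diff_mult_distrib)
    qed
    then show ?thesis using True
      by (simp add: take_map drop_map block_map del: mult_Suc)
  qed simp
qed

lemma cochains_transport:
  assumes \<alpha>: "\<And>\<eta>. \<eta> \<in> Lam J' 0 q \<Longrightarrow> (\<lambda>xs. \<eta> (map \<alpha> xs)) \<in> Lam J 0 q"
    and F: "F \<in> cochains J' M q"
  shows "transport \<alpha> a b F \<in> cochains J M q"
  using F unfolding cochains_def
proof (induction rule: fvs.span_induct_alt)
  case base
  have 0: "transport \<alpha> a b 0 = 0" by (auto simp: transport_def)
  show ?case unfolding 0 by (rule fvs.span_zero)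
next
  case (step c x y)
  then obtain \<eta> e where x: "x = cotensor \<eta> e" "\<eta> \<in> Lam J' 0 q" "e \<in> espace J' M" by blast
  have "transport \<alpha> a b x = cotensor (\<lambda>xs. \<eta> (map \<alpha> xs)) (\<lambda>as. e (tr as))"
    by (auto simp: x(1) transport_def cotensor_def)
  then have "transport \<alpha> a b x \<in> fvs.span {cotensor \<eta> e |\<eta> e. \<eta> \<in> Lam J 0 q \<and> e \<in> espace J M}"
    using \<alpha>[OF x(2)] espace_tr[OF x(3)] by (intro fvs.span_base) blast
  then show ?case
    unfolding transport_add transport_scale by (intro fvs.span_add fvs.span_scale step)
qed

lemma cochains_transport_id:
  assumes F: "F \<in> cochains J' M q"
    and \<alpha>: "\<And>\<eta> xs. \<eta> \<in> Lam J' 0 q \<Longrightarrow> \<eta> (map \<alpha> xs) = \<eta> xs"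
    and a: "\<And>v. v \<in> g10 J' \<Longrightarrow> a v = v" and b: "\<And>\<omega> u. \<omega> \<in> g10_dual J' \<Longrightarrow> \<omega> (b u) = \<omega> u"
  shows "transport \<alpha> a b F = F"
proof (intro ext, clarify)
  fix xs as
  have "F (map \<alpha> xs, tr as) = F (xs, tr as)"
    using \<alpha>[OF cochains_form[OF F]] .
  also have "\<dots> = F (xs, as)"
    using espace_tr_id[OF a b cochains_tens[OF J' F]] .
  finally show "transport \<alpha> a b F (xs, as) = F (xs, as)" by (simp add: transport_def)
qed

text \<open>This reduces compatibility with the differentials to three checks: on forms of type
  (0,q), on vectors and on covectors.\<close>

lemma ext_op_transport:
  assumes F: "F \<in> cochains J' M q"
    and d: "\<And>\<eta> xs. \<eta> \<in> Lam J' 0 q \<Longrightarrow> d (\<lambda>ys. \<eta> (map \<alpha> ys)) xs = d' \<eta> (map \<alpha> xs)"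
    and V: "\<And>v x. v \<in> g10 J' \<Longrightarrow> \<delta>V (a v) x = a (\<delta>V' v (\<alpha> x))"
    and W: "\<And>\<omega> x u. \<omega> \<in> g10_dual J' \<Longrightarrow> \<delta>W (\<lambda>u. \<omega> (b u)) x u = \<delta>W' \<omega> (\<alpha> x) (b u)"
  shows "ext_op d (leibniz J \<delta>V \<delta>W M) q (transport \<alpha> a b F) =
    transport \<alpha> a b (ext_op d' (leibniz J' \<delta>V' \<delta>W' M) q F)"
proof (intro ext, clarify)
  fix xs as
  have 1: "d (\<lambda>ys. F (map \<alpha> ys, tr as)) xs = d' (\<lambda>ys. F (ys, tr as)) (map \<alpha> xs)"
    by (rule d[OF cochains_form[OF F]])
  have 2: "leibniz J \<delta>V \<delta>W M (\<lambda>bs. F (map \<alpha> (map (\<lambda>i. xs ! \<sigma> i) [0..<q]), tr bs)) (xs ! \<sigma> q) as =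
      leibniz J' \<delta>V' \<delta>W' M (\<lambda>bs. F (map (\<lambda>i. map \<alpha> xs ! \<sigma> i) [0..<q], bs)) (map \<alpha> xs ! \<sigma> q) (tr as)"
    if "\<sigma> permutes {..<q + 1}" "length xs = q + 1" for \<sigma>
  proof -
    have \<sigma>: "i \<le> q \<Longrightarrow> \<sigma> i < length xs" for i using permutes_in_image[OF that(1), of i] that(2) by simp
    then have "map \<alpha> (map (\<lambda>i. xs ! \<sigma> i) [0..<q]) = map (\<lambda>i. map \<alpha> xs ! \<sigma> i) [0..<q]" by simp
    moreover have "map \<alpha> xs ! \<sigma> q = \<alpha> (xs ! \<sigma> q)" using \<sigma>[of q] by simp
    moreover have "leibniz J \<delta>V \<delta>W M (\<lambda>bs. F (zs, tr bs)) x as =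
        leibniz J' \<delta>V' \<delta>W' M (\<lambda>bs. F (zs, bs)) (\<alpha> x) (tr as)" for zs x
      by (rule leibniz_tr) (rule V W cochains_tens[OF J' F], assumption?)+
    ultimately show ?thesis by (simp only:)
  qed
  have 3: "(\<Sum>\<sigma> | \<sigma> permutes {..<q + 1}. of_int (sign \<sigma>) *
        leibniz J \<delta>V \<delta>W M (\<lambda>bs. F (map \<alpha> (map (\<lambda>i. xs ! \<sigma> i) [0..<q]), tr bs)) (xs ! \<sigma> q) as) =
      (\<Sum>\<sigma> | \<sigma> permutes {..<q + 1}. of_int (sign \<sigma>) *
        leibniz J' \<delta>V' \<delta>W' M (\<lambda>bs. F (map (\<lambda>i. map \<alpha> xs ! \<sigma> i) [0..<q], bs)) (map \<alpha> xs ! \<sigma> q) (tr as))"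
    if "length xs = q + 1"
    by (intro sum.cong refl arg_cong2[where f = "(*)"] 2 that) (simp only: mem_Collect_eq)
  show "ext_op d (leibniz J \<delta>V \<delta>W M) q (transport \<alpha> a b F) (xs, as) =
    transport \<alpha> a b (ext_op d' (leibniz J' \<delta>V' \<delta>W' M) q F) (xs, as)"
    unfolding transport_def ext_op_def split 1
    by (cases "length xs = q + 1") (simp_all only: length_map if_True if_False 3 simp_thms)
qed

end

section \<open>Isomorphisms of cohomology\<close>

lemma elt_set_plus_image: "a +o B = (+) a ` B"
  by (auto simp: elt_set_plus_def)

text \<open>
  The maps \<open>T\<close> and \<open>S\<close> are defined on all functions, but are inverse to each other only on
  cochains; \<open>ST_D\<close> replaces the inclusion of the coboundaries in the cochains.
\<close>

lemma cohomology_isoI: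
  fixes T :: "('x \<Rightarrow> complex) \<Rightarrow> 'y \<Rightarrow> complex" and S :: "('y \<Rightarrow> complex) \<Rightarrow> 'x \<Rightarrow> complex"
  assumes T_add: "\<And>F G. T (F + G) = T F + T G" and T_scale: "\<And>c F. T (fscale c F) = fscale c (T F)"
    and S_add: "\<And>F G. S (F + G) = S F + S G"
    and T: "\<And>k F. F \<in> C k \<Longrightarrow> T F \<in> C' k" and S: "\<And>k G. G \<in> C' k \<Longrightarrow> S G \<in> C k"
    and ST: "\<And>k F. F \<in> C k \<Longrightarrow> S (T F) = F" and TS: "\<And>k G. G \<in> C' k \<Longrightarrow> T (S G) = G"
    and ST_D: "\<And>k F. F \<in> C k \<Longrightarrow> S (T (D k F)) = D k F"
    and comm: "\<And>k F. F \<in> C k \<Longrightarrow> T (D k F) = D' k (T F)"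
  shows "cohomology_iso C D C' D' q"
proof -
  let ?B = "coboundaries C D q" and ?B' = "coboundaries C' D' q"
  have T0: "T 0 = 0" using T_add[of 0 0] by simp
  have S0: "S 0 = 0" using S_add[of 0 0] by simp
  have TB: "T ` ?B = ?B'"
  proof (cases q)
    case 0
    then show ?thesis by (simp add: coboundaries_def T0)
  next
    case (Suc p)
    have "T ` D p ` C p = D' p ` T ` C p" unfolding image_image by (rule image_cong[OF refl comm])
    also have "T ` C p = C' p"
    proof (intro equalityI subsetI)
      fix G assume G: "G \<in> C' p"
      show "G \<in> T ` C p" using TS[OF G, symmetric] S[OF G] by (rule image_eqI)
    qed (use T in blast)
    finally show ?thesis using Suc by (simp add: coboundaries_def)
  qed
  have ST_B: "S (T b) = b" if "b \<in> ?B" for b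
  proof (cases q)
    case 0
    then have "b = 0" using that by (simp add: coboundaries_def)
    then show ?thesis by (simp only: T0 S0)
  next
    case (Suc p)
    then have "b \<in> D p ` C p" using that by (simp add: coboundaries_def)
    then show ?thesis using ST_D by blast
  qed
  have coset: "T ` (F +o ?B) = T F +o ?B'" for F
    unfolding TB[symmetric] elt_set_plus_image image_image by (simp only: T_add)
  have ST_K: "S ` T ` K = K" if K: "K \<in> cohomology C D q" for K
  proof -
    obtain F where F: "F \<in> C q" "K = F +o ?B" using K unfolding cohomology_def cocycles_def by blast
    have "S (T x) = x" if "x \<in> K" for x
    proof -
      obtain b where "x = F + b" "b \<in> ?B" using \<open>x \<in> K\<close> unfolding F(2) elt_set_plus_def by blast
      then show ?thesis by (simp only: T_add S_add ST[OF F(1)] ST_B)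
    qed
    then show ?thesis by (simp add: image_image)
  qed
  have T_cocycle: "T F \<in> cocycles C' D' q" if "F \<in> cocycles C D q" for F
  proof -
    have F: "F \<in> C q" "D q F = 0" using that unfolding cocycles_def by blast+
    show ?thesis using T[OF F(1)] comm[OF F(1)] unfolding F(2) T0 cocycles_def by simp
  qed
  have S_cocycle: "S G \<in> cocycles C D q" if "G \<in> cocycles C' D' q" for G
  proof -
    have G: "G \<in> C' q" "D' q G = 0" using that unfolding cocycles_def by blast+
    \<comment> \<open>That \<open>S\<close> preserves cocycles is deduced from \<open>comm\<close>
      for \<open>T\<close>, by inserting \<open>S \<circ> T\<close> in front of the
      differential.\<close>
    have "D q (S G) = S (T (D q (S G)))" by (rule ST_D[OF S[OF G(1)], symmetric])
    also have "\<dots> = 0" by (simp only: comm[OF S[OF G(1)]] TS[OF G(1)] G(2) S0)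
    finally show ?thesis using S[OF G(1)] by (simp add: cocycles_def)
  qed
  have "bij_betw ((`) T) (cohomology C D q) (cohomology C' D' q)"
  proof (rule bij_betwI')
    fix K L assume K: "K \<in> cohomology C D q" and L: "L \<in> cohomology C D q"
    show "(T ` K = T ` L) = (K = L)"
    proof
      assume eq: "T ` K = T ` L"
      have "K = S ` T ` K" by (rule ST_K[OF K, symmetric])
      also have "\<dots> = L" unfolding eq by (rule ST_K[OF L])
      finally show "K = L" .
    qed (rule arg_cong)
  next
    fix K assume "K \<in> cohomology C D q"
    then obtain F where F: "F \<in> cocycles C D q" and K: "K = F +o ?B" unfolding cohomology_def by blast
    show "T ` K \<in> cohomology C' D' q" unfolding K coset cohomology_def by (rule imageI[OF T_cocycle[OF F]])
  next
    fix L assume "L \<in> cohomology C' D' q"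
    then obtain G where G: "G \<in> cocycles C' D' q" "L = G +o ?B'" unfolding cohomology_def by blast
    have "G \<in> C' q" using G(1) unfolding cocycles_def by blast
    then have "L = T ` (S G +o ?B)" unfolding coset G(2) by (simp only: TS)
    moreover have "S G +o ?B \<in> cohomology C D q"
      unfolding cohomology_def by (rule imageI[OF S_cocycle[OF G(1)]])
    ultimately show "\<exists>K\<in>cohomology C D q. L = T ` K" by (rule bexI)
  qed
  moreover have plus: "T ` (K + L) = T ` K + T ` L" for K L
  proof (intro equalityI subsetI)
    fix z assume "z \<in> T ` (K + L)"
    then obtain a b where ab: "a \<in> K" "b \<in> L" and z: "z = T (a + b)" unfolding set_plus_def by blast
    show "z \<in> T ` K + T ` L" unfolding z T_add by (intro set_plus_intro imageI ab)
  next
    fix z assume "z \<in> T ` K + T ` L"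
    then obtain a b where ab: "a \<in> K" "b \<in> L" and z: "z = T a + T b" unfolding set_plus_def by blast
    show "z \<in> T ` (K + L)" unfolding z T_add[symmetric] by (intro set_plus_intro imageI ab)
  qed
  moreover have "T ` class_scale C D q c K = class_scale C' D' q c (T ` K)" for c K
    unfolding class_scale_def plus TB by (simp add: image_image T_scale)
  ultimately show ?thesis unfolding cohomology_iso_def by (intro exI[of _ "(`) T"] conjI ballI allI)
qed

section \<open>The comparison of the two complexes\<close>

lemma act_cov_eq:
  assumes "almost_complex J" "lie_algebra br" "\<omega> \<in> cdual"
  shows "act_cov br J \<omega> x u = - \<omega> (cbr br (pr01 J x) (pr10 J u))"
proof -
  interpret almost_complex J by fact
  interpret lie_algebra br by fact
  show ?thesis
    by (simp add: act_cov_def contr_def delbar_def bideg_1 lessThan_Suc ce_d_one one_form_def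
        pr_simps cdual_zero[OF assms(3)])
qed

lemma almost_complexI: "complex_structure br J \<Longrightarrow> almost_complex J"
  unfolding complex_structure_def by (intro almost_complex.intro) blast+

text \<open>For \<open>u = (a, J a)\<close> and \<open>v = (b, J b)\<close> membership means that
  \<open>J\<close> maps the real part of the bracket to its imaginary part. This is the Nijenhuis
  condition after one application of \<open>J\<close>.\<close>

lemma g01_cbr:
  assumes br: "lie_algebra br" and J: "complex_structure br J" and uv: "u \<in> g01 J" "v \<in> g01 J"
  shows "cbr br u v \<in> g01 J"
proof -
  interpret lie_algebra br by fact
  interpret almost_complex J using J by (rule almost_complexI)
  obtain a b where ab: "u = (a, J a)" "v = (b, J b)"
    using uv by (cases u, cases v) (auto simp: g01_iff)
  have N: "br (J a) (J b) - br a b = J (br (J a) b + br a (J b))"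
    using J by (simp add: complex_structure_def J_simps algebra_simps)
  have "J (br a b - br (J a) (J b)) = - J (br (J a) (J b) - br a b)" by (simp add: J_simps)
  also have "\<dots> = br (J a) b + br a (J b)" by (simp only: N sq minus_minus)
  finally show ?thesis
    using N by (simp add: g01_iff cbr_def ab add.commute)
qed

text \<open>\<open>g10 J\<close> is \<open>g01\<close> of the structure \<open>- J\<close>, and the
  Nijenhuis condition is even in \<open>J\<close>.\<close>

lemma g10_cbr_closed:
  assumes br: "lie_algebra br" and J: "complex_structure br J" and uv: "u \<in> g10 J" "v \<in> g10 J"
  shows "cbr br u v \<in> g10 J"
proof -
  have g: "w \<in> g10 J \<longleftrightarrow> w \<in> g01 (\<lambda>x. - J x)" for w
    unfolding g10_iff g01_iff by (metis minus_minus)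
  interpret lie_algebra br by fact
  have lin: "linear J" using J by (simp add: complex_structure_def)
  have neg: "br (- x) y = - br x y" "br x (- y) = - br x y" for x y
    using br_simps(5)[of "-1" x y] br_simps(6)[of x "-1" y] by simp_all
  have "complex_structure br (\<lambda>x. - J x)"
    using J linear_compose_neg[OF lin] by (simp add: complex_structure_def neg linear_neg[OF lin])
  then show ?thesis using g01_cbr[OF br] uv unfolding g by blast
qed

section \<open>The deformed structure and the transports between the two complexes\<close>

locale deformation = beltrami br J Z \<phi>
  for br :: "'g::real_vector \<Rightarrow> 'g \<Rightarrow> 'g" and J Z \<phi> +
  fixes J' :: "'g \<Rightarrow> 'g"
  assumes det: "determines br J \<phi> J'"
begin

lemma t_complex_structure: "complex_structure br J'"
  using det unfolding determines_def by blast

sublocale t: almost_complex J'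
  using t_complex_structure by (rule almost_complexI)

lemma bracket: "lie_algebra br" ..

lemma t_cbr: "u \<in> g01 J' \<Longrightarrow> v \<in> g01 J' \<Longrightarrow> cbr br u v \<in> g01 J'"
  by (rule g01_cbr[OF bracket t_complex_structure])

lemma t_g01: "g01 J' = (\<lambda>x. x - \<phi> x) ` g01 J"
  using det unfolding determines_def by blast

lemma rho_add: "rho (u + v) = rho u + rho v" and rho_scale: "rho (cscale c u) = cscale c (rho u)"
  by (simp_all add: rho_def pr01_add phi_add pr01_scale phi_scale cvs.scale_right_diff_distrib)

lemma proj_add: "proj (u + v) = proj u + proj v" and proj_scale: "proj (cscale c u) = cscale c (proj u)"
  by (simp_all add: proj_def pr10_add phi_add pr10_scale phi_scale cvs.scale_right_distrib)

lemma rho_mem: "rho x \<in> g01 J'"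
  unfolding t_g01 rho_def using pr01_mem[of x] phi_pr01[of x] by (metis image_eqI)

lemma rho_g10: "x \<in> g10 J \<Longrightarrow> rho x = 0"
  by (simp add: rho_def pr01_g10 phi_g10)

lemma pr01_rho: "pr01 J (rho x) = pr01 J x"
  by (simp add: rho_def pr01_diff pr_simps pr01_g10[OF phi_mem])

lemma rho_g01: "v \<in> g01 J' \<Longrightarrow> rho v = v"
  unfolding t_g01 by (auto simp: rho_def pr01_diff pr01_g10[OF phi_mem] pr01_g01 phi_diff phi_g10[OF phi_mem])

lemma rho_pr01: "rho (pr01 J x) = rho x"
  by (simp add: rho_def pr_simps phi_pr01)

lemma proj_rho: "proj v + rho v = v"
  by (simp add: proj_def rho_def pr_sum)

lemma proj_mem: "proj v \<in> g10 J"
  unfolding proj_def by (intro g10_add lin pr10_mem phi_mem)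

lemma proj_g10: "v \<in> g10 J \<Longrightarrow> proj v = v"
  by (simp add: proj_def pr10_g10 phi_g10)

lemma proj_g01: "v \<in> g01 J' \<Longrightarrow> proj v = 0"
  using proj_rho[of v] rho_g01[of v] by simp

lemma proj_pr10: "proj (pr10 J' v) = proj v"
  using proj_add[of "pr10 J' v" "pr01 J' v"] proj_g01[OF t.pr01_mem] by (simp add: t.pr_sum)

lemma t_pr10_proj: "pr10 J' (proj v) = pr10 J' v"
  using t.pr10_add[of "proj v" "rho v"] t.pr10_g01[OF rho_mem] by (simp add: proj_rho)

lemma cdual_proj:
  assumes "\<omega> \<in> g10_dual J'"
  shows "\<omega> (proj v) = \<omega> v"
proof -
  have "\<omega> \<in> cdual" "\<omega> (rho v) = 0" using assms rho_mem by (auto simp: g10_dual_def)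
  then show ?thesis using cdual_add[of \<omega> "proj v" "rho v"] by (simp add: proj_rho)
qed

lemma cdual_pr10:
  assumes "\<omega> \<in> g10_dual J"
  shows "\<omega> (pr10 J v) = \<omega> v"
proof -
  have "\<omega> \<in> cdual" "\<omega> (pr01 J v) = 0" using assms pr01_mem by (auto simp: g10_dual_def)
  then show ?thesis using cdual_add[of \<omega> "pr10 J v" "pr01 J v"] by (simp add: pr_sum)
qed

lemma g10_dual_pr10:
  assumes "\<omega> \<in> g10_dual J'"
  shows "(\<lambda>u. \<omega> (pr10 J u)) \<in> g10_dual J"
proof -
  have W: "\<omega> \<in> cdual" using assms by (simp add: g10_dual_def)
  show ?thesis
    unfolding g10_dual_def using cdual_comp[OF W pr10_add pr10_scale] by (simp add: pr10_g01 cdual_zero[OF W])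
qed

lemma g10_dual_proj:
  assumes "\<omega> \<in> g10_dual J"
  shows "(\<lambda>u. \<omega> (proj u)) \<in> g10_dual J'"
proof -
  have W: "\<omega> \<in> cdual" using assms by (simp add: g10_dual_def)
  show ?thesis
    unfolding g10_dual_def using cdual_comp[OF W proj_add proj_scale] by (simp add: proj_g01 cdual_zero[OF W])
qed

sublocale T: tens_transport J' J proj "pr10 J"
  by (intro tens_transport.intro lin t.lin proj_add proj_scale proj_mem g10_dual_pr10)

sublocale S: tens_transport J J' "pr10 J'" proj
  by (intro tens_transport.intro lin t.lin t.pr10_add t.pr10_scale t.pr10_mem g10_dual_proj)

text \<open>\<open>I\<close> and \<open>I0\<close> carry the coefficient maps of the two round
  trips, from \<open>J'\<close> to \<open>J'\<close> and from \<open>J\<close> to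
  \<open>J\<close>.\<close>

sublocale I: tens_transport J' J' "pr10 J'" proj
proof (intro tens_transport.intro t.lin t.pr10_add t.pr10_scale t.pr10_mem)
  fix \<omega> assume "\<omega> \<in> g10_dual J'"
  then show "(\<lambda>u. \<omega> (proj u)) \<in> g10_dual J'" by (simp only: cdual_proj[of \<omega>])
qed

sublocale I0: tens_transport J J proj "pr10 J"
proof (intro tens_transport.intro lin proj_add proj_scale proj_mem)
  fix \<omega> assume "\<omega> \<in> g10_dual J"
  then show "(\<lambda>u. \<omega> (pr10 J u)) \<in> g10_dual J" by (simp only: cdual_pr10[of \<omega>])
qed

abbreviation "TT \<equiv> transport rho proj (pr10 J)"
text \<open>On \<open>g01 J'\<close> the inverse of \<open>rho\<close> is \<open>pr01 J\<close>; the
  preceding \<open>pr01 J'\<close> makes pulled-back forms vanish on \<open>g10 J'\<close>. On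
  coefficients \<open>pr10 J'\<close> inverts \<open>proj\<close> between \<open>g10 J'\<close> and
  \<open>g10 J\<close>.\<close>

abbreviation "SS \<equiv> transport (\<lambda>x. pr01 J (pr01 J' x)) (pr10 J') proj"
abbreviation "II \<equiv> transport (pr01 J') (pr10 J') proj"

text \<open>The round trip still projects all arguments, and so it is not the identity on arbitrary
  functions; cochains do not notice the projections, by \<open>I_cochain\<close>.\<close>

lemma S_T: "SS (TT F) = II F"
proof -
  have 1: "rho (pr01 J (pr01 J' x)) = pr01 J' x" for x
    by (simp add: rho_pr01 rho_g01[OF t.pr01_mem])
  have 2: "tr_arg proj (pr10 J) (tr_arg (pr10 J') proj x) = tr_arg (pr10 J') proj x" for x
    by (auto simp: tr_arg_def t_pr10_proj pr10_g10[OF proj_mem] cdual_comp t.pr10_add t.pr10_scale split: arg.splits)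
  show ?thesis by (rule ext) (auto simp: transport_def 1 2 o_def)
qed

lemma T_S:
  assumes "G \<in> cochains J M q"
  shows "TT (SS G) = G"
proof -
  have 1: "pr01 J (pr01 J' (rho x)) = pr01 J x" for x
    by (simp add: t.pr01_g01[OF rho_mem] pr01_rho)
  have 2: "tr_arg (pr10 J') proj (tr_arg proj (pr10 J) x) = tr_arg proj (pr10 J) x" for x
    by (auto simp: tr_arg_def proj_pr10 proj_g10[OF pr10_mem] cdual_comp proj_add proj_scale split: arg.splits)
  have "TT (SS G) = transport (pr01 J) proj (pr10 J) G"
    by (rule ext) (auto simp: transport_def 1 2 o_def)
  also have "\<dots> = G"
    by (rule I0.cochains_transport_id[OF assms Lam_pr01 proj_g10 cdual_pr10])
  finally show ?thesis .
qed

lemma I_cochain: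
  assumes "F \<in> cochains J' M q"
  shows "II F = F"
  by (rule I.cochains_transport_id[OF assms t.Lam_pr01 t.pr10_g10 cdual_proj])

lemma T_cochain: "F \<in> cochains J' M q \<Longrightarrow> TT F \<in> cochains J M q"
  by (rule T.cochains_transport[OF Lam_map[OF _ rho_add rho_scale rho_g10]])

lemma S_cochain: "G \<in> cochains J M q \<Longrightarrow> SS G \<in> cochains J' M q"
  by (rule S.cochains_transport[OF t.Lam_map])
    (simp_all add: t.pr01_add t.pr01_scale pr01_add pr01_scale t.pr01_g10 pr01_zero)

lemma T_dbar:
  assumes F: "F \<in> cochains J' M q"
  shows "TT (dbar br J' M q F) = dbar_phi br J Z \<phi> M q (TT F)"
  unfolding dbar_def dbar_phi_def
proof (rule T.ext_op_transport[OF F, symmetric])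
  fix \<eta> xs assume \<eta>: "\<eta> \<in> Lam J' 0 q"
  let ?B = "\<lambda>u v. cbr br u v - (cbr br (\<phi> u) v - cbr br (\<phi> v) u)"
  have B: "rho (?B (pr01 J x) (pr01 J y)) = cbr br (rho x) (rho y)" for x y
  proof -
    define u v where "u = pr01 J x" and "v = pr01 J y"
    have uv: "rho x = u - \<phi> u" "rho y = v - \<phi> v" by (simp_all add: u_def v_def rho_def phi_pr01)
    \<comment> \<open>The quadratic term lies in \<open>g10 J\<close> and is killed by
      \<open>rho\<close>, whereas the left-hand side lies in the subalgebra \<open>g01 J'\<close>
      and is fixed by \<open>rho\<close>.\<close>
    have "cbr br (rho x) (rho y) = ?B u v + cbr br (\<phi> u) (\<phi> v)"
      unfolding uv cbr_diff_left cbr_diff_right using cbr_anticomm[of u "\<phi> v"] by simp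
    then have "rho (cbr br (rho x) (rho y)) = rho (?B u v)"
      using rho_g10[OF g10_cbr[OF phi_mem phi_mem]] by (simp add: rho_add)
    then show ?thesis
      using rho_g01[OF t_cbr[OF rho_mem rho_mem]] by (simp add: u_def v_def)
  qed
  have rr: "map rho (map (pr01 J) ys) = map rho ys" for ys by (simp add: rho_pr01)
  have tt: "map (pr01 J') (map rho ys) = map rho ys" for ys by (simp add: t.pr01_g01[OF rho_mem])
  have "alt_d ?B (\<lambda>ys. \<eta> (map rho ys)) (map (pr01 J) xs) = alt_d (cbr br) \<eta> (map rho xs)"
  proof (rule alt_d_cong)
    fix i j assume "i < length (map (pr01 J) xs)" "j < length (map (pr01 J) xs)"
    then show "\<eta> (map rho (?B (map (pr01 J) xs ! i) (map (pr01 J) xs ! j) # nths (map (pr01 J) xs) (- {i, j}))) =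
      \<eta> (cbr br (map rho xs ! i) (map rho xs ! j) # nths (map rho xs) (- {i, j}))"
      by (simp only: list.map nths_map rr length_map nth_map B)
  qed simp
  then show "delbar_phi br J Z \<phi> 0 q (\<lambda>ys. \<eta> (map rho ys)) xs = delbar br J' 0 q \<eta> (map rho xs)"
    by (simp only: delbar_phi_0[OF Lam_map[OF \<eta> rho_add rho_scale rho_g10]] delbar_0 tt length_map)
next
  fix v x assume v: "v \<in> g10 J'"
  \<comment> \<open>\<open>v\<close> and \<open>proj v\<close> differ by an element of
    \<open>g01 J'\<close>; its bracket with \<open>rho x\<close> stays there and dies under
    \<open>proj\<close>. This is the independence of the representative in the quotient.\<close>
  have "proj (cbr br (rho x) v) = proj (cbr br (rho x) (proj v)) + proj (cbr br (rho x) (rho v))"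
    by (simp add: proj_rho flip: proj_add cbr_add_right)
  also have "proj (cbr br (rho x) (rho v)) = 0"
    by (rule proj_g01[OF t_cbr[OF rho_mem rho_mem]])
  finally show "phi_vec br J Z \<phi> (proj v) x = proj (act_vec br J' v (rho x))"
    by (simp add: phi_vec_eq[OF proj_mem] act_vec_def proj_pr10 t.pr01_g01[OF rho_mem])
next
  fix \<omega> x u assume \<omega>: "\<omega> \<in> g10_dual J'"
  let ?p = "pr10 J u"
  have W: "\<omega> \<in> cdual" and W0: "\<And>v. v \<in> g01 J' \<Longrightarrow> \<omega> v = 0" using \<omega> by (auto simp: g10_dual_def)
  \<comment> \<open>The dual argument: the part of \<open>?p\<close> in \<open>g01 J'\<close>
    brackets into \<open>g01 J'\<close>, which \<omega> annihilates.\<close>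
  have "\<omega> (cbr br (rho x) ?p) = \<omega> (cbr br (rho x) (pr10 J' ?p)) + \<omega> (cbr br (rho x) (pr01 J' ?p))"
    by (simp add: t.pr_sum flip: cdual_add[OF W] cbr_add_right)
  also have "\<omega> (cbr br (rho x) (pr01 J' ?p)) = 0"
    by (rule W0[OF t_cbr[OF rho_mem t.pr01_mem]])
  finally show "phi_cov br J Z \<phi> (\<lambda>u. \<omega> (pr10 J u)) x u = act_cov br J' \<omega> (rho x) ?p"
    by (simp add: phi_cov_eq[OF g10_dual_pr10[OF \<omega>]] pr10_g10[OF proj_mem] cdual_proj[OF \<omega>]
        act_cov_eq[OF t.almost_complex_axioms bracket W] t.pr01_g01[OF rho_mem])
qed

text \<open>\<open>II\<close> is itself a transport, from \<open>J'\<close> to \<open>J'\<close>,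
  and commutes with the differential by the same three checks. As it fixes cochains, it fixes their
  images under the differential; this supplies \<open>ST_D\<close> without decomposing those images
  into a sum of \<open>cotensor\<close> terms.\<close>

lemma I_dbar:
  assumes F: "F \<in> cochains J' M q"
  shows "II (dbar br J' M q F) = dbar br J' M q F"
proof -
  have "II (dbar br J' M q F) = dbar br J' M q (II F)"
    unfolding dbar_def
  proof (rule I.ext_op_transport[OF F, symmetric])
    fix \<eta> xs assume "\<eta> \<in> Lam J' 0 q"
    then show "delbar br J' 0 q (\<lambda>ys. \<eta> (map (pr01 J') ys)) xs = delbar br J' 0 q \<eta> (map (pr01 J') xs)"
      by (simp add: t.Lam_pr01 delbar_0 t.pr_simps o_def)
  next
    fix v x assume "v \<in> g10 J'"
    then show "act_vec br J' (pr10 J' v) x = pr10 J' (act_vec br J' v (pr01 J' x))"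
      by (simp add: act_vec_def t.pr_simps t.pr10_g10)
  next
    fix \<omega> x u assume \<omega>: "\<omega> \<in> g10_dual J'"
    then have "\<omega> \<in> cdual" by (simp add: g10_dual_def)
    then show "act_cov br J' (\<lambda>u. \<omega> (proj u)) x u = act_cov br J' \<omega> (pr01 J' x) (proj u)"
      by (simp add: cdual_proj[OF \<omega>] act_cov_eq[OF t.almost_complex_axioms bracket] t.pr_simps t_pr10_proj)
  qed
  then show ?thesis by (simp only: I_cochain[OF F])
qed

lemma cohomology_iso: "cohomology_iso (cochains J' M) (dbar br J' M) (cochains J M) (dbar_phi br J Z \<phi> M) q"
proof (rule cohomology_isoI[where T = TT and S = SS])
  fix k F assume F: "F \<in> cochains J' M k"
  show "TT F \<in> cochains J M k" using F by (rule T_cochain)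
  show "SS (TT F) = F" using I_cochain[OF F] by (simp only: S_T)
  show "SS (TT (dbar br J' M k F)) = dbar br J' M k F" using I_dbar[OF F] by (simp only: S_T)
  show "TT (dbar br J' M k F) = dbar_phi br J Z \<phi> M k (TT F)" using F by (rule T_dbar)
next
  fix k G assume G: "G \<in> cochains J M k"
  show "SS G \<in> cochains J' M k" using G by (rule S_cochain)
  show "TT (SS G) = G" using G by (rule T_S)
qed (rule transport_add transport_scale)+

end

text \<open>A real spanning set, embedded as real parts, spans the complexification over the complex
  numbers, and an independent set in a finitely generated span is finite.\<close>

lemma finite_basis10:
  fixes J :: "'g::real_vector \<Rightarrow> 'g"
  assumes S: "finite S" "span S = (UNIV :: 'g set)" and Z: "is_basis10 J Z"
  shows "finite Z"
proof -
  let ?S = "(\<lambda>s. (s, 0 :: 'g)) ` S"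
  have left: "(x, 0) \<in> cvs.span ?S" for x
  proof -
    have "x \<in> span S" using S(2) by simp
    then show ?thesis
    proof (induction rule: span_induct_alt)
      case base
      show ?case using cvs.span_zero[of ?S] by (simp add: zero_prod_def)
    next
      case (step c s y)
      have "(c *\<^sub>R s + y, 0) = cscale (of_real c) (s, 0) + (y, 0)" by (simp add: cscale_def)
      then show ?case using step by (metis cvs.span_add cvs.span_base cvs.span_scale image_eqI)
    qed
  qed
  have "w \<in> cvs.span ?S" for w
  proof -
    have "w = (fst w, 0) + cscale \<i> (snd w, 0)" by (simp add: cscale_def)
    then show ?thesis using left by (metis cvs.span_add cvs.span_scale)
  qed
  then have "Z \<subseteq> cvs.span ?S" by (rule subsetI)
  then show ?thesis
    using Z S(1) cvs.independent_span_bound[of ?S Z] unfolding is_basis10_def by blast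
qed

theorem theorem1p2:
  fixes br :: "'g::real_vector \<Rightarrow> 'g \<Rightarrow> 'g"
    and J :: "'g \<Rightarrow> 'g"
    and Z :: "('g \<times> 'g) set"
    and r :: "real ^ 'm"
    and B :: "(complex ^ 'm) set"
    and \<phi> :: "complex ^ 'm \<Rightarrow> 'g \<times> 'g \<Rightarrow> 'g \<times> 'g"
    and \<epsilon> :: real
    and Jt :: "complex ^ 'm \<Rightarrow> 'g \<Rightarrow> 'g"
    and E :: mexp
  assumes "lie_algebra_with_complex_structure br J"
    and "is_basis10 J Z"
    and "\<And>i. 0 < r $ i"
    and "analytic_subset (polydisc r) B"
    and "0 \<in> B"
    and "holomorphic_family J B \<phi>"
    and "\<phi> 0 = (\<lambda>x. 0)"
    and "\<And>t. t \<in> B \<Longrightarrow> maurer_cartan br J Z (\<phi> t)"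
    and "0 < \<epsilon>"
    and "\<And>t. t \<in> B \<Longrightarrow> norm t < \<epsilon> \<Longrightarrow> determines br J (\<phi> t) (Jt t)"
  shows "\<forall>t\<in>B. norm t < \<epsilon> \<longrightarrow>
    (\<forall>q. cohomology_iso (cochains (Jt t) E) (dbar br (Jt t) E)
                        (cochains J E) (dbar_phi br J Z (\<phi> t) E) q)"
proof (intro ballI impI allI)
  fix t q assume t: "t \<in> B" "norm t < \<epsilon>"
  have L: "lie_bracket br" and J: "complex_structure br J" and fin: "\<exists>S. finite S \<and> span S = (UNIV :: 'g set)"
    using assms(1) by (auto simp: lie_algebra_with_complex_structure_def)
  have br: "lie_algebra br" using L by unfold_locales
  obtain S where "finite S" "span S = (UNIV :: 'g set)" using fin by blast
  then have "finite Z" using assms(2) by (rule finite_basis10)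
  moreover have "\<phi> t \<in> Lam01_T10 J" using assms(6) t(1) by (simp add: holomorphic_family_def)
  ultimately have "beltrami br J Z (\<phi> t)"
    using assms(2) g10_cbr_closed[OF br J]
    by (intro beltrami.intro beltrami_axioms.intro br almost_complexI[OF J])
  then interpret deformation br J Z "\<phi> t" "Jt t"
    using assms(10)[OF t] by (intro deformation.intro deformation_axioms.intro)
  show "cohomology_iso (cochains (Jt t) E) (dbar br (Jt t) E) (cochains J E) (dbar_phi br J Z (\<phi> t) E) q"
    by (rule cohomology_iso)
qed

end
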